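(* Let $\mathfrak{g}$ be a Kac--Moody algebra, $\lambda\in\mathfrak{h}^*$, and let $V$ be any highest weight $\mathfrak{g}$-module with highest weight $\lambda$. Then $$\mathrm{wt}\,V=\big(\mathrm{wt}\,V\cap[\lambda-\mathbb{Z}_{\geq0}\Pi_{J_V}]\big)-\mathbb{Z}_{\geq0}\big(\Delta^+\setminus\Delta^+_{J_V}\big).$$ More strongly, for any $J\subseteq\mathcal{I}$, $$\mathrm{wt}\,V=\big(\mathrm{wt}\,V\cap[\lambda-\mathbb{Z}_{\geq0}\Pi_{J}]\big)-\mathbb{Z}_{\geq0}\big(\Delta^+\setminus\Delta^+_{J}\big)\quad\Longleftrightarrow\quad J\supseteq J_V;$$ so the subsets $J$ for which the decomposition $\mathrm{wt}\,V=\big(\mathrm{wt}\,V\cap[\lambda-\mathbb{Z}_{\geq0}\Pi_{J}]\big)-\mathbb{Z}_{\geq0}\big(\Delta^+\setminus\Delta^+_{J}\big)$ holds form the interval $J_V\subseteq J\subseteq\mathcal{I}$. Furthermore, $$\lambda-\mathbb{Z}_{\geq0}\Pi_J\subseteq\mathrm{wt}\,V\qquad\text{for all }J\subseteq J_V^c.$$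
   Context: $\mathfrak{g}=\mathfrak{g}(A)$ is the complex Kac--Moody Lie algebra of a generalized Cartan matrix $A$ (not necessarily symmetrizable) with finite index set $\mathcal{I}$ (the nodes of the Dynkin diagram), with Cartan subalgebra $\mathfrak{h}$, simple roots $\alpha_i$ and simple co-roots $\alpha_i^\vee$ ($i\in\mathcal{I}$), root system $\Delta$ and positive roots $\Delta^+$. A highest weight module $V$ with highest weight $\lambda$ is a nonzero quotient of the Verma module $M(\lambda)$; $\mathrm{wt}\,V$ is its set of weights. For $J\subseteq\mathcal{I}$: $J^c=\mathcal{I}\setminus J$, $\Pi_J=\{\alpha_j: j\in J\}$, $\Delta_J^+=\Delta^+\cap\mathbb{Z}\Pi_J$. $\mathbb{Z}_{\geq0}S$ is the set of finite non-negative integer combinations of elements of $S$ ($\{0\}$ if $S=\emptyset$), and $C-D=\{c-d:c\in C,d\in D\}$. $J_\lambda=\{i\in\mathcal{I}:\lambda(\alpha_i^\vee)\in\mathbb{Z}_{\geq0}\}$. A subset of $\mathcal{I}$ is independent if no two distinct nodes in it are joined by an edge of the Dynkin diagram. Definition of $J_V$: $J_V\subseteq J_\lambda$ is the union of all independent subsets $I\subseteq J_\lambda$ such that $\lambda-\sum_{i\in I}(\lambda(\alpha_i^\vee)+1)\alpha_i\notin\mathrm{wt}\,V$ and which are minimal with this property, i.e. $\lambda-\sum_{k\in K}(\lambda(\alpha_k^\vee)+1)\alpha_k\in\mathrm{wt}\,V$ for every $K\subsetneq I$. *)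

theory Defs
  imports "HOL-Analysis.Analysis" "HOL-Library.Poly_Mapping"
begin

locale lie_algebra = vector_space scale
  for scale :: "complex \<Rightarrow> 'g::ab_group_add \<Rightarrow> 'g" +
  fixes br :: "'g \<Rightarrow> 'g \<Rightarrow> 'g"
  assumes br_add_left: "br (x + y) z = br x z + br y z"
    and br_add_right: "br z (x + y) = br z x + br z y"
    and br_scale_left: "br (scale c x) y = scale c (br x y)"
    and br_scale_right: "br x (scale c y) = scale c (br x y)"
    and br_self: "br x x = 0"
    and jacobi: "br x (br y z) + br y (br z x) + br z (br x y) = 0"

definition lie_generated ::
  "(complex \<Rightarrow> 'g::ab_group_add \<Rightarrow> 'g) \<Rightarrow> ('g \<Rightarrow> 'g \<Rightarrow> 'g) \<Rightarrow> 'g set \<Rightarrow> 'g set" where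
  "lie_generated sc br S =
     \<Inter>{T. module.subspace sc T \<and> (\<forall>x\<in>T. \<forall>y\<in>T. br x y \<in> T) \<and> S \<subseteq> T}"

text \<open>The nodes of the Dynkin diagram are the elements of the finite type \<open>'i\<close>.\<close>

definition generalized_cartan_matrix :: "int^'i^'i \<Rightarrow> bool" where
  "generalized_cartan_matrix A \<longleftrightarrow>
     (\<forall>i. A$i$i = 2) \<and> (\<forall>i j. i \<noteq> j \<longrightarrow> A$i$j \<le> 0) \<and> (\<forall>i j. A$i$j = 0 \<longrightarrow> A$j$i = 0)"

text \<open>The Cartan subalgebra is a type \<open>'h\<close> of its own, embedded into the Lie algebra \<open>'g\<close>
  by \<open>hemb\<close>; its dual space consists of the linear functions \<open>'h \<Rightarrow> complex\<close>.\<close>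

record ('h, 'i) realization_data =
  hscale :: "complex \<Rightarrow> 'h \<Rightarrow> 'h"
  sroot :: "'i \<Rightarrow> 'h \<Rightarrow> complex"
  scoroot :: "'i \<Rightarrow> 'h"

record ('h, 'i, 'g) km_data = "('h, 'i) realization_data" +
  gscale :: "complex \<Rightarrow> 'g \<Rightarrow> 'g"
  brk :: "'g \<Rightarrow> 'g \<Rightarrow> 'g"
  hemb :: "'h \<Rightarrow> 'g"
  chev_e :: "'i \<Rightarrow> 'g"
  chev_f :: "'i \<Rightarrow> 'g"

definition hdual :: "('h::ab_group_add, 'i, 'z) realization_data_scheme \<Rightarrow> ('h \<Rightarrow> complex) set" where
  "hdual L = {\<mu>. Vector_Spaces.linear (hscale L) (*) \<mu>}"

text \<open>Finite-dimensionality of \<open>'h\<close> is demanded separately because \<open>dim\<close> is \<open>0\<close> on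
  infinite-dimensional spaces.\<close>

locale realization = vector_space "hscale L"
  for A :: "int^'i::finite^'i"
  and L :: "('h::ab_group_add, 'i, 'z) realization_data_scheme" +
  assumes finite_dim: "\<exists>B. finite B \<and> span B = UNIV"
    and dim_h: "dim (UNIV :: 'h set) + rank (\<chi> i j. complex_of_int (A$i$j)) = 2 * CARD('i)"
    and sroot_hdual: "sroot L i \<in> hdual L"
    and sroot_indep: "(\<forall>h. (\<Sum>i\<in>UNIV. c i * sroot L i h) = 0) \<Longrightarrow> c i = 0"
    and scoroot_indep: "(\<Sum>i\<in>UNIV. hscale L (c i) (scoroot L i)) = 0 \<Longrightarrow> c i = 0"
    and pairing: "sroot L j (scoroot L i) = complex_of_int (A$i$j)"

text \<open>The Lie algebras below are the quotients of the algebra presented by the Chevalley--Serre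
  relations by an ideal meeting the Cartan subalgebra trivially. Both usual meanings of
  the Kac--Moody algebra of \<open>A\<close> are among them: the presented algebra itself, and its
  quotient by the largest such ideal. For symmetrizable \<open>A\<close> there is only one such algebra
  (Gabber--Kac).\<close>

locale kac_moody_algebra =
  realization A L + g: lie_algebra "gscale L" "brk L"
  for A :: "int^'i::finite^'i"
  and L :: "('h::ab_group_add, 'i, 'g::ab_group_add) km_data" +
  assumes gcm: "generalized_cartan_matrix A"
    and hemb_linear: "Vector_Spaces.linear (hscale L) (gscale L) (hemb L)"
    and hemb_inj: "inj (hemb L)"
    and h_abelian: "brk L (hemb L h) (hemb L h') = 0"
    and h_e: "brk L (hemb L h) (chev_e L i) = gscale L (sroot L i h) (chev_e L i)"
    and h_f: "brk L (hemb L h) (chev_f L i) = gscale L (- sroot L i h) (chev_f L i)"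
    and e_f: "brk L (chev_e L i) (chev_f L j) = (if i = j then hemb L (scoroot L i) else 0)"
    and serre_e: "i \<noteq> j \<Longrightarrow> (brk L (chev_e L i) ^^ nat (1 - A$i$j)) (chev_e L j) = 0"
    and serre_f: "i \<noteq> j \<Longrightarrow> (brk L (chev_f L i) ^^ nat (1 - A$i$j)) (chev_f L j) = 0"
    and generated: "lie_generated (gscale L) (brk L)
          (range (hemb L) \<union> range (chev_e L) \<union> range (chev_f L)) = UNIV"

definition n_plus :: "('h, 'i, 'g::ab_group_add) km_data \<Rightarrow> 'g set" where
  "n_plus L = lie_generated (gscale L) (brk L) (range (chev_e L))"

definition nat_cone :: "('h \<Rightarrow> complex) set \<Rightarrow> ('h \<Rightarrow> complex) set" where
  "nat_cone S = {(\<lambda>h. \<Sum>\<beta>\<in>F. of_nat (c \<beta>) * \<beta> h) | F (c :: ('h \<Rightarrow> complex) \<Rightarrow> nat). finite F \<and> F \<subseteq> S}"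

definition int_lattice :: "('h \<Rightarrow> complex) set \<Rightarrow> ('h \<Rightarrow> complex) set" where
  "int_lattice S = {(\<lambda>h. \<Sum>\<beta>\<in>F. of_int (c \<beta>) * \<beta> h) | F (c :: ('h \<Rightarrow> complex) \<Rightarrow> int). finite F \<and> F \<subseteq> S}"

text \<open>Elementwise difference of sets; plain \<open>-\<close> on sets is set difference.\<close>

definition minkowski_diff ::
  "('h \<Rightarrow> complex) set \<Rightarrow> ('h \<Rightarrow> complex) set \<Rightarrow> ('h \<Rightarrow> complex) set"  (infixl "\<ominus>" 65) where
  "C \<ominus> D = {(\<lambda>h. c h - d h) | c d. c \<in> C \<and> d \<in> D}"

definition roots :: "('h::ab_group_add, 'i, 'g::ab_group_add) km_data \<Rightarrow> ('h \<Rightarrow> complex) set" where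
  "roots L = {\<beta> \<in> hdual L. \<beta> \<noteq> (\<lambda>h. 0) \<and>
     (\<exists>x. x \<noteq> 0 \<and> (\<forall>h. brk L (hemb L h) x = gscale L (\<beta> h) x))}"

definition pos_roots :: "('h::ab_group_add, 'i, 'g::ab_group_add) km_data \<Rightarrow> ('h \<Rightarrow> complex) set" where
  "pos_roots L = roots L \<inter> nat_cone (range (sroot L))"

definition pos_roots_on ::
  "('h::ab_group_add, 'i, 'g::ab_group_add) km_data \<Rightarrow> 'i set \<Rightarrow> ('h \<Rightarrow> complex) set" where
  "pos_roots_on L J = pos_roots L \<inter> int_lattice (sroot L ` J)"

record ('g, 'v) module_data =
  mscale :: "complex \<Rightarrow> 'v \<Rightarrow> 'v"
  act :: "'g \<Rightarrow> 'v \<Rightarrow> 'v"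

locale lie_module = vector_space "mscale V"
  for L :: "('h, 'i, 'g::ab_group_add) km_data"
  and V :: "('g, 'v::ab_group_add) module_data" +
  assumes act_add_left: "act V (x + y) v = act V x v + act V y v"
    and act_add_right: "act V x (v + w) = act V x v + act V x w"
    and act_scale_left: "act V (gscale L c x) v = mscale V c (act V x v)"
    and act_scale_right: "act V x (mscale V c v) = mscale V c (act V x v)"
    and act_brk: "act V (brk L x y) v = act V x (act V y v) - act V y (act V x v)"

definition weights ::
  "('h::ab_group_add, 'i, 'g) km_data \<Rightarrow> ('g, 'v::ab_group_add) module_data \<Rightarrow> ('h \<Rightarrow> complex) set" where
  "weights L V = {\<mu> \<in> hdual L. \<exists>v. v \<noteq> 0 \<and> (\<forall>h. act V (hemb L h) v = mscale V (\<mu> h) v)}"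

text \<open>Formal complex combinations of words in elements of \<open>'g\<close> form the free associative algebra
  on the set \<open>'g\<close>. The universal enveloping algebra \<open>U\<close> is its quotient by the first three
  families of relations in \<open>verma_relations\<close>, and \<open>U/U{x - \<Lambda>(x) | x \<in> b}\<close>, for the Borel
  subalgebra \<open>b\<close> spanned by the Cartan subalgebra and \<open>n_plus\<close>, is the Verma module
  \<open>M(\<Lambda>)\<close>, induced from \<open>b\<close>. So \<open>M(\<Lambda>)\<close> is the space of formal combinations of words modulo
  \<open>verma_kernel\<close>, with \<open>'g\<close> acting by \<open>word_act\<close>, that is, by left multiplication.\<close>

definition word :: "'g list \<Rightarrow> ('g list \<Rightarrow>\<^sub>0 complex)" where
  "word w = Poly_Mapping.single w 1"

definition word_scale :: "complex \<Rightarrow> ('g list \<Rightarrow>\<^sub>0 complex) \<Rightarrow> ('g list \<Rightarrow>\<^sub>0 complex)" where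
  "word_scale c t = Poly_Mapping.map (\<lambda>a. c * a) t"

definition word_act :: "'g \<Rightarrow> ('g list \<Rightarrow>\<^sub>0 complex) \<Rightarrow> ('g list \<Rightarrow>\<^sub>0 complex)" where
  "word_act x t = (\<Sum>w\<in>Poly_Mapping.keys t. Poly_Mapping.single (x # w) (Poly_Mapping.lookup t w))"

definition verma_relations ::
  "('h, 'i, 'g::ab_group_add) km_data \<Rightarrow> ('h \<Rightarrow> complex) \<Rightarrow> ('g list \<Rightarrow>\<^sub>0 complex) set" where
  "verma_relations L \<Lambda> =
     {word (u @ [x + y] @ w) - word (u @ [x] @ w) - word (u @ [y] @ w) | u w x y. True}
   \<union> {word (u @ [gscale L c x] @ w) - word_scale c (word (u @ [x] @ w)) | u w c x. True}
   \<union> {word (u @ [x, y] @ w) - word (u @ [y, x] @ w) - word (u @ [brk L x y] @ w) | u w x y. True}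
   \<union> {word (u @ [x]) | u x. x \<in> n_plus L}
   \<union> {word (u @ [hemb L h]) - word_scale (\<Lambda> h) (word u) | u h. True}"

definition verma_kernel ::
  "('h, 'i, 'g::ab_group_add) km_data \<Rightarrow> ('h \<Rightarrow> complex) \<Rightarrow> ('g list \<Rightarrow>\<^sub>0 complex) set" where
  "verma_kernel L \<Lambda> = module.span word_scale (verma_relations L \<Lambda>)"

text \<open>The nonzero quotients of \<open>M(\<Lambda>)\<close>: a surjective module homomorphism from \<open>M(\<Lambda>)\<close> is
  the same as a surjective homomorphism \<open>\<pi>\<close> from the words that kills \<open>verma_kernel\<close>.\<close>

definition highest_weight_module ::
  "('h, 'i, 'g::ab_group_add) km_data \<Rightarrow> ('h \<Rightarrow> complex) \<Rightarrow> ('g, 'v::ab_group_add) module_data \<Rightarrow> bool" where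
  "highest_weight_module L \<Lambda> V \<longleftrightarrow>
     lie_module L V \<and> (\<exists>v :: 'v. v \<noteq> 0) \<and>
     (\<exists>\<pi> :: ('g list \<Rightarrow>\<^sub>0 complex) \<Rightarrow> 'v.
        Vector_Spaces.linear word_scale (mscale V) \<pi> \<and>
        (\<forall>x t. \<pi> (word_act x t) = act V x (\<pi> t)) \<and>
        (\<forall>t\<in>verma_kernel L \<Lambda>. \<pi> t = 0) \<and>
        surj \<pi>)"

definition dynkin_edge :: "int^'i^'i \<Rightarrow> 'i \<Rightarrow> 'i \<Rightarrow> bool" where
  "dynkin_edge A i j \<longleftrightarrow> i \<noteq> j \<and> (A$i$j \<noteq> 0 \<or> A$j$i \<noteq> 0)"

definition independent_nodes :: "int^'i^'i \<Rightarrow> 'i set \<Rightarrow> bool" where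
  "independent_nodes A I \<longleftrightarrow> (\<forall>i\<in>I. \<forall>j\<in>I. i \<noteq> j \<longrightarrow> \<not> dynkin_edge A i j)"

definition J_wt :: "('h, 'i, 'z) realization_data_scheme \<Rightarrow> ('h \<Rightarrow> complex) \<Rightarrow> 'i set" where
  "J_wt L \<Lambda> = {i. \<Lambda> (scoroot L i) \<in> \<nat>}"

definition shifted_wt ::
  "('h, 'i, 'z) realization_data_scheme \<Rightarrow> ('h \<Rightarrow> complex) \<Rightarrow> 'i set \<Rightarrow> ('h \<Rightarrow> complex)" where
  "shifted_wt L \<Lambda> I = (\<lambda>h. \<Lambda> h - (\<Sum>i\<in>I. (\<Lambda> (scoroot L i) + 1) * sroot L i h))"

definition J_mod ::
  "int^'i^'i \<Rightarrow> ('h::ab_group_add, 'i, 'g) km_data \<Rightarrow> ('h \<Rightarrow> complex)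
     \<Rightarrow> ('g, 'v::ab_group_add) module_data \<Rightarrow> 'i set" where
  "J_mod A L \<Lambda> V = \<Union>{I. I \<subseteq> J_wt L \<Lambda> \<and> independent_nodes A I \<and>
     shifted_wt L \<Lambda> I \<notin> weights L V \<and> (\<forall>K. K \<subset> I \<longrightarrow> shifted_wt L \<Lambda> K \<in> weights L V)}"

end

theory Submission
  imports Defs "HOL-Library.Multiset"
begin

text \<open>
  Write a weight of \<open>V\<close> as the highest weight minus the simple roots of a multiset of nodes, its
  content. The theorem follows from a description of the set \<open>C\<close> of contents of \<open>V\<close> as a union of
  regions \<open>P(J)\<close>, where \<open>J\<close> consists of nodes with natural highest weight value: \<open>P(J)\<close> is the
  smallest set of contents that contains the empty one, allows the nodes outside \<open>J\<close> to be added
  freely, and allows a node of \<open>J\<close> to be added as often as an sl2-string forces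
  (\<open>reach A (-J) J m\<close>). It is the set of contents of the parabolic Verma module of \<open>J\<close>.
  Call \<open>J\<close> transversal if it meets every independent set \<open>I\<close> whose corner, the content of
  \<open>\<Lambda> - (\<Sum>i\<in>I. (\<Lambda> (coroot i) + 1) \<alpha>\<^sub>i)\<close>, is missing from \<open>C\<close>. Since the minimal such \<open>I\<close> lie in
  \<open>J_V\<close>, the intersection of a transversal set with \<open>J_V\<close> is transversal again.

  (1) Every element of \<open>C\<close> lies in \<open>P(J)\<close> for some transversal \<open>J\<close>
  (\<open>content_reach_transversal\<close>). If all \<open>F\<^sub>i\<close> with \<open>\<Lambda> (coroot i)\<close> natural act locally nilpotently,
  sl2-theory puts all contents into \<open>P(J)\<close> for the set \<open>J\<close> of these nodes. Otherwise a weight of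
  \<open>V\<close> survives in the quotient by the submodule of a singular vector \<open>F\<^sub>i\<^sup>n v\<close>, or it is a weight of
  that submodule; both cases are handled by induction. All statements about the operators are
  therefore made modulo a stable subspace \<open>N\<close>, so that no quotient module has to be formed.

  (2) For transversal \<open>J\<close>, \<open>P(J)\<close> is contained in \<open>C\<close>. Since \<open>C\<close> is closed under strings, it is
  enough to treat contents outside \<open>J\<close> (\<open>free_contents\<close>). Given multiplicities of
  the nodes outside \<open>J\<close>, a greedy choice (\<open>greedy_independent\<close>) yields an independent set \<open>I\<close> such
  that the nodes which cannot be added freely because of the singular vector of corner \<open>I\<close> can be
  added by strings. Freeness comes from an Ore argument: \<open>F\<^sub>k\<close> cannot kill what generates a vector
  on which it acts injectively (\<open>F_submodule_of\<close>).

  (3) \<open>P(J)\<close> is closed under adding a positive root whose support is not contained in \<open>J\<close>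
  (\<open>reach_add_root\<close>). This needs the symmetry of \<open>P(J)\<close> under the reflections of \<open>J\<close>, obtained from
  modules for the nodes of \<open>J\<close> that occur as subquotients of \<open>V\<close> (\<open>integrable_reflection_closed\<close>).

  By (1) to (3), \<open>C\<close> is closed under adding the positive roots not supported in \<open>J_V\<close>, which gives one
  inclusion of the decomposition and, for simple roots, the last claim. The other inclusion holds
  for every \<open>J\<close>: words in the \<open>F\<^sub>i\<close> can be rearranged into products of brackets
  \<open>[F\<^sub>j, [\<dots>, [F\<^sub>k, F\<^sub>i]]]\<close> with \<open>i\<close> outside \<open>J\<close> and all other nodes inside, followed by a word in \<open>J\<close>.
  The contents of nonzero brackets are described by strings alone, hence are the same for the
  positive and the negative half of the algebra even if no Chevalley involution exists; so they
  are roots. Finally, if the decomposition holds for \<open>J\<close>, then \<open>C\<close> is closed under adding nodes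
  outside \<open>J\<close>. For \<open>I\<close> minimal with missing corner, this would lead from the corner of \<open>I - {i}\<close> to
  that of \<open>I\<close>, so \<open>I\<close> is contained in \<open>J\<close>.
\<close>

section \<open>Contents and strings\<close>

definition coroot_value :: "int^'i::finite^'i \<Rightarrow> 'i multiset \<Rightarrow> 'i \<Rightarrow> int" where
  "coroot_value A c j = (\<Sum>i\<in>#c. A $ j $ i)"

lemma coroot_value_simps [simp]:
  "coroot_value A {#} j = 0"
  "coroot_value A (add_mset i c) j = A $ j $ i + coroot_value A c j"
  "coroot_value A (c + d) j = coroot_value A c j + coroot_value A d j"
  "coroot_value A (replicate_mset t i) j = int t * A $ j $ i"
  by (simp_all add: coroot_value_def)

lemma coroot_value_diff:
  assumes "d \<subseteq># c"
  shows "coroot_value A (c - d) j = coroot_value A c j - coroot_value A d j"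
proof -
  have "coroot_value A (c - d + d) j = coroot_value A c j"
    using assms by (simp only: subset_mset.diff_add)
  then show ?thesis by simp
qed

lemma gcm_diag: "generalized_cartan_matrix A \<Longrightarrow> A $ i $ i = 2"
  and gcm_off_diag: "generalized_cartan_matrix A \<Longrightarrow> i \<noteq> j \<Longrightarrow> A $ i $ j \<le> 0"
  and gcm_zero: "generalized_cartan_matrix A \<Longrightarrow> A $ i $ j = 0 \<Longrightarrow> A $ j $ i = 0"
  by (auto simp: generalized_cartan_matrix_def)

text \<open>The contents obtained from the empty one by adding nodes of \<open>Fr\<close> freely and by descending
  along \<open>j\<close>-strings for \<open>j\<close> in \<open>J\<close>, where \<open>m\<close> gives the values of the highest weight on the coroots
  of \<open>J\<close>.\<close>
inductive_set reach :: "int^'i::finite^'i \<Rightarrow> 'i set \<Rightarrow> 'i set \<Rightarrow> ('i \<Rightarrow> int) \<Rightarrow> 'i multiset set"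
  for A :: "int^'i::finite^'i" and Fr J :: "'i set" and m :: "'i \<Rightarrow> int" where
  empty: "{#} \<in> reach A Fr J m"
| free: "c \<in> reach A Fr J m \<Longrightarrow> i \<in> Fr \<Longrightarrow> add_mset i c \<in> reach A Fr J m"
| string: "c \<in> reach A Fr J m \<Longrightarrow> j \<in> J \<Longrightarrow> int t \<le> m j - coroot_value A c j
     \<Longrightarrow> c + replicate_mset t j \<in> reach A Fr J m"

lemma reach_mono:
  assumes "c \<in> reach A Fr J m" and "\<And>j. j \<in> J \<Longrightarrow> m j \<le> m' j"
  shows "c \<in> reach A Fr J m'"
  using assms(1)
proof induction
  case (string c j t)
  then show ?case using assms(2)[of j] by (intro reach.string) auto
qed (auto intro: reach.intros)

lemma reach_free_add:
  "c \<in> reach A Fr J m \<Longrightarrow> set_mset n \<subseteq> Fr \<Longrightarrow> c + n \<in> reach A Fr J m"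
  by (induction n) (auto intro: reach.free)

lemma reach_fewer_strings:
  assumes "c \<in> reach A (-J) J m" and "J0 \<subseteq> J"
  shows "c \<in> reach A (-J0) J0 m"
  using assms(1)
proof induction
  case (string c j t)
  show ?case
  proof (cases "j \<in> J0")
    case True
    then show ?thesis using string by (intro reach.string)
  next
    case False
    then have "set_mset (replicate_mset t j) \<subseteq> - J0" by auto
    then show ?thesis using string reach_free_add by blast
  qed
next
  case (free c i)
  then show ?case using assms(2) by (intro reach.free) auto
qed (rule reach.empty)

lemma reach_shift:
  assumes "c \<in> reach A Fr' J (\<lambda>j. m j - coroot_value A n j)" and "set_mset n \<subseteq> Fr" and "Fr' \<subseteq> Fr"
  shows "n + c \<in> reach A Fr J m"
  using assms(1)
proof induction
  case empty
  show ?case using reach_free_add[OF reach.empty assms(2)] by simp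
next
  case (free c i)
  then have "add_mset i (n + c) \<in> reach A Fr J m" using assms(3) by (intro reach.free) auto
  then show ?case by simp
next
  case (string c j t)
  then have "n + c + replicate_mset t j \<in> reach A Fr J m" by (intro reach.string) auto
  then show ?case by (simp add: add.assoc)
qed

text \<open>All free nodes can be added before any string is used: adding a node \<open>i\<close> outside \<open>J\<close> first can
  only raise the values on the coroots of \<open>J\<close>, so it only lengthens the strings that follow.\<close>
lemma reach_split:
  assumes "generalized_cartan_matrix A" and "c \<in> reach A (-J) J m"
  shows "\<exists>n x. c = n + x \<and> set_mset n \<subseteq> -J \<and> x \<in> reach A {} J (\<lambda>j. m j - coroot_value A n j)"
  using assms(2)
proof induction
  case empty
  show ?case by (intro exI[of _ "{#}"]) (auto intro: reach.empty)
next
  case (free c i)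
  then obtain n x where c: "c = n + x" and n: "set_mset n \<subseteq> -J"
    and x: "x \<in> reach A {} J (\<lambda>j. m j - coroot_value A n j)" by blast
  have "A $ j $ i \<le> 0" if "j \<in> J" for j
    using gcm_off_diag[OF assms(1), of j i] that free(2) by auto
  then have "x \<in> reach A {} J (\<lambda>j. m j - coroot_value A (add_mset i n) j)"
    by (intro reach_mono[OF x]) simp
  moreover have "set_mset (add_mset i n) \<subseteq> -J" using n free(2) by auto
  moreover have "add_mset i c = add_mset i n + x" using c by simp
  ultimately show ?case by blast
next
  case (string c j t)
  then obtain n x where c: "c = n + x" and n: "set_mset n \<subseteq> -J"
    and x: "x \<in> reach A {} J (\<lambda>j. m j - coroot_value A n j)" by blast
  have "x + replicate_mset t j \<in> reach A {} J (\<lambda>j. m j - coroot_value A n j)"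
    using string c by (intro reach.string[OF x]) auto
  moreover have "c + replicate_mset t j = n + (x + replicate_mset t j)" using c by (simp add: add.assoc)
  ultimately show ?case using n by blast
qed

text \<open>The weight of content \<open>c\<close> has value \<open>m j - coroot_value A c j\<close> on the coroot of \<open>j\<close>. If this
  is negative, the reflected weight has a smaller content; some content at least as far up
  the \<open>j\<close>-string is required to be present.\<close>
definition reflection_closed :: "int^'i::finite^'i \<Rightarrow> 'i set \<Rightarrow> ('i \<Rightarrow> int) \<Rightarrow> 'i multiset set \<Rightarrow> bool" where
  "reflection_closed A J m R \<longleftrightarrow> (\<forall>c\<in>R. \<forall>j\<in>J. \<exists>k. k \<le> count c j
      \<and> coroot_value A c j - m j \<le> int k \<and> c - replicate_mset k j \<in> R)"

text \<open>A combinatorial shadow of the tensor product of two modules integrable for \<open>J\<close>. In the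
  step for a string of \<open>y\<close> at \<open>j\<close>, the content \<open>c\<close> may have a negative value at \<open>j\<close>, which would shorten
  the string; moving \<open>c\<close> up to its reflection first repairs this, and the string then
  makes up for the move as well.\<close>
lemma reach_add_root:
  assumes gcm: "generalized_cartan_matrix A"
    and refl: "reflection_closed A J m (reach A (-J) J m)"
    and i: "i \<notin> J" and y: "y \<in> reach A {} J (\<lambda>j. - (A $ j $ i))"
    and c: "c \<in> reach A (-J) J m"
  shows "c + add_mset i y \<in> reach A (-J) J m"
  using y c
proof (induction arbitrary: c)
  case empty
  then show ?case using i reach.free[of c A "-J" J m i] by simp
next
  case (string y j t)
  obtain k where k: "k \<le> count c j" "coroot_value A c j - m j \<le> int k"
    and c': "c - replicate_mset k j \<in> reach A (-J) J m"
    using refl string.prems string.hyps(2) unfolding reflection_closed_def by blast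
  have sub: "replicate_mset k j \<subseteq># c" using k(1) by (simp add: count_le_replicate_mset_subset_eq)
  have "c - replicate_mset k j + add_mset i y \<in> reach A (-J) J m"
    using string.IH[OF c'] .
  then have "(c - replicate_mset k j + add_mset i y) + replicate_mset (k + t) j \<in> reach A (-J) J m"
    using k string.hyps gcm_diag[OF gcm, of j]
    by (intro reach.string) (auto simp: coroot_value_diff[OF sub])
  moreover have "(c - replicate_mset k j + add_mset i y) + replicate_mset (k + t) j
     = (c - replicate_mset k j + replicate_mset k j) + add_mset i (y + replicate_mset t j)"
    by (simp add: multiset_eq_iff)
  ultimately show ?case using sub by (simp add: subset_mset.diff_add)
qed auto

section \<open>Operators satisfying the Chevalley--Serre relations\<close>

definition commutator :: "('v \<Rightarrow> 'v::minus) \<Rightarrow> ('v \<Rightarrow> 'v) \<Rightarrow> 'v \<Rightarrow> 'v" where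
  "commutator f g = (\<lambda>x. f (g x) - g (f x))"

text \<open>The Lie algebra enters the main argument only through operators on a vector space. This
  covers a module, the adjoint representation, and the adjoint representation with the roles of
  the two halves of the algebra exchanged.\<close>
locale chevalley_operators = vector_space s
  for s :: "complex \<Rightarrow> 'v::ab_group_add \<Rightarrow> 'v" +
  fixes A :: "int^'i::finite^'i" and r :: "'i \<Rightarrow> 'h \<Rightarrow> complex" and cor :: "'i \<Rightarrow> 'h"
    and E F :: "'i \<Rightarrow> 'v \<Rightarrow> 'v" and T :: "'h \<Rightarrow> 'v \<Rightarrow> 'v"
  assumes gcm: "generalized_cartan_matrix A"
    and wgt_inj: "(\<And>h. (\<Sum>i\<in>#c. r i h) = (\<Sum>i\<in>#d. r i h)) \<Longrightarrow> c = d"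
    and r_cor: "r j (cor i) = of_int (A $ i $ j)"
    and E_linear: "Vector_Spaces.linear s s (E i)"
    and F_linear: "Vector_Spaces.linear s s (F i)"
    and T_linear: "Vector_Spaces.linear s s (T h)"
    and EF: "E i (F j x) - F j (E i x) = (if i = j then T (cor i) x else 0)"
    and TE: "T h (E i x) - E i (T h x) = s (r i h) (E i x)"
    and TF: "T h (F i x) - F i (T h x) = s (- r i h) (F i x)"
    and serre_E: "i \<noteq> j \<Longrightarrow> (commutator (E i) ^^ nat (1 - A $ i $ j)) (E j) = (\<lambda>x. 0)"
    and serre_F: "i \<noteq> j \<Longrightarrow> (commutator (F i) ^^ nat (1 - A $ i $ j)) (F j) = (\<lambda>x. 0)"
begin

lemma E_hom: "module_hom s s (E i)" and F_hom: "module_hom s s (F i)" and T_hom: "module_hom s s (T h)"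
  using E_linear F_linear T_linear by (auto dest: Vector_Spaces.linear.axioms(3))

lemmas linear_simps [simp] =
  module_hom.add[OF E_hom] module_hom.diff[OF E_hom] module_hom.scale[OF E_hom] module_hom.zero[OF E_hom] module_hom.neg[OF E_hom]
  module_hom.add[OF F_hom] module_hom.diff[OF F_hom] module_hom.scale[OF F_hom] module_hom.zero[OF F_hom] module_hom.neg[OF F_hom]
  module_hom.add[OF T_hom] module_hom.diff[OF T_hom] module_hom.scale[OF T_hom] module_hom.zero[OF T_hom] module_hom.neg[OF T_hom]

lemma EF_eq: "E i (F j x) = F j (E i x) + (if i = j then T (cor i) x else 0)"
  using EF[of i j x] by (simp add: diff_eq_eq add.commute)

lemma TE_eq: "T h (E i x) = E i (T h x) + s (r i h) (E i x)"
  using TE[of h i x] by (simp add: diff_eq_eq add.commute)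

lemma TF_eq: "T h (F i x) = F i (T h x) - s (r i h) (F i x)"
  using TF[of h i x] by (simp add: diff_eq_eq add.commute)

text \<open>The usual sl2-computation for a raising operator \<open>a\<close> and a lowering operator \<open>b\<close>, made modulo
  \<open>N\<close>: only the scalar by which the commutator acts along the chain matters.\<close>
lemma sl2_ladder:
  assumes N: "subspace N"
    and b: "Vector_Spaces.linear s s b" and bN: "\<And>x. x \<in> N \<Longrightarrow> b x \<in> N"
    and y: "a y \<in> N"
    and comm: "\<And>t. a (b ((b ^^ t) y)) - b (a ((b ^^ t) y)) - s (n - 2 * of_nat t) ((b ^^ t) y) \<in> N"
  shows "a ((b ^^ Suc t) y) - s (of_nat (Suc t) * (n - of_nat t)) ((b ^^ t) y) \<in> N"
proof (induction t)
  case 0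
  have "a (b y) - b (a y) - s n y + b (a y) \<in> N"
    using comm[of 0] bN[OF y] N by (intro subspace_add) auto
  then show ?case by simp
next
  case (Suc t)
  let ?y = "\<lambda>t. (b ^^ t) y"
  have "b (a (?y (Suc t)) - s (of_nat (Suc t) * (n - of_nat t)) (?y t)) \<in> N"
    using bN[OF Suc.IH] .
  then have 1: "b (a (?y (Suc t))) - s (of_nat (Suc t) * (n - of_nat t)) (?y (Suc t)) \<in> N"
    by (simp add: module_hom.diff[OF Vector_Spaces.linear.axioms(3)[OF b]]
         module_hom.scale[OF Vector_Spaces.linear.axioms(3)[OF b]])
  have eq: "s (n - 2 * of_nat (Suc t)) (?y (Suc t))
      + s (of_nat (Suc t) * (n - of_nat t)) (?y (Suc t))
      = s (of_nat (Suc (Suc t)) * (n - of_nat (Suc t))) (?y (Suc t))"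
    unfolding scale_left_distrib[symmetric] by (simp add: algebra_simps)
  have "(a (b (?y (Suc t))) - b (a (?y (Suc t))) - s (n - 2 * of_nat (Suc t)) (?y (Suc t)))
     + (b (a (?y (Suc t))) - s (of_nat (Suc t) * (n - of_nat t)) (?y (Suc t))) \<in> N"
    using comm[of "Suc t"] 1 N by (intro subspace_add)
  then have "a (b (?y (Suc t))) - (s (n - 2 * of_nat (Suc t)) (?y (Suc t))
      + s (of_nat (Suc t) * (n - of_nat t)) (?y (Suc t))) \<in> N"
    by (simp add: diff_diff_eq[symmetric] del: of_nat_Suc)
  then show ?case unfolding eq by simp
qed

text \<open>The scalar in the ladder vanishes at \<open>t\<close> only if \<open>n = t\<close>, so the chain cannot enter \<open>N\<close> before.\<close>
lemma sl2_chain: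
  assumes N: "subspace N"
    and b: "Vector_Spaces.linear s s b"
    and aN: "\<And>x. x \<in> N \<Longrightarrow> a x \<in> N" and bN: "\<And>x. x \<in> N \<Longrightarrow> b x \<in> N"
    and y: "y \<notin> N" "a y \<in> N"
    and comm: "\<And>t. a (b ((b ^^ t) y)) - b (a ((b ^^ t) y)) - s (n - 2 * of_nat t) ((b ^^ t) y) \<in> N"
    and nz: "\<And>u. u < t \<Longrightarrow> n \<noteq> of_nat u"
  shows "(b ^^ t) y \<notin> N"
proof -
  note ladder = sl2_ladder[OF N b bN y(2) comm]
  show ?thesis using nz
  proof (induction t)
    case 0
    then show ?case using y by simp
  next
    case (Suc t)
    then have IH: "(b ^^ t) y \<notin> N" by simp
    show ?case
    proof
      assume "(b ^^ Suc t) y \<in> N"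
      then have "a ((b ^^ Suc t) y) \<in> N" by (rule aN)
      then have "s (of_nat (Suc t) * (n - of_nat t)) ((b ^^ t) y) \<in> N"
        using subspace_diff[OF N _ ladder[of t]] by fastforce
      then have "s (inverse (of_nat (Suc t) * (n - of_nat t)))
           (s (of_nat (Suc t) * (n - of_nat t)) ((b ^^ t) y)) \<in> N"
        by (rule subspace_scale[OF N])
      moreover have "of_nat (Suc t) * (n - of_nat t) \<noteq> 0"
        using Suc.prems[of t] by (simp del: of_nat_Suc)
      ultimately show False using IH by (simp only: scale_scale left_inverse not_False_eq_True scale_one)
    qed
  qed
qed

definition wgt :: "'i multiset \<Rightarrow> 'h \<Rightarrow> complex" where
  "wgt c h = (\<Sum>i\<in>#c. r i h)"

lemma wgt_simps [simp]:
  "wgt {#} h = 0" "wgt (add_mset i c) h = r i h + wgt c h" "wgt (c + d) h = wgt c h + wgt d h"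
  "wgt (replicate_mset n i) h = of_nat n * r i h"
  by (simp_all add: wgt_def)

lemma wgt_cor: "wgt c (cor j) = of_int (coroot_value A c j)"
  by (induction c) (simp_all add: r_cor)

lemma wgt_eqD: "(\<And>h. wgt c h = wgt d h) \<Longrightarrow> c = d"
  unfolding wgt_def by (rule wgt_inj)

definition Fw :: "'i list \<Rightarrow> 'v \<Rightarrow> 'v" where "Fw w x = foldr F w x"

lemma Fw_simps [simp]: "Fw [] x = x" "Fw (i # w) x = F i (Fw w x)" "Fw (u @ w) x = Fw u (Fw w x)"
  "Fw (replicate n i) x = (F i ^^ n) x"
  by (simp_all add: Fw_def foldr_replicate)

text \<open>A subspace stable under the operators of the nodes of \<open>K\<close> only: besides submodules, the
  submodules for the subalgebra of \<open>K\<close> are needed.\<close>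
definition stable :: "'i set \<Rightarrow> 'v set \<Rightarrow> bool" where
  "stable K N \<longleftrightarrow> subspace N \<and> (\<forall>y\<in>N. (\<forall>k\<in>K. E k y \<in> N \<and> F k y \<in> N) \<and> (\<forall>h. T h y \<in> N))"

lemma stableD:
  assumes "stable K N"
  shows "subspace N" "y \<in> N \<Longrightarrow> k \<in> K \<Longrightarrow> E k y \<in> N" "y \<in> N \<Longrightarrow> k \<in> K \<Longrightarrow> F k y \<in> N"
    "y \<in> N \<Longrightarrow> T h y \<in> N"
  using assms by (auto simp: stable_def)

lemma stable_zero: "stable K {0}"
  by (simp add: stable_def subspace_def)

lemma stable_Fpow: "stable K N \<Longrightarrow> k \<in> K \<Longrightarrow> y \<in> N \<Longrightarrow> (F k ^^ n) y \<in> N"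
  by (induction n) (auto dest: stableD)

lemma stable_Fw: "stable K N \<Longrightarrow> set w \<subseteq> K \<Longrightarrow> y \<in> N \<Longrightarrow> Fw w y \<in> N"
  by (induction w) (auto dest: stableD)

text \<open>A highest weight vector modulo \<open>N\<close> for the nodes of \<open>K\<close>. It may lie in \<open>N\<close>.\<close>
definition hw :: "'i set \<Rightarrow> 'v set \<Rightarrow> ('h \<Rightarrow> complex) \<Rightarrow> 'v \<Rightarrow> bool" where
  "hw K N \<Lambda> x \<longleftrightarrow> stable K N \<and> (\<forall>k\<in>K. E k x \<in> N) \<and> (\<forall>h. T h x = s (\<Lambda> h) x)"

lemma hwD:
  assumes "hw K N \<Lambda> x"
  shows "stable K N" "k \<in> K \<Longrightarrow> E k x \<in> N" "T h x = s (\<Lambda> h) x"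
  using assms by (auto simp: hw_def)

text \<open>For \<open>hw K N \<Lambda> x\<close> these are the contents of the weights of the submodule generated by \<open>x\<close>
  modulo \<open>N\<close>, under the operators of \<open>K\<close>.\<close>
definition contents :: "'i set \<Rightarrow> 'v set \<Rightarrow> 'v \<Rightarrow> 'i multiset set" where
  "contents K N x = {mset w | w. set w \<subseteq> K \<and> Fw w x \<notin> N}"

definition wordspan :: "'i set \<Rightarrow> 'v \<Rightarrow> 'i multiset \<Rightarrow> 'v set" where
  "wordspan K x c = span {Fw w x | w. set w \<subseteq> K \<and> mset w = c}"

text \<open>This is the sum \<open>N + S\<close> for subspaces.\<close>
definition near :: "'v set \<Rightarrow> 'v set \<Rightarrow> 'v set" where
  "near N S = {y. \<exists>z\<in>S. y - z \<in> N}"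

lemma Fw_in_wordspan: "set w \<subseteq> K \<Longrightarrow> Fw w x \<in> wordspan K x (mset w)"
  unfolding wordspan_def by (rule span_base) auto

lemma subspace_near: "subspace N \<Longrightarrow> subspace S \<Longrightarrow> subspace (near N S)"
  unfolding near_def subspace_def
  apply safe
    apply (metis diff_self)
   apply (metis add_diff_add)
  by (metis scale_right_diff_distrib)

lemma near_superset: "subspace N \<Longrightarrow> S \<subseteq> near N S"
  unfolding near_def by (force dest: subspace_0)

lemma near_N: "subspace S \<Longrightarrow> N \<subseteq> near N S"
  unfolding near_def using subspace_0 by force

lemma T_Fw: "T h x = s (\<Lambda> h) x \<Longrightarrow> T h (Fw w x) = s (\<Lambda> h - wgt (mset w) h) (Fw w x)"
proof (induction w)
  case (Cons i w)
  have "T h (F i (Fw w x)) = F i (T h (Fw w x)) - s (r i h) (F i (Fw w x))" by (rule TF_eq)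
  also have "\<dots> = s (\<Lambda> h - wgt (mset w) h) (F i (Fw w x)) - s (r i h) (F i (Fw w x))"
    using Cons by simp
  also have "\<dots> = s (\<Lambda> h - wgt (mset (i # w)) h) (F i (Fw w x))"
    by (simp only: scale_left_diff_distrib[symmetric]) (simp add: diff_diff_eq add.commute)
  finally show ?case by simp
qed simp

lemma T_wordspan:
  assumes "T h x = s (\<Lambda> h) x" and "z \<in> wordspan K x c"
  shows "T h z = s (\<Lambda> h - wgt c h) z"
  using assms(2) unfolding wordspan_def
proof (induction rule: span_induct_alt)
  case base
  then show ?case by simp
next
  case (step a y z)
  then obtain w where "y = Fw w x" "mset w = c" by auto
  then show ?case using step T_Fw[of h x \<Lambda> w] assms(1)
    by (simp add: scale_right_distrib mult.commute)
qed

lemma T_near: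
  assumes "hw K N \<Lambda> x" and "y \<in> near N (wordspan K x c)"
  shows "T h y - s (\<Lambda> h - wgt c h) y \<in> N"
proof -
  obtain z where z: "z \<in> wordspan K x c" "y - z \<in> N" using assms(2) by (auto simp: near_def)
  have "T h (y - z) - s (\<Lambda> h - wgt c h) (y - z) \<in> N"
    using stableD(4)[OF hwD(1)[OF assms(1)] z(2)] subspace_scale[OF stableD(1)[OF hwD(1)[OF assms(1)]] z(2)]
    by (rule subspace_diff[OF stableD(1)[OF hwD(1)[OF assms(1)]]])
  moreover have "T h z = s (\<Lambda> h - wgt c h) z"
    by (rule T_wordspan[of h x \<Lambda>, OF hwD(3)[OF assms(1)] z(1)])
  ultimately show ?thesis by (simp add: scale_right_diff_distrib)
qed

lemma F_wordspan: "z \<in> wordspan K x c \<Longrightarrow> k \<in> K \<Longrightarrow> F k z \<in> wordspan K x (add_mset k c)"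
  unfolding wordspan_def
proof (induction rule: span_induct_alt)
  case base
  then show ?case by (simp add: span_zero)
next
  case (step a y z)
  then obtain w where w: "y = Fw w x" "mset w = c" "set w \<subseteq> K" by auto
  then have "F k y \<in> {Fw w x |w. set w \<subseteq> K \<and> mset w = add_mset k c}"
    using step.prems by (intro CollectI exI[of _ "k # w"]) auto
  then show ?case using step by (simp add: span_add span_scale span_base)
qed

lemma F_near:
  assumes "stable K N" "y \<in> near N (wordspan K x c)" "k \<in> K"
  shows "F k y \<in> near N (wordspan K x (add_mset k c))"
proof -
  obtain z where z: "z \<in> wordspan K x c" "y - z \<in> N" using assms(2) by (auto simp: near_def)
  have "F k y - F k z \<in> N" using stableD(3)[OF assms(1) z(2) assms(3)] by simp
  then show ?thesis using F_wordspan[OF z(1) assms(3)] by (auto simp: near_def)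
qed

lemma Fpow_near:
  assumes "stable K N" "y \<in> near N (wordspan K x c)" "k \<in> K"
  shows "(F k ^^ p) y \<in> near N (wordspan K x (c + replicate_mset p k))"
  by (induction p) (use assms F_near in auto)

text \<open>Moving \<open>E\<^sub>k\<close> through a word to the highest weight vector produces a scalar multiple of a shorter
  word for every occurrence of \<open>k\<close>.\<close>
lemma E_near_Fw:
  assumes hw: "hw K N \<Lambda> x" and k: "k \<in> K" and w: "set w \<subseteq> K"
  shows "(k \<in># mset w \<longrightarrow> E k (Fw w x) \<in> near N (wordspan K x (mset w - {#k#})))
     \<and> (k \<notin># mset w \<longrightarrow> E k (Fw w x) \<in> N)"
  using w
proof (induction w)
  case Nil
  then show ?case using hwD(2)[OF hw k] by simp
next
  case (Cons l w)
  note st = hwD(1)[OF hw]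
  have sub: "subspace (near N (wordspan K x d))" for d
    using stableD(1)[OF st] by (intro subspace_near) (auto simp: wordspan_def)
  have l: "l \<in> K" and w: "set w \<subseteq> K" using Cons by auto
  show ?case
  proof (cases "k = l")
    case True
    have 1: "T (cor k) (Fw w x) \<in> wordspan K x (mset w)"
      using T_Fw[of "cor k" x \<Lambda> w] hwD(3)[OF hw] Fw_in_wordspan[OF w]
      by (simp add: wordspan_def span_scale)
    have 2: "F k (E k (Fw w x)) \<in> near N (wordspan K x (mset w))"
    proof (cases "k \<in># mset w")
      case True
      then show ?thesis using Cons F_near[OF st _ k, of "E k (Fw w x)" x "mset w - {#k#}"] by simp
    next
      case False
      then have "F k (E k (Fw w x)) \<in> N" using Cons stableD(3)[OF st _ k] by simp
      then show ?thesis using near_N[of "wordspan K x (mset w)" N] by (auto simp: wordspan_def)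
    qed
    have "E k (Fw (l # w) x) \<in> near N (wordspan K x (mset w))"
      using 1 2 near_superset[OF stableD(1)[OF st]] True
      by (auto simp: EF_eq intro!: subspace_add[OF sub])
    then show ?thesis using True by simp
  next
    case False
    then have eq: "E k (Fw (l # w) x) = F l (E k (Fw w x))" by (simp add: EF_eq)
    show ?thesis
    proof (cases "k \<in># mset w")
      case True
      then have "F l (E k (Fw w x)) \<in> near N (wordspan K x (add_mset l (mset w - {#k#})))"
        using Cons F_near[OF st _ l] by simp
      then show ?thesis using True eq False by simp
    next
      case F: False
      then have "F l (E k (Fw w x)) \<in> N" using Cons stableD(3)[OF st _ l] by simp
      then show ?thesis using F eq False by simp
    qed
  qed
qed

lemma E_near:
  assumes hw: "hw K N \<Lambda> x" and k: "k \<in> K" and y: "y \<in> near N (wordspan K x c)"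
  shows "(k \<in># c \<longrightarrow> E k y \<in> near N (wordspan K x (c - {#k#}))) \<and> (k \<notin># c \<longrightarrow> E k y \<in> N)"
proof -
  note st = hwD(1)[OF hw]
  define M where "M = (if k \<in># c then near N (wordspan K x (c - {#k#})) else N)"
  have M: "subspace M" "N \<subseteq> M"
    using stableD(1)[OF st] near_N[of "wordspan K x (c - {#k#})" N]
    by (auto simp: M_def wordspan_def subspace_near)
  obtain z where z: "z \<in> wordspan K x c" "y - z \<in> N" using y by (auto simp: near_def)
  have "E k z \<in> M" using z(1) unfolding wordspan_def
  proof (induction rule: span_induct_alt)
    case base
    then show ?case using M by (simp add: subspace_0)
  next
    case (step a y z)
    then have "E k y \<in> M" using E_near_Fw[OF hw k] by (auto simp: M_def)
    then show ?case using step M by (simp add: subspace_add subspace_scale)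
  qed
  moreover have "E k (y - z) \<in> M" using stableD(2)[OF st z(2) k] M(2) by blast
  ultimately have "E k (y - z) + E k z \<in> M" using M(1) by (intro subspace_add)
  then show ?thesis by (simp add: M_def split: if_splits)
qed

lemma Epow_near:
  assumes hw: "hw K N \<Lambda> x" and k: "k \<in> K" and y: "y \<in> near N (wordspan K x c)"
  shows "(p \<le> count c k \<longrightarrow> (E k ^^ p) y \<in> near N (wordspan K x (c - replicate_mset p k)))
     \<and> (count c k < p \<longrightarrow> (E k ^^ p) y \<in> N)"
proof (induction p)
  case 0
  then show ?case using y by simp
next
  case (Suc p)
  note st = hwD(1)[OF hw]
  consider "count c k < p" | "p = count c k" | "p < count c k" by linarith
  then show ?case
  proof cases
    case 1
    then show ?thesis using Suc stableD(2)[OF st _ k] by simp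
  next
    case 2
    then have "k \<notin># c - replicate_mset p k" by (simp add: not_in_iff)
    then show ?thesis using 2 Suc E_near[OF hw k, of "(E k ^^ p) y" "c - replicate_mset p k"] by simp
  next
    case 3
    then have "k \<in># c - replicate_mset p k" by (simp add: in_diff_count)
    then show ?thesis using 3 Suc E_near[OF hw k, of "(E k ^^ p) y" "c - replicate_mset p k"] by simp
  qed
qed

lemma contents_near:
  assumes "subspace N" "y \<in> near N (wordspan K x c)" "y \<notin> N"
  shows "c \<in> contents K N x"
proof (rule ccontr)
  assume c: "c \<notin> contents K N x"
  obtain z where z: "z \<in> wordspan K x c" "y - z \<in> N" using assms(2) by (auto simp: near_def)
  have "{Fw w x |w. set w \<subseteq> K \<and> mset w = c} \<subseteq> N" using c by (auto simp: contents_def)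
  then have "z \<in> N" using z(1) assms(1) unfolding wordspan_def using span_minimal by blast
  then have "y - z + z \<in> N" using z(2) assms(1) by (intro subspace_add)
  then show False using assms(3) by simp
qed

end

section \<open>Strings and torsion\<close>

context chevalley_operators
begin

lemma T_Fpow_mod:
  assumes st: "stable K N" and k: "k \<in> K" and y: "T (cor k) y - s n y \<in> N"
  shows "T (cor k) ((F k ^^ t) y) - s (n - 2 * of_nat t) ((F k ^^ t) y) \<in> N"
proof (induction t)
  case (Suc t)
  let ?z = "(F k ^^ t) y"
  have rk: "r k (cor k) = 2" using r_cor[of k k] gcm_diag[OF gcm, of k] by simp
  have "T (cor k) (F k ?z) - s (n - 2 * of_nat (Suc t)) (F k ?z)
      = F k (T (cor k) ?z - s (n - 2 * of_nat t) ?z)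
        + (s (n - 2 * of_nat t) (F k ?z) - s 2 (F k ?z) - s (n - 2 * of_nat (Suc t)) (F k ?z))"
    by (simp add: TF_eq rk)
  also have "s (n - 2 * of_nat t) (F k ?z) - s 2 (F k ?z) - s (n - 2 * of_nat (Suc t)) (F k ?z) = 0"
    unfolding scale_left_diff_distrib[symmetric] by simp
  finally show ?case using stableD(3)[OF st Suc k] by simp
qed (use y in simp)

lemma T_Epow_mod:
  assumes st: "stable K N" and k: "k \<in> K" and y: "T (cor k) y - s n y \<in> N"
  shows "T (cor k) ((E k ^^ t) y) - s (n + 2 * of_nat t) ((E k ^^ t) y) \<in> N"
proof (induction t)
  case (Suc t)
  let ?z = "(E k ^^ t) y"
  have rk: "r k (cor k) = 2" using r_cor[of k k] gcm_diag[OF gcm, of k] by simp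
  have "T (cor k) (E k ?z) - s (n + 2 * of_nat (Suc t)) (E k ?z)
      = E k (T (cor k) ?z - s (n + 2 * of_nat t) ?z)
        + (s (n + 2 * of_nat t) (E k ?z) + s 2 (E k ?z) - s (n + 2 * of_nat (Suc t)) (E k ?z))"
    by (simp add: TE_eq rk)
  also have "s (n + 2 * of_nat t) (E k ?z) + s 2 (E k ?z) - s (n + 2 * of_nat (Suc t)) (E k ?z) = 0"
    unfolding scale_left_distrib[symmetric] scale_left_diff_distrib[symmetric] by simp
  finally show ?case using stableD(2)[OF st Suc k] by simp
qed (use y in simp)

lemma F_chain:
  assumes st: "stable K N" and k: "k \<in> K" and y: "y \<notin> N" "E k y \<in> N" "T (cor k) y - s n y \<in> N"
    and nz: "\<And>u. u < t \<Longrightarrow> n \<noteq> of_nat u"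
  shows "(F k ^^ t) y \<notin> N"
  by (rule sl2_chain[where a = "E k" and n = n])
    (use stableD[OF st] k F_linear y nz T_Fpow_mod[OF st k y(3)] in \<open>auto simp: EF\<close>)

lemma F_ladder_top:
  assumes st: "stable K N" and k: "k \<in> K" and y: "E k y \<in> N" "T (cor k) y - s (of_nat n) y \<in> N"
  shows "E k ((F k ^^ Suc n) y) \<in> N"
proof -
  have "E k ((F k ^^ Suc n) y) - s (of_nat (Suc n) * (of_nat n - of_nat n)) ((F k ^^ n) y) \<in> N"
    by (rule sl2_ladder)
      (use stableD[OF st] k F_linear y T_Fpow_mod[OF st k y(2)] in \<open>auto simp: EF\<close>)
  then show ?thesis by simp
qed

lemma E_chain:
  assumes st: "stable K N" and k: "k \<in> K" and y: "y \<notin> N" "F k y \<in> N" "T (cor k) y - s (-n) y \<in> N"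
    and nz: "\<And>u. u < t \<Longrightarrow> n \<noteq> of_nat u"
  shows "(E k ^^ t) y \<notin> N"
proof (rule sl2_chain[where a = "F k" and n = n])
  fix u
  let ?z = "(E k ^^ u) y"
  have "T (cor k) ?z - s (- n + 2 * of_nat u) ?z \<in> N" by (rule T_Epow_mod[OF st k y(3)])
  then have "- (T (cor k) ?z - s (- n + 2 * of_nat u) ?z) \<in> N"
    by (rule subspace_neg[OF stableD(1)[OF st]])
  moreover have "s (n - 2 * of_nat u) ?z = - s (- n + 2 * of_nat u) ?z"
    by (metis minus_diff_eq scale_minus_left uminus_add_conv_diff)
  moreover have "F k (E k ?z) - E k (F k ?z) = - T (cor k) ?z" by (simp add: EF_eq)
  ultimately show "F k (E k ?z) - E k (F k ?z) - s (n - 2 * of_nat u) ?z \<in> N"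
    by simp
qed (use stableD[OF st] k E_linear y nz in auto)

lemma last_power_outside:
  fixes f :: "'v \<Rightarrow> 'v"
  shows "(f ^^ q) y \<in> N \<Longrightarrow> y \<notin> N \<Longrightarrow> \<exists>p<q. (f ^^ p) y \<notin> N \<and> f ((f ^^ p) y) \<in> N"
proof (induction q)
  case (Suc q)
  then show ?case by (cases "(f ^^ q) y \<in> N") (auto intro: less_SucI)
qed simp

text \<open>Climb the \<open>j\<close>-string with \<open>E\<^sub>j\<close> to its top above the given weight, and descend from there with
  \<open>F\<^sub>j\<close>: no vector is lost as long as the value at the top permits. The top exists because
  multiplicities in a content cannot become negative.\<close>
lemma string_down:
  assumes hw: "hw K N \<Lambda> x" and c: "c \<in> contents K N x" and j: "j \<in> K"
    and \<mu>: "\<Lambda> (cor j) = of_int \<mu>" and t: "int t \<le> \<mu> - coroot_value A c j"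
  shows "c + replicate_mset t j \<in> contents K N x"
proof -
  note st = hwD(1)[OF hw]
  obtain w where w: "set w \<subseteq> K" "mset w = c" and out: "Fw w x \<notin> N"
    using c by (auto simp: contents_def)
  let ?y0 = "Fw w x"
  have y0: "?y0 \<in> near N (wordspan K x c)"
    using near_superset[OF stableD(1)[OF st]] Fw_in_wordspan[OF w(1)] w(2) by blast
  have "(E j ^^ Suc (count c j)) ?y0 \<in> N"
    using Epow_near[OF hw j y0, of "Suc (count c j)"] by simp
  from last_power_outside[OF this out]
  obtain p where p: "p \<le> count c j" "(E j ^^ p) ?y0 \<notin> N" "E j ((E j ^^ p) ?y0) \<in> N"
    by (auto simp: less_Suc_eq_le)
  let ?c' = "c - replicate_mset p j"
  let ?y = "(E j ^^ p) ?y0"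
  have sub: "replicate_mset p j \<subseteq># c" using p(1) by (simp add: count_le_replicate_mset_subset_eq)
  have y: "?y \<in> near N (wordspan K x ?c')" using Epow_near[OF hw j y0, of p] p(1) by simp
  define n where "n = \<mu> - coroot_value A c j + 2 * int p"
  have cv: "coroot_value A ?c' j = coroot_value A c j - 2 * int p"
    using gcm_diag[OF gcm, of j] by (simp add: coroot_value_diff[OF sub])
  have "T (cor j) ?y - s (of_int n) ?y \<in> N"
    using T_near[OF hw y, of "cor j"] by (simp add: \<mu> wgt_cor cv n_def algebra_simps)
  then have "(F j ^^ (p + t)) ?y \<notin> N"
  proof (rule F_chain[OF st j p(2,3)])
    fix u assume "u < p + t"
    then have "n \<noteq> int u" using t by (simp add: n_def)
    then show "of_int n \<noteq> (of_nat u :: complex)" by (metis of_int_eq_iff of_int_of_nat_eq)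
  qed
  moreover have "?c' + replicate_mset (p + t) j = c + replicate_mset t j"
    using p(1) by (auto simp: multiset_eq_iff)
  then have "(F j ^^ (p + t)) ?y \<in> near N (wordspan K x (c + replicate_mset t j))"
    using Fpow_near[OF st y j, of "p + t"] by simp
  ultimately show ?thesis using contents_near[OF stableD(1)[OF st]] by blast
qed

definition torsion :: "'i \<Rightarrow> 'v set \<Rightarrow> 'v set" where
  "torsion k N = {y. \<exists>q. (F k ^^ q) y \<in> N}"

lemma Fpow_linear [simp]:
  "(F k ^^ n) (x + y) = (F k ^^ n) x + (F k ^^ n) y" "(F k ^^ n) (s a x) = s a ((F k ^^ n) x)"
  "(F k ^^ n) 0 = 0"
  by (induction n) auto

lemma Fpow_later:
  assumes "stable K N" "k \<in> K" "(F k ^^ p) y \<in> N" "p \<le> q"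
  shows "(F k ^^ q) y \<in> N"
  using stable_Fpow[OF assms(1,2,3), of "q - p"] assms(4)
  by (metis comp_apply funpow_add le_add_diff_inverse2)

text \<open>The Ore condition for the powers of \<open>F\<^sub>k\<close>, by double induction over
  \<open>F\<^sub>k G = [F\<^sub>k, G] + G F\<^sub>k\<close>: the commutator lowers \<open>p\<close>, the other term lowers \<open>q\<close>.\<close>
lemma torsion_commutator:
  assumes st: "stable K N" and k: "k \<in> K"
    and "\<And>y. y \<in> N \<Longrightarrow> G y \<in> N" and "(commutator (F k) ^^ p) G = (\<lambda>x. 0)" and "(F k ^^ q) y \<in> N"
  shows "\<exists>l. (F k ^^ l) (G y) \<in> N"
  using assms(3-)
proof (induction "p + q" arbitrary: p q G y rule: less_induct)
  case less
  note N = stableD(1)[OF st]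
  show ?case
  proof (cases p)
    case 0
    then have "G y = 0" using less.prems(2) by simp
    then show ?thesis using subspace_0[OF N] by (intro exI[of _ 0]) simp
  next
    case p: (Suc p')
    show ?thesis
    proof (cases q)
      case 0
      then show ?thesis using less.prems by (intro exI[of _ 0]) simp
    next
      case q: (Suc q')
      have "\<exists>l. (F k ^^ l) (commutator (F k) G y) \<in> N"
      proof (rule less.hyps[of p' q "commutator (F k) G" y])
        show "commutator (F k) G z \<in> N" if "z \<in> N" for z
          using that less.prems(1) stableD(3)[OF st _ k] subspace_diff[OF N] by (simp add: commutator_def)
        show "(commutator (F k) ^^ p') (commutator (F k) G) = (\<lambda>x. 0)"
          using less.prems(2) by (simp add: p funpow_swap1)
      qed (use p less.prems in auto)
      then obtain l1 where l1: "(F k ^^ l1) (commutator (F k) G y) \<in> N" by blast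
      have "\<exists>l. (F k ^^ l) (G (F k y)) \<in> N"
        by (rule less.hyps[of p q' G "F k y"]) (use q less.prems in \<open>auto simp: funpow_swap1\<close>)
      then obtain l2 where l2: "(F k ^^ l2) (G (F k y)) \<in> N" by blast
      define l where "l = max l1 l2"
      have "F k (G y) = commutator (F k) G y + G (F k y)" by (simp add: commutator_def)
      then have "(F k ^^ Suc l) (G y) = (F k ^^ l) (commutator (F k) G y) + (F k ^^ l) (G (F k y))"
        by (simp add: funpow_swap1)
      moreover have "\<dots> \<in> N"
        using Fpow_later[OF st k l1, of l] Fpow_later[OF st k l2, of l]
        by (intro subspace_add[OF N]) (auto simp: l_def)
      ultimately show ?thesis by metis
    qed
  qed
qed

text \<open>All operators are ad-nilpotent under \<open>F\<^sub>k\<close>, by the Serre relations for \<open>F\<^sub>l\<close>.\<close>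
lemma stable_torsion:
  assumes st: "stable K N" and k: "k \<in> K"
  shows "stable K (torsion k N)"
proof -
  note N = stableD(1)[OF st]
  have rk: "r k (cor k) = 2" using r_cor[of k k] gcm_diag[OF gcm, of k] by simp
  have FF: "commutator (F k) (F k) = (\<lambda>x. 0)" by (simp add: commutator_def fun_eq_iff)
  have "subspace (torsion k N)"
  proof (rule subspaceI)
    show "0 \<in> torsion k N" using subspace_0[OF N] by (auto simp: torsion_def intro!: exI[of _ 0])
    show "x + y \<in> torsion k N" if "x \<in> torsion k N" "y \<in> torsion k N" for x y
    proof -
      obtain p q where "(F k ^^ p) x \<in> N" "(F k ^^ q) y \<in> N" using \<open>x \<in> _\<close> \<open>y \<in> _\<close> by (auto simp: torsion_def)
      then have "(F k ^^ max p q) (x + y) \<in> N"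
        using Fpow_later[OF st k] by (simp add: subspace_add[OF N])
      then show ?thesis by (auto simp: torsion_def)
    qed
    show "s a x \<in> torsion k N" if "x \<in> torsion k N" for a x
      using that subspace_scale[OF N] by (fastforce simp: torsion_def)
  qed
  moreover have "F l y \<in> torsion k N" if "l \<in> K" "y \<in> torsion k N" for l y
  proof -
    have "(commutator (F k) ^^ (if l = k then 1 else nat (1 - A $ k $ l))) (F l) = (\<lambda>x. 0)"
      using FF serre_F[of k l] by auto
    then show ?thesis
      using torsion_commutator[OF st k, of "F l"] stableD(3)[OF st _ that(1)] that(2) by (auto simp: torsion_def)
  qed
  moreover have "E l y \<in> torsion k N" if "l \<in> K" "y \<in> torsion k N" for l y
  proof -
    have "commutator (F k) (E l) = (if k = l then (\<lambda>z. - T (cor k) z) else (\<lambda>z. 0))"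
      by (auto simp: commutator_def fun_eq_iff EF_eq)
    moreover have "commutator (F k) (\<lambda>z. - T (cor k) z) = (\<lambda>z. - s 2 (F k z))"
      by (auto simp: commutator_def fun_eq_iff TF_eq rk)
    moreover have "commutator (F k) (\<lambda>z. - s 2 (F k z)) = (\<lambda>z. 0)" "commutator (F k) (\<lambda>z. 0) = (\<lambda>z. 0)"
      by (auto simp: commutator_def fun_eq_iff)
    ultimately have "(commutator (F k) ^^ 3) (E l) = (\<lambda>x. 0)"
      by (cases "k = l") (simp_all add: numeral_3_eq_3)
    then show ?thesis
      using torsion_commutator[OF st k, of "E l"] stableD(2)[OF st _ that(1)] that(2) by (auto simp: torsion_def)
  qed
  moreover have "T h y \<in> torsion k N" if "y \<in> torsion k N" for h y
  proof -
    have "commutator (F k) (T h) = (\<lambda>z. s (r k h) (F k z))"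
      by (auto simp: commutator_def fun_eq_iff TF_eq)
    moreover have "commutator (F k) (\<lambda>z. s (r k h) (F k z)) = (\<lambda>z. 0)"
      by (auto simp: commutator_def fun_eq_iff)
    ultimately have "(commutator (F k) ^^ 2) (T h) = (\<lambda>x. 0)"
      by (simp add: numeral_2_eq_2)
    then show ?thesis
      using torsion_commutator[OF st k, of "T h"] stableD(4)[OF st] that by (auto simp: torsion_def)
  qed
  ultimately show ?thesis by (auto simp: stable_def)
qed

lemma torsion_superset: "N \<subseteq> torsion k N"
  by (auto simp: torsion_def intro: exI[of _ 0])

lemma torsion_mono: "N \<subseteq> N' \<Longrightarrow> torsion k N \<subseteq> torsion k N'"
  by (auto simp: torsion_def)

text \<open>The vector after the end of the string is singular with a negative value at \<open>k\<close>, so \<open>F\<^sub>k\<close> is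
  nilpotent on it only if it vanishes modulo \<open>N\<close>.\<close>
lemma torsion_iff:
  assumes st: "stable K N" and k: "k \<in> K"
    and y: "E k y \<in> N" "T (cor k) y - s (of_nat n) y \<in> N"
  shows "y \<in> torsion k N \<longleftrightarrow> (F k ^^ Suc n) y \<in> N"
proof
  assume "y \<in> torsion k N"
  then obtain q where q: "(F k ^^ q) y \<in> N" by (auto simp: torsion_def)
  show "(F k ^^ Suc n) y \<in> N"
  proof (rule ccontr)
    let ?z = "(F k ^^ Suc n) y"
    assume z: "?z \<notin> N"
    have "E k ?z \<in> N" by (rule F_ladder_top[OF st k y])
    moreover have "T (cor k) ?z - s (of_nat n - 2 * of_nat (Suc n)) ?z \<in> N"
      by (rule T_Fpow_mod[OF st k y(2)])
    moreover have "of_nat n - 2 * of_nat (Suc n) \<noteq> (of_nat u :: complex)" for u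
    proof
      assume "of_nat n - 2 * of_nat (Suc n) = (of_nat u :: complex)"
      then have "of_int (int n - 2 * int (Suc n)) = (of_int (int u) :: complex)" by simp
      then show False unfolding of_int_eq_iff by simp
    qed
    ultimately have "(F k ^^ q) ?z \<notin> N" using F_chain[OF st k z] by blast
    moreover have "(F k ^^ q) ?z = (F k ^^ Suc n) ((F k ^^ q) y)"
      by (metis add.commute comp_apply funpow_add)
    ultimately show False using stable_Fpow[OF st k q] by metis
  qed
qed (auto simp: torsion_def simp del: funpow.simps)

text \<open>The reflection of a weight, in the form that is used: descend with \<open>F\<^sub>j\<close> to the bottom of the
  string and climb up again with \<open>E\<^sub>j\<close>.\<close>
lemma reflect_content:
  assumes hw: "hw K N \<Lambda> x" and c: "c \<in> contents K N x" and j: "j \<in> K"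
    and \<mu>: "\<Lambda> (cor j) = of_int \<mu>" and tor: "x \<in> torsion j N"
  shows "\<exists>k. k \<le> count c j \<and> coroot_value A c j - \<mu> \<le> int k \<and> c - replicate_mset k j \<in> contents K N x"
proof (cases "coroot_value A c j \<le> \<mu>")
  case True
  then show ?thesis using c by (intro exI[of _ 0]) simp
next
  case False
  note st = hwD(1)[OF hw]
  obtain w where w: "set w \<subseteq> K" "mset w = c" and out: "Fw w x \<notin> N"
    using c by (auto simp: contents_def)
  let ?y0 = "Fw w x"
  have y0: "?y0 \<in> near N (wordspan K x c)"
    using near_superset[OF stableD(1)[OF st]] Fw_in_wordspan[OF w(1)] w(2) by blast
  have "?y0 \<in> torsion j N" by (rule stable_Fw[OF stable_torsion[OF st j] w(1) tor])
  then obtain q where "(F j ^^ q) ?y0 \<in> N" by (auto simp: torsion_def)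
  from last_power_outside[OF this out]
  obtain p where p: "(F j ^^ p) ?y0 \<notin> N" "F j ((F j ^^ p) ?y0) \<in> N" by auto
  let ?y = "(F j ^^ p) ?y0"
  let ?c' = "c + replicate_mset p j"
  have y: "?y \<in> near N (wordspan K x ?c')" by (rule Fpow_near[OF st y0 j])
  define n where "n = nat (2 * int p + coroot_value A c j - \<mu>)"
  have n: "int n = 2 * int p + coroot_value A c j - \<mu>" using False by (simp add: n_def)
  then have n': "(of_nat n :: complex) = of_int (2 * int p + coroot_value A c j - \<mu>)"
    by (metis of_int_of_nat_eq)
  have "T (cor j) ?y - s (- of_nat n) ?y \<in> N"
    using T_near[OF hw y, of "cor j"] gcm_diag[OF gcm, of j]
    by (simp add: \<mu> wgt_cor n' algebra_simps)
  then have E: "(E j ^^ n) ?y \<notin> N" by (rule E_chain[OF st j p]) simp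
  have le: "n \<le> count c j + p"
  proof (rule ccontr)
    assume "\<not> n \<le> count c j + p"
    then have "count ?c' j < n" by simp
    then show False using Epow_near[OF hw j y, of n] E by blast
  qed
  then have "?c' - replicate_mset n j \<in> contents K N x"
    using Epow_near[OF hw j y, of n] contents_near[OF stableD(1)[OF st] _ E] by simp
  moreover have "?c' - replicate_mset n j = c - replicate_mset (n - p) j"
    using n False by (auto simp: multiset_eq_iff)
  moreover have "n - p \<le> count c j" "coroot_value A c j - \<mu> \<le> int (n - p)"
    using le n False by auto
  ultimately show ?thesis by metis
qed

text \<open>By induction on the size of the content. If the word of a weight starts with a node of \<open>J\<close>,
  the weight is not at the top of its string, and the string can be entered from a smaller
  content. With \<open>reach_subset_contents\<close>, the contents of a module on which all nodes of \<open>K\<close> act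
  nilpotently depend only on the values \<open>m\<close>.\<close>
lemma contents_subset_reach:
  assumes hw: "hw K N \<Lambda> x" and JK: "J \<subseteq> K"
    and tor: "\<And>j. j \<in> J \<Longrightarrow> x \<in> torsion j N"
    and m: "\<And>j. j \<in> J \<Longrightarrow> \<Lambda> (cor j) = of_int (m j)"
    and c: "c \<in> contents K N x"
  shows "c \<in> reach A (K - J) J m"
  using c
proof (induction "size c" arbitrary: c rule: less_induct)
  case less
  obtain w where w: "set w \<subseteq> K" "mset w = c" and out: "Fw w x \<notin> N"
    using less.prems by (auto simp: contents_def)
  show ?case
  proof (cases w)
    case Nil
    then show ?thesis using w reach.empty by auto
  next
    case (Cons i w')
    have i: "i \<in> K" and w': "set w' \<subseteq> K" using Cons w by auto
    have "Fw w' x \<notin> N" using out Cons stableD(3)[OF hwD(1)[OF hw] _ i] by auto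
    then have "mset w' \<in> contents K N x" using w' by (auto simp: contents_def)
    moreover have c: "c = add_mset i (mset w')" using w(2) Cons by simp
    ultimately have IH: "mset w' \<in> reach A (K - J) J m" using less.hyps by simp
    show ?thesis
    proof (cases "i \<in> J")
      case False
      then show ?thesis using IH i c reach.free[of "mset w'" A "K - J" J m i] by simp
    next
      case True
      obtain k where k: "k \<le> count c i" "coroot_value A c i - m i \<le> int k"
        and c': "c - replicate_mset k i \<in> contents K N x"
        using reflect_content[OF hw less.prems i m[OF True] tor[OF True]] by blast
      have sub: "replicate_mset k i \<subseteq># c" using k(1) by (simp add: count_le_replicate_mset_subset_eq)
      show ?thesis
      proof (cases "k = 0")
        case True
        then have "mset w' + replicate_mset 1 i \<in> reach A (K - J) J m"
          using k c IH \<open>i \<in> J\<close> gcm_diag[OF gcm, of i] by (intro reach.string) auto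
        then show ?thesis using c by simp
      next
        case False
        have "size (c - replicate_mset k i) < size c"
          using False k(1) by (intro mset_subset_size) (auto simp: subset_mset_def multiset_eq_iff in_diff_count)
        then have "c - replicate_mset k i \<in> reach A (K - J) J m" using less.hyps c' by blast
        then have "c - replicate_mset k i + replicate_mset k i \<in> reach A (K - J) J m"
          using k \<open>i \<in> J\<close> gcm_diag[OF gcm, of i] by (intro reach.string) (auto simp: coroot_value_diff[OF sub])
        then show ?thesis using sub by (simp add: subset_mset.diff_add)
      qed
    qed
  qed
qed

lemma reach_subset_contents:
  assumes hw: "hw K N \<Lambda> x" and x: "x \<notin> N" and JK: "J \<subseteq> K"
    and m: "\<And>j. j \<in> J \<Longrightarrow> \<Lambda> (cor j) = of_int (m j)"
    and c: "c \<in> reach A {} J m"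
  shows "c \<in> contents K N x"
  using c
proof induction
  case empty
  then show ?case using x by (auto simp: contents_def intro!: exI[of _ "[]"])
next
  case (string c j t)
  then show ?case using string_down[OF hw string.IH _ m] JK by auto
qed auto

definition submodule_of :: "'v \<Rightarrow> 'v set" where
  "submodule_of y = \<Inter>{M. stable UNIV M \<and> y \<in> M}"

lemma submodule_of_self: "y \<in> submodule_of y" and submodule_of_minimal: "stable UNIV M \<Longrightarrow> y \<in> M \<Longrightarrow> submodule_of y \<subseteq> M"
  by (auto simp: submodule_of_def)

lemma stable_submodule_of: "stable UNIV (submodule_of y)"
  unfolding stable_def submodule_of_def
  by (auto intro!: subspace_Inter dest: stableD)

text \<open>The vector \<open>y\<close> is torsion for \<open>F\<^sub>k\<close> modulo the submodule of \<open>F\<^sub>k y\<close>, hence so is \<open>z\<close>. But the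
  non-natural value at \<open>k\<close> makes \<open>F\<^sub>k\<close> act freely on the singular vector \<open>z\<close>.\<close>
lemma F_submodule_of:
  assumes z: "z \<in> submodule_of y" "E k z = 0" "T (cor k) z = s n z" and n: "\<And>u. n \<noteq> of_nat u"
  shows "z \<in> submodule_of (F k y)"
proof (rule ccontr)
  assume out: "z \<notin> submodule_of (F k y)"
  let ?M = "submodule_of (F k y)"
  note st = stable_submodule_of[of "F k y"]
  have "y \<in> torsion k ?M" using submodule_of_self by (auto simp: torsion_def intro!: exI[of _ 1])
  then have "z \<in> torsion k ?M"
    using submodule_of_minimal[OF stable_torsion[OF st]] z(1) by blast
  then obtain q where q: "(F k ^^ q) z \<in> ?M" by (auto simp: torsion_def)
  have "(F k ^^ q) z \<notin> ?M"
    by (rule F_chain[OF st _ out, of k n]) (use z n subspace_0[OF stableD(1)[OF st]] in auto)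
  then show False using q by blast
qed

end

section \<open>Weight components\<close>

context chevalley_operators
begin

text \<open>Weight vectors of different weights are separated by the operators \<open>T h\<close>; each step applies
  \<open>T h - \<omega> b h\<close> to remove one vector \<open>b\<close> of a wrong weight from the combination.\<close>
lemma weight_component:
  assumes st: "subspace N" "\<And>h y. y \<in> N \<Longrightarrow> T h y \<in> N"
    and y: "\<And>h. T h y = s (\<mu> h) y"
    and B: "\<And>b h. b \<in> B \<Longrightarrow> T h b = s (\<omega> b h) b"
    and z: "z \<in> span B" "y - z \<in> N"
  shows "\<exists>z'\<in>span {b\<in>B. \<omega> b = \<mu>}. y - z' \<in> N"
proof -
  have main: "finite S \<Longrightarrow> S \<subseteq> B \<Longrightarrow> (\<And>b. b \<in> S \<Longrightarrow> \<omega> b \<noteq> \<mu>) \<Longrightarrow> z' \<in> span {b\<in>B. \<omega> b = \<mu>}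
      \<Longrightarrow> y - z' - (\<Sum>b\<in>S. s (a b) b) \<in> N \<Longrightarrow> \<exists>z'\<in>span {b\<in>B. \<omega> b = \<mu>}. y - z' \<in> N" for S z' a
  proof (induction S arbitrary: z' a rule: finite_induct)
    case empty
    then show ?case by auto
  next
    case (insert b S)
    then have "\<omega> b \<noteq> \<mu>" by blast
    then obtain h where h: "\<omega> b h \<noteq> \<mu> h" by (auto simp: fun_eq_iff)
    let ?X = "y - z' - (\<Sum>b\<in>insert b S. s (a b) b)"
    have Tz: "T h z' = s (\<mu> h) z'" using insert.prems(3)
    proof (induction rule: span_induct_alt)
      case (step c x y)
      then have "T h x = s (\<mu> h) x" using B[of x h] by auto
      then show ?case using step.IH by (simp add: scale_right_distrib mult.commute)
    qed simp
    have TS: "T h (\<Sum>b\<in>insert b S. s (a b) b) = (\<Sum>b\<in>insert b S. s (a b * \<omega> b h) b)"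
    proof -
      have "T h (s (a c) c) = s (a c * \<omega> c h) c" if "c \<in> insert b S" for c
        using B[of c h] that insert.prems(1) by auto
      then show ?thesis unfolding module_hom.sum[OF T_hom] by (rule sum.cong[OF refl])
    qed
    have TX: "T h ?X = s (\<mu> h) (y - z') - (\<Sum>b\<in>insert b S. s (a b * \<omega> b h) b)"
      unfolding module_hom.diff[OF T_hom] Tz TS y scale_right_diff_distrib ..
    let ?e = "\<mu> h - \<omega> b h"
    let ?Y' = "s ?e (y - z') - (\<Sum>c\<in>S. s (a c * (\<omega> c h - \<omega> b h)) c)"
    have X: "T h ?X - s (\<omega> b h) ?X \<in> N"
      using subspace_diff[OF st(1) st(2)[OF insert.prems(4)] subspace_scale[OF st(1) insert.prems(4)]] .
    have 1: "s (a b * \<omega> b h) b = s (\<omega> b h) (s (a b) b)" by (simp add: mult.commute)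
    have 2: "(\<Sum>c\<in>S. s (a c * (\<omega> c h - \<omega> b h)) c)
        = (\<Sum>c\<in>S. s (a c * \<omega> c h) c) - s (\<omega> b h) (\<Sum>c\<in>S. s (a c) c)"
      by (simp add: scale_sum_right right_diff_distrib scale_left_diff_distrib sum_subtractf mult.commute)
    have 3: "P - (x + Q) - (U - (x + R)) = (P - U) - (Q - R)" for P Q R U x :: 'v by simp
    have 4: "s (\<omega> b h) ?X = s (\<omega> b h) (y - z') - (s (\<omega> b h) (s (a b) b) + s (\<omega> b h) (\<Sum>c\<in>S. s (a c) c))"
      by (simp only: sum.insert[OF insert.hyps] scale_right_distrib scale_right_diff_distrib[of _ "y - z'"])
    have 5: "T h ?X = s (\<mu> h) (y - z') - (s (\<omega> b h) (s (a b) b) + (\<Sum>c\<in>S. s (a c * \<omega> c h) c))"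
      unfolding TX by (simp only: sum.insert[OF insert.hyps] 1)
    have "?Y' \<in> N"
      using X unfolding 4 5 3 2[symmetric] scale_left_diff_distrib[symmetric] .
    then have Y: "s (inverse ?e) ?Y' \<in> N" by (rule subspace_scale[OF st(1)])
    have "s (inverse ?e) ?Y'
      = y - z' - (\<Sum>c\<in>S. s (inverse ?e * (a c * (\<omega> c h - \<omega> b h))) c)"
      using h by (subst scale_right_diff_distrib) (simp add: scale_sum_right)
    then have "y - z' - (\<Sum>c\<in>S. s (inverse ?e * (a c * (\<omega> c h - \<omega> b h))) c) \<in> N"
      using Y by (simp only:)
    then show ?case
      using insert.prems(1,2) by (intro insert.IH[OF _ _ insert.prems(3)]) auto
  qed
  obtain t a where t: "finite t" "t \<subseteq> B" "z = (\<Sum>b\<in>t. s (a b) b)"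
    using z(1) by (auto simp: span_explicit)
  let ?t1 = "{b\<in>t. \<omega> b = \<mu>}" and ?t2 = "{b\<in>t. \<omega> b \<noteq> \<mu>}"
  have "t = ?t1 \<union> ?t2" by auto
  then have "z = (\<Sum>b\<in>?t1. s (a b) b) + (\<Sum>b\<in>?t2. s (a b) b)"
    unfolding t(3) using t(1) by (subst sum.union_disjoint[symmetric]) auto
  then have "y - (\<Sum>b\<in>?t1. s (a b) b) - (\<Sum>b\<in>?t2. s (a b) b) \<in> N"
    using z(2) by (simp add: diff_diff_eq)
  moreover have "(\<Sum>b\<in>?t1. s (a b) b) \<in> span {b\<in>B. \<omega> b = \<mu>}"
    using t(2) by (intro span_sum span_scale span_base) auto
  ultimately show ?thesis using t(1,2) by (intro main[of ?t2 "\<Sum>b\<in>?t1. s (a b) b" a]) auto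
qed

end

section \<open>Every weight lies in a transversal region\<close>

lemma coroot_value_outside:
  assumes "generalized_cartan_matrix A" and "j \<notin># d"
  shows "coroot_value A d j \<le> 0" and "A $ j $ l \<noteq> 0 \<Longrightarrow> int (count d l) \<le> - coroot_value A d j"
proof -
  have "coroot_value A d j \<le> 0 \<and> (A $ j $ l \<noteq> 0 \<longrightarrow> int (count d l) \<le> - coroot_value A d j)"
    using assms(2)
  proof (induction d)
    case (add i d)
    have "A $ j $ i \<le> 0" using gcm_off_diag[OF assms(1), of j i] add.prems by auto
    then show ?case using add by auto
  qed simp
  then show "coroot_value A d j \<le> 0" and "A $ j $ l \<noteq> 0 \<Longrightarrow> int (count d l) \<le> - coroot_value A d j"
    by auto
qed

context chevalley_operators
begin

lemma weight_unique: "y \<noteq> 0 \<Longrightarrow> T h y = s a y \<Longrightarrow> T h y = s b y \<Longrightarrow> a = b"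
  by (metis scale_right_imp_eq)

lemma weight_component_vector:
  assumes N: "subspace N" "\<And>h y. y \<in> N \<Longrightarrow> T h y \<in> N"
    and y: "\<And>h. T h y = s (\<mu> h) y" "y \<notin> N"
    and B: "\<And>b. b \<in> B \<Longrightarrow> \<exists>\<nu>. \<forall>h. T h b = s (\<nu> h) b"
    and z: "z \<in> span B" "y - z \<in> N"
  shows "\<exists>b\<in>B. b \<notin> N \<and> (\<forall>h. T h b = s (\<mu> h) b)"
proof -
  obtain \<omega> where \<omega>: "\<And>b h. b \<in> B \<Longrightarrow> T h b = s (\<omega> b h) b" using B by metis
  obtain z' where z': "z' \<in> span {b\<in>B. \<omega> b = \<mu>}" "y - z' \<in> N"
    using weight_component[OF N y(1) \<omega> z] by blast
  have "\<not> {b\<in>B. \<omega> b = \<mu>} \<subseteq> N"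
  proof
    assume "{b\<in>B. \<omega> b = \<mu>} \<subseteq> N"
    then have "z' \<in> N" using z'(1) span_minimal[OF _ N(1)] by blast
    then have "y - z' + z' \<in> N" using z'(2) by (intro subspace_add[OF N(1)])
    then show False using y(2) by simp
  qed
  then obtain b where "b \<in> B" "\<omega> b = \<mu>" "b \<notin> N" by blast
  then show ?thesis using \<omega>[of b] by auto
qed

text \<open>For natural \<open>\<Lambda> (cor i)\<close> this is \<open>\<Lambda> (cor i) + 1\<close>, the power of \<open>F\<^sub>i\<close> that takes a highest weight
  vector to a singular one.\<close>
definition exponent :: "('h \<Rightarrow> complex) \<Rightarrow> 'i \<Rightarrow> nat" where
  "exponent \<Lambda> i = Suc (nat \<lfloor>Re (\<Lambda> (cor i))\<rfloor>)"

definition coval :: "('h \<Rightarrow> complex) \<Rightarrow> 'i \<Rightarrow> int" where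
  "coval \<Lambda> i = \<lfloor>Re (\<Lambda> (cor i))\<rfloor>"

definition dominant_nodes :: "('h \<Rightarrow> complex) \<Rightarrow> 'i set" where
  "dominant_nodes \<Lambda> = {i. \<Lambda> (cor i) \<in> \<nat>}"

lemma coval_of_int: "\<Lambda> (cor i) = of_int z \<Longrightarrow> coval \<Lambda> i = z"
  by (simp add: coval_def)

lemma dominant_nodesD:
  assumes "i \<in> dominant_nodes \<Lambda>"
  shows "\<Lambda> (cor i) = of_int (coval \<Lambda> i)" "0 \<le> coval \<Lambda> i" "int (exponent \<Lambda> i) = coval \<Lambda> i + 1"
    "\<Lambda> (cor i) = of_nat (exponent \<Lambda> i - 1)" "of_nat (exponent \<Lambda> i) = \<Lambda> (cor i) + 1"
  using assms by (auto simp: dominant_nodes_def coval_def exponent_def Nats_def)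

lemma exponent_pos: "0 < exponent \<Lambda> i"
  by (simp add: exponent_def)

lemma of_int_in_Nats_iff: "(of_int z :: complex) \<in> \<nat> \<longleftrightarrow> 0 \<le> z"
proof
  assume "(of_int z :: complex) \<in> \<nat>"
  then obtain n where "(of_int z :: complex) = of_nat n" by (auto simp: Nats_def)
  then have "z = int n" by (metis of_int_eq_iff of_int_of_nat_eq)
  then show "0 \<le> z" by simp
qed (metis of_nat_0_le_iff of_nat_in_Nats of_int_of_nat_eq zero_le_imp_eq_int)

lemma E_Fpow_commute: "k \<noteq> i \<Longrightarrow> E k ((F i ^^ n) x) = (F i ^^ n) (E k x)"
  by (induction n) (simp_all add: EF_eq)

lemma hw_singular:
  assumes hw: "hw K N \<Lambda> x" and i: "i \<in> K" "i \<in> dominant_nodes \<Lambda>"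
  shows "hw K N (\<lambda>h. \<Lambda> h - of_nat (exponent \<Lambda> i) * r i h) ((F i ^^ exponent \<Lambda> i) x)"
  unfolding hw_def
proof (intro conjI ballI allI)
  note st = hwD(1)[OF hw]
  show "stable K N" by (rule st)
  show "E k ((F i ^^ exponent \<Lambda> i) x) \<in> N" if "k \<in> K" for k
  proof (cases "k = i")
    case True
    have "E i ((F i ^^ Suc (exponent \<Lambda> i - 1)) x) \<in> N"
      by (rule F_ladder_top[OF st i(1) hwD(2)[OF hw i(1)]])
        (simp add: hwD(3)[OF hw] dominant_nodesD(4)[OF i(2)] subspace_0[OF stableD(1)[OF st]])
    then show ?thesis using True exponent_pos[of \<Lambda> i] by simp
  next
    case False
    then show ?thesis using stable_Fpow[OF st i(1) hwD(2)[OF hw that]] by (simp add: E_Fpow_commute)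
  qed
  show "T h ((F i ^^ exponent \<Lambda> i) x) = s (\<Lambda> h - of_nat (exponent \<Lambda> i) * r i h) ((F i ^^ exponent \<Lambda> i) x)" for h
    using T_Fw[of h x \<Lambda> "replicate (exponent \<Lambda> i) i"] hwD(3)[OF hw] by simp
qed

text \<open>Vectors killed modulo \<open>N\<close> by a product of powers of the \<open>F\<^sub>l\<close>, \<open>l\<close> in the list. For commuting
  \<open>F\<^sub>l\<close> the order of the list does not matter.\<close>
definition torsions :: "'i list \<Rightarrow> 'v set \<Rightarrow> 'v set" where
  "torsions ls N = foldr torsion ls N"

lemma torsions_simps [simp]: "torsions [] N = N" "torsions (l # ls) N = torsion l (torsions ls N)"
  by (simp_all add: torsions_def)

lemma stable_torsions: "stable UNIV N \<Longrightarrow> stable UNIV (torsions ls N)"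
  by (induction ls) (auto intro: stable_torsion)

lemma torsions_mono: "N \<subseteq> N' \<Longrightarrow> torsions ls N \<subseteq> torsions ls N'"
  by (induction ls) (auto dest: torsion_mono)

lemma torsions_superset: "N \<subseteq> torsions ls N"
  by (induction ls) (use torsion_superset in auto)

lemma F_commute:
  assumes "A $ i $ j = 0 \<or> i = j"
  shows "F i (F j x) = F j (F i x)"
proof (cases "i = j")
  case False
  then have "commutator (F i) (F j) x = 0" using serre_F[of i j] assms by simp
  then show ?thesis by (simp add: commutator_def)
qed simp

lemma Fpow_commute:
  assumes "A $ i $ j = 0 \<or> i = j"
  shows "(F i ^^ p) ((F j ^^ q) x) = (F j ^^ q) ((F i ^^ p) x)"
proof -
  have 1: "F i ((F j ^^ q) x) = (F j ^^ q) (F i x)" for x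
    by (induction q) (simp_all add: F_commute[OF assms])
  show ?thesis by (induction p) (simp_all add: 1)
qed

lemma torsion_commute:
  assumes "A $ a $ b = 0"
  shows "torsion a (torsion b N) = torsion b (torsion a N)"
proof -
  have "(F b ^^ q) ((F a ^^ p) y) = (F a ^^ p) ((F b ^^ q) y)" for p q y
    using Fpow_commute[of a b] assms by simp
  then show ?thesis unfolding torsion_def by auto
qed

lemma independent_entry:
  "independent_nodes A I \<Longrightarrow> i \<in> I \<Longrightarrow> j \<in> I \<Longrightarrow> i \<noteq> j \<Longrightarrow> A $ i $ j = 0"
  by (auto simp: independent_nodes_def dynkin_edge_def)

lemma torsions_move_front:
  assumes "independent_nodes A (set ls)" "i \<in> set ls"
  shows "torsions ls N = torsion i (torsions (remove1 i ls) N)"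
  using assms
proof (induction ls)
  case (Cons a ls)
  show ?case
  proof (cases "a = i")
    case False
    have "independent_nodes A (set ls)" using Cons.prems(1) by (auto simp: independent_nodes_def)
    then have "torsions (a # ls) N = torsion a (torsion i (torsions (remove1 i ls) N))"
      using Cons False by simp
    moreover have "A $ a $ i = 0" using independent_entry[OF Cons.prems(1), of a i] Cons.prems(2) False by auto
    ultimately show ?thesis using torsion_commute[of a i] False by simp
  qed simp
qed simp

lemma word_outside_of_torsions:
  "y \<notin> torsions ls N \<Longrightarrow> distinct ls \<Longrightarrow>
     \<exists>w. mset w = (\<Sum>i\<in>set ls. replicate_mset (n i) i) \<and> Fw w y \<notin> N"
proof (induction ls arbitrary: y)
  case Nil
  then show ?case by (intro exI[of _ "[]"]) simp
next
  case (Cons a ls)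
  then have "(F a ^^ n a) y \<notin> torsions ls N" by (auto simp: torsion_def)
  then obtain w where w: "mset w = (\<Sum>i\<in>set ls. replicate_mset (n i) i)" "Fw w ((F a ^^ n a) y) \<notin> N"
    using Cons by auto
  then show ?case using Cons.prems(2)
    by (intro exI[of _ "w @ replicate (n a) a"]) (simp add: add.commute)
qed

text \<open>For independent nodes, a highest weight vector \<open>x\<close> is torsion if and only if the vector at
  their corner lies in \<open>N\<close>. So this says that \<open>J\<close> meets every independent set with missing corner. The formulation with torsion
  passes to singular vectors without computation, because torsion submodules are stable.\<close>
definition transversal :: "'v set \<Rightarrow> 'v \<Rightarrow> ('h \<Rightarrow> complex) \<Rightarrow> 'i set \<Rightarrow> bool" where
  "transversal N x \<Lambda> J \<longleftrightarrow> (\<forall>ls. distinct ls \<longrightarrow> independent_nodes A (set ls)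
      \<longrightarrow> set ls \<subseteq> dominant_nodes \<Lambda> - J \<longrightarrow> x \<notin> torsions ls N)"

lemma near_span_closed:
  assumes G: "Vector_Spaces.linear s s G" and N: "subspace N" and GN: "\<And>y. y \<in> N \<Longrightarrow> G y \<in> N"
    and GB: "\<And>b. b \<in> B \<Longrightarrow> G b \<in> near N (span B)" and y: "y \<in> near N (span B)"
  shows "G y \<in> near N (span B)"
proof -
  have hom: "module_hom s s G" using G by (rule Vector_Spaces.linear.axioms(3))
  have sub: "subspace (near N (span B))" by (rule subspace_near[OF N]) simp
  obtain z where z: "z \<in> span B" "y - z \<in> N" using y by (auto simp: near_def)
  have "G z \<in> near N (span B)" using z(1)
  proof (induction rule: span_induct_alt)
    case base
    then show ?case using subspace_0[OF sub] module_hom.zero[OF hom] by simp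
  next
    case (step c b z)
    then show ?case using GB[of b]
      by (simp add: module_hom.add[OF hom] module_hom.scale[OF hom] subspace_add[OF sub] subspace_scale[OF sub])
  qed
  moreover have "G (y - z) \<in> near N (span B)" using GN[OF z(2)] near_N[of "span B" N] by auto
  ultimately have "G (y - z) + G z \<in> near N (span B)" by (intro subspace_add[OF sub])
  then show ?thesis by (simp add: module_hom.diff[OF hom])
qed

lemma stable_near_words:
  assumes hw: "hw K N \<Lambda> x"
  shows "stable K (near N (span {Fw w x | w. set w \<subseteq> K}))"
proof -
  let ?B = "{Fw w x | w. set w \<subseteq> K}"
  note st = hwD(1)[OF hw]
  note N = stableD(1)[OF st]
  have sub: "near N (wordspan K x c) \<subseteq> near N (span ?B)" for c
  proof -
    have "wordspan K x c \<subseteq> span ?B" unfolding wordspan_def by (rule span_mono) auto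
    then show ?thesis by (auto simp: near_def)
  qed
  have NB: "N \<subseteq> near N (span ?B)" by (rule near_N) simp
  have BB: "span ?B \<subseteq> near N (span ?B)" by (rule near_superset[OF N])
  have "E k y \<in> near N (span ?B)" if k: "k \<in> K" and y: "y \<in> near N (span ?B)" for k y
  proof (rule near_span_closed[OF E_linear N _ _ y])
    show "E k b \<in> near N (span ?B)" if b: "b \<in> ?B" for b
    proof -
      obtain w where "b = Fw w x" "set w \<subseteq> K" using b by auto
      then show ?thesis using E_near_Fw[OF hw k, of w] sub NB by (cases "k \<in># mset w") auto
    qed
  qed (use stableD(2)[OF st _ k] in auto)
  moreover have "F k y \<in> near N (span ?B)" if k: "k \<in> K" and y: "y \<in> near N (span ?B)" for k y
  proof (rule near_span_closed[OF F_linear N _ _ y])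
    show "F k b \<in> near N (span ?B)" if b: "b \<in> ?B" for b
    proof -
      obtain w where "b = Fw w x" "set w \<subseteq> K" using b by auto
      then have "F k b \<in> ?B" using k by (auto intro!: exI[of _ "k # w"])
      then show ?thesis by (rule subsetD[OF BB span_base])
    qed
  qed (use stableD(3)[OF st _ k] in auto)
  moreover have "T h y \<in> near N (span ?B)" if y: "y \<in> near N (span ?B)" for h y
  proof (rule near_span_closed[OF T_linear N _ _ y])
    show "T h b \<in> near N (span ?B)" if b: "b \<in> ?B" for b
    proof -
      obtain w where "b = Fw w x" using b by auto
      then have "T h b = s (\<Lambda> h - wgt (mset w) h) b" using T_Fw[of h x \<Lambda> w] hwD(3)[OF hw] by simp
      moreover have "s (\<Lambda> h - wgt (mset w) h) b \<in> span ?B" by (rule span_scale[OF span_base[OF b]])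
      ultimately show ?thesis using BB by (simp only: subsetD)
    qed
  qed (use stableD(4)[OF st] in auto)
  moreover have "subspace (near N (span ?B))" by (rule subspace_near[OF N]) simp
  ultimately show ?thesis by (auto simp: stable_def)
qed

text \<open>The induction described at the beginning. Either \<open>y = F\<^sub>i\<^sup>n x\<close> is factored out, which increases the
  number of nilpotent directions, or the weight occurs in the submodule of \<open>y\<close>, where its
  content is smaller. In the second case \<open>i\<close> does not occur in the set \<open>J'\<close> found for \<open>y\<close>, so the
  \<open>n\<close> copies of \<open>i\<close> leading from \<open>x\<close> to \<open>y\<close> are free in \<open>P(J)\<close>.\<close>
lemma content_reach_transversal:
  assumes "hw UNIV N \<Lambda> x" and "c \<in> contents UNIV N x"
  shows "\<exists>J\<subseteq>dominant_nodes \<Lambda>. transversal N x \<Lambda> J \<and> c \<in> reach A (-J) J (coval \<Lambda>)"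
  using assms
proof (induction "size c * Suc CARD('i) + card {i\<in>dominant_nodes \<Lambda>. (F i ^^ exponent \<Lambda> i) x \<notin> N}"
    arbitrary: c N \<Lambda> x rule: less_induct)
  case less
  note hw = less.prems(1)
  note st = hwD(1)[OF hw]
  note N = stableD(1)[OF st]
  let ?D = "dominant_nodes \<Lambda>"
  obtain w where w: "mset w = c" and out: "Fw w x \<notin> N"
    using less.prems(2) by (auto simp: contents_def)
  then have xN: "x \<notin> N" using stable_Fw[OF st] by auto
  show ?case
  proof (cases "\<exists>i\<in>?D. (F i ^^ exponent \<Lambda> i) x \<notin> N")
    case False
    then have "c \<in> reach A (UNIV - ?D) ?D (coval \<Lambda>)"
      by (intro contents_subset_reach[OF hw]) (use dominant_nodesD less.prems in \<open>auto simp: torsion_def\<close>)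
    moreover have "transversal N x \<Lambda> ?D" using xN by (auto simp: transversal_def)
    ultimately show ?thesis by (auto simp: Compl_eq_Diff_UNIV)
  next
    case True
    then obtain i where i: "i \<in> ?D" and xi: "(F i ^^ exponent \<Lambda> i) x \<notin> N" by blast
    define y where "y = (F i ^^ exponent \<Lambda> i) x"
    define \<Lambda>' where "\<Lambda>' = (\<lambda>h. \<Lambda> h - of_nat (exponent \<Lambda> i) * r i h)"
    have hwy: "hw UNIV N \<Lambda>' y" unfolding y_def \<Lambda>'_def by (rule hw_singular[OF hw]) (use i in auto)
    let ?B = "{Fw u y | u. set u \<subseteq> UNIV}"
    define N' where "N' = near N (span ?B)"
    have NN': "N \<subseteq> N'" unfolding N'_def by (rule near_N) simp
    show ?thesis
    proof (cases "c \<in> contents UNIV N' x")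
      case True
      have hw': "hw UNIV N' \<Lambda> x"
        using stable_near_words[OF hwy] hw NN' unfolding N'_def[symmetric] by (auto simp: hw_def)
      have "y \<in> ?B" by (auto intro!: exI[of _ "[]"])
      then have "y \<in> N'" unfolding N'_def by (rule subsetD[OF near_superset[OF N] span_base])
      then have "{i\<in>?D. (F i ^^ exponent \<Lambda> i) x \<notin> N'} \<subset> {i\<in>?D. (F i ^^ exponent \<Lambda> i) x \<notin> N}"
        using NN' i xi unfolding y_def by blast
      then have "card {i\<in>?D. (F i ^^ exponent \<Lambda> i) x \<notin> N'} < card {i\<in>?D. (F i ^^ exponent \<Lambda> i) x \<notin> N}"
        by (intro psubset_card_mono) auto
      then obtain J where J: "J \<subseteq> ?D" "transversal N' x \<Lambda> J" "c \<in> reach A (-J) J (coval \<Lambda>)"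
        using less.hyps[OF _ hw' True] by auto
      have "transversal N x \<Lambda> J"
        using J(2) torsions_mono[OF NN'] unfolding transversal_def by blast
      then show ?thesis using J by blast
    next
      case False
      then have "Fw w x \<in> N'" using w by (auto simp: contents_def)
      then obtain z where z: "z \<in> span ?B" "Fw w x - z \<in> N" by (auto simp: N'_def near_def)
      have TB: "T h (Fw u y) = s (\<Lambda>' h - wgt (mset u) h) (Fw u y)" for h u
        using T_Fw[of h y \<Lambda>' u] hwD(3)[OF hwy] by simp
      have Tw: "T h (Fw w x) = s (\<Lambda> h - wgt c h) (Fw w x)" for h
        using T_Fw[of h x \<Lambda> w] hwD(3)[OF hw] w by simp
      have "\<exists>b\<in>?B. b \<notin> N \<and> (\<forall>h. T h b = s (\<Lambda> h - wgt c h) b)"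
      proof (rule weight_component_vector[OF N stableD(4)[OF st] Tw out _ z])
        fix b assume "b \<in> ?B"
        then obtain u where "b = Fw u y" by auto
        then show "\<exists>\<nu>. \<forall>h. T h b = s (\<nu> h) b"
          using TB by (intro exI[of _ "\<lambda>h. \<Lambda>' h - wgt (mset u) h"]) simp
      qed
      then obtain u where u: "Fw u y \<notin> N" "\<And>h. T h (Fw u y) = s (\<Lambda> h - wgt c h) (Fw u y)" by blast
      have "Fw u y \<noteq> 0" using u(1) subspace_0[OF N] by auto
      then have "\<Lambda> h - wgt c h = \<Lambda>' h - wgt (mset u) h" for h
        using weight_unique u(2) TB by blast
      then have "wgt c h = wgt (replicate_mset (exponent \<Lambda> i) i + mset u) h" for h
        by (simp add: \<Lambda>'_def algebra_simps)
      then have c: "c = replicate_mset (exponent \<Lambda> i) i + mset u" by (rule wgt_eqD)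
      let ?c' = "mset u"
      have c': "?c' \<in> contents UNIV N y" using u(1) by (auto simp: contents_def)
      \<comment> \<open>The size dominates in the induction measure, since the cardinality is at most \<open>CARD('i)\<close>.\<close>
      have lt: "size ?c' * Suc CARD('i) + card {i\<in>dominant_nodes \<Lambda>'. (F i ^^ exponent \<Lambda>' i) y \<notin> N}
          < size c * Suc CARD('i) + card {i\<in>?D. (F i ^^ exponent \<Lambda> i) x \<notin> N}"
      proof -
        have 1: "card {i\<in>dominant_nodes \<Lambda>'. (F i ^^ exponent \<Lambda>' i) y \<notin> N} \<le> CARD('i)"
          by (intro card_mono) auto
        have "Suc (size ?c') \<le> size c" using c exponent_pos[of \<Lambda> i] by simp
        then have "Suc (size ?c') * Suc CARD('i) \<le> size c * Suc CARD('i)" by (rule mult_le_mono1)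
        then show ?thesis using 1 by simp
      qed
      obtain J' where J': "J' \<subseteq> dominant_nodes \<Lambda>'" "transversal N y \<Lambda>' J'"
        "?c' \<in> reach A (-J') J' (coval \<Lambda>')"
        using less.hyps[OF lt hwy c'] by blast
      have cor': "\<Lambda>' (cor j) = \<Lambda> (cor j) - of_int (int (exponent \<Lambda> i) * A $ j $ i)" for j
        by (simp add: \<Lambda>'_def r_cor)
      have "\<Lambda>' (cor i) = of_int (- int (exponent \<Lambda> i) - 1)"
        unfolding cor' dominant_nodesD(1)[OF i] of_int_diff[symmetric] of_int_eq_iff
        using dominant_nodesD(3)[OF i] gcm_diag[OF gcm, of i] by simp
      then have iJ': "i \<notin> dominant_nodes \<Lambda>'" "i \<notin> J'"
        using J'(1) of_int_in_Nats_iff[of "- int (exponent \<Lambda> i) - 1"] by (auto simp: dominant_nodes_def)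
      define J where "J = J' \<inter> ?D"
      have val: "coval \<Lambda>' j = coval \<Lambda> j - int (exponent \<Lambda> i) * A $ j $ i" if "j \<in> ?D" for j
        by (rule coval_of_int) (simp add: cor' dominant_nodesD(1)[OF that])
      have "?c' \<in> reach A (-J) J (coval \<Lambda>')"
        by (rule reach_fewer_strings[OF J'(3)]) (simp add: J_def)
      then have "?c' \<in> reach A (-J) J (\<lambda>j. coval \<Lambda> j - coroot_value A (replicate_mset (exponent \<Lambda> i) i) j)"
        by (rule reach_mono) (use val in \<open>auto simp: J_def\<close>)
      then have "replicate_mset (exponent \<Lambda> i) i + ?c' \<in> reach A (-J) J (coval \<Lambda>)"
        by (rule reach_shift) (use iJ' in \<open>auto simp: J_def\<close>)
      moreover have "transversal N x \<Lambda> J"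
        unfolding transversal_def
      proof (intro allI impI notI)
        fix ls assume ls: "distinct ls" "independent_nodes A (set ls)" "set ls \<subseteq> ?D - J"
          and x: "x \<in> torsions ls N"
        have dom: "l \<in> dominant_nodes \<Lambda>'" if l: "l \<in> ?D" "l \<noteq> i" for l
        proof -
          have "\<Lambda>' (cor l) = of_int (coval \<Lambda> l - int (exponent \<Lambda> i) * A $ l $ i)"
            using dominant_nodesD(1)[OF l(1)] by (simp add: cor')
          moreover have "int (exponent \<Lambda> i) * A $ l $ i \<le> 0"
            using gcm_off_diag[OF gcm l(2)] by (simp add: mult_nonneg_nonpos)
          ultimately show ?thesis
            using dominant_nodesD(2)[OF l(1)] unfolding dominant_nodes_def mem_Collect_eq
            by (simp only: of_int_in_Nats_iff)
        qed
        show False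
        proof (cases "i \<in> set ls")
          case False
          have "y \<in> torsions ls N"
            unfolding y_def by (rule stable_Fpow[OF stable_torsions[OF st] _ x]) simp
          moreover have "set ls \<subseteq> dominant_nodes \<Lambda>' - J'" using ls(3) dom False by (auto simp: J_def)
          ultimately show False using J'(2) ls by (auto simp: transversal_def)
        next
          case True
          let ?ls = "remove1 i ls"
          have "x \<in> torsion i (torsions ?ls N)" using x torsions_move_front[OF ls(2) True] by simp
          moreover have "E i x \<in> torsions ?ls N"
            using hwD(2)[OF hw, of i] torsions_superset[of N ?ls] by auto
          moreover have "T (cor i) x - s (of_nat (exponent \<Lambda> i - 1)) x \<in> torsions ?ls N"
            using hwD(3)[OF hw, of "cor i"] dominant_nodesD(4)[OF i]
              subspace_0[OF stableD(1)[OF stable_torsions[OF st]]] by simp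
          ultimately have "(F i ^^ Suc (exponent \<Lambda> i - 1)) x \<in> torsions ?ls N"
            using torsion_iff[OF stable_torsions[OF st]] by blast
          then have "y \<in> torsions ?ls N" using exponent_pos[of \<Lambda> i] by (simp add: y_def)
          moreover have "set ?ls \<subseteq> dominant_nodes \<Lambda>' - J'" using ls(1,3) dom by (auto simp: J_def)
          moreover have "independent_nodes A (set ?ls)"
            using ls(2) set_remove1_subset[of i ls] by (auto simp: independent_nodes_def)
          ultimately show False using J'(2) ls(1) by (auto simp: transversal_def)
        qed
      qed
      ultimately show ?thesis using c by (intro exI[of _ J]) (auto simp: J_def)
    qed
  qed
qed

end

section \<open>Free directions\<close>

text \<open>With \<open>e i = \<Lambda> (cor i) + 1\<close>, the weight of this content is obtained from \<open>\<Lambda>\<close> by the product of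
  the dotted reflections of the independent set \<open>I\<close>.\<close>
definition corner :: "('i::finite \<Rightarrow> nat) \<Rightarrow> 'i set \<Rightarrow> 'i multiset" where
  "corner e I = (\<Sum>i\<in>I. replicate_mset (e i) i)"

lemma count_corner: "count (corner e I) k = (if k \<in> I then e k else 0)"
  by (simp add: corner_def count_sum sum.delta)

lemma set_corner: "set_mset (corner e I) \<subseteq> I"
proof
  fix k assume "k \<in># corner e I"
  then have "0 < count (corner e I) k" by simp
  then show "k \<in> I" by (simp add: count_corner split: if_splits)
qed

lemma corner_insert: "j \<notin> I \<Longrightarrow> corner e (insert j I) = replicate_mset (e j) j + corner e I"
  by (simp add: corner_def)

lemma coroot_value_zero: "(\<And>l. l \<in># d \<Longrightarrow> A $ k $ l = 0) \<Longrightarrow> coroot_value A d k = 0"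
  by (induction d) auto

text \<open>The nodes of \<open>D\<close> (natural values) have excess \<open>n - e\<close>, the others \<open>n\<close>. They are visited in
  decreasing order, with nodes of \<open>D\<close> first among equals. A node of \<open>D\<close> with nonnegative excess enters
  \<open>I\<close> unless it has a neighbour in \<open>I\<close> or an unblocked neighbour that was visited before. Then every
  excluded node of \<open>D\<close> is dominated by such a neighbour, and a node outside \<open>D\<close> can be blocked only
  by earlier neighbours in \<open>I\<close>.\<close>
lemma greedy_independent:
  fixes A :: "int^'i::finite^'i" and K D :: "'i set" and n e :: "'i \<Rightarrow> nat" and lam :: "'i \<Rightarrow> complex"
  assumes gcm: "generalized_cartan_matrix A"
    and lam: "\<And>k. k \<in> K - D \<Longrightarrow> lam k \<notin> \<nat>"
  defines "unblocked \<equiv> \<lambda>I k. lam k - of_int (coroot_value A (corner e I) k) \<notin> \<nat>"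
  shows "\<exists>I. I \<subseteq> K \<inter> D \<and> independent_nodes A I \<and> (\<forall>i\<in>I. e i \<le> n i)
    \<and> (\<forall>j\<in>K \<inter> D - I. e j \<le> n j \<longrightarrow>
         (\<exists>i\<in>I. A $ j $ i \<noteq> 0 \<and> n j + e i \<le> n i + e j)
       \<or> (\<exists>k\<in>K - D. unblocked I k \<and> A $ j $ k \<noteq> 0 \<and> n j < n k + e j))
    \<and> (\<forall>k\<in>K - D. \<not> unblocked I k \<longrightarrow> (\<exists>i\<in>I. A $ k $ i \<noteq> 0 \<and> n k + e i \<le> n i))"
proof -
  \<comment> \<open>Doubling makes room for the tie-break in favour of \<open>D\<close>.\<close>
  define q where "q j = (if j \<in> D then 2 * (int (n j) - int (e j)) + 1 else 2 * int (n j))" for j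
  define good where "good R I \<longleftrightarrow> I \<subseteq> R \<inter> D \<and> independent_nodes A I \<and> (\<forall>i\<in>I. e i \<le> n i)
    \<and> (\<forall>j\<in>R \<inter> D - I. e j \<le> n j \<longrightarrow>
         (\<exists>i\<in>I. A $ j $ i \<noteq> 0 \<and> n j + e i \<le> n i + e j)
       \<or> (\<exists>k\<in>R - D. unblocked I k \<and> A $ j $ k \<noteq> 0 \<and> n j < n k + e j))
    \<and> (\<forall>k\<in>R - D. \<not> unblocked I k \<longrightarrow> (\<exists>i\<in>I. A $ k $ i \<noteq> 0 \<and> n k + e i \<le> n i))" for R I
  have step: "\<exists>I. good (insert j R) I"
    if jR: "j \<notin> R" and top: "\<And>y. y \<in> R \<Longrightarrow> - q y \<le> - q j" and sub: "insert j R \<subseteq> K" and I: "good R I" for j R I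
  proof (cases "j \<in> D")
    case False
    have IR: "I \<subseteq> R \<inter> D" using I by (simp add: good_def)
    have new: "\<exists>i\<in>I. A $ j $ i \<noteq> 0 \<and> n j + e i \<le> n i" if blocked: "\<not> unblocked I j"
    proof -
      have "\<exists>i\<in>#corner e I. A $ j $ i \<noteq> 0"
      proof (rule ccontr)
        assume "\<not> ?thesis"
        then have "coroot_value A (corner e I) j = 0" by (intro coroot_value_zero) auto
        then show False using blocked lam[of j] sub False by (simp add: unblocked_def)
      qed
      then obtain i where i: "i \<in> I" "A $ j $ i \<noteq> 0" using set_corner by blast
      then have "q j \<le> q i" "i \<in> D" using IR top[of i] by auto
      then show ?thesis using i False by (intro bexI[of _ i]) (auto simp: q_def)
    qed
    have "good (insert j R) I" using I new False unfolding good_def by blast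
    then show ?thesis by blast
  next
    case jD: True
    have IR: "I \<subseteq> R \<inter> D" and indep: "independent_nodes A I" using I by (simp_all add: good_def)
    consider (low) "n j < e j"
      | (nbr) i where "i \<in> I" "A $ j $ i \<noteq> 0" "e j \<le> n j"
      | (nbr2) k where "k \<in> R - D" "unblocked I k" "A $ j $ k \<noteq> 0" "e j \<le> n j"
      | (add) "e j \<le> n j" "\<And>i. i \<in> I \<Longrightarrow> A $ j $ i = 0" "\<And>k. k \<in> R - D \<Longrightarrow> unblocked I k \<Longrightarrow> A $ j $ k = 0"
      by (meson not_less)
    then show ?thesis
    proof cases
      case low
      have "good (insert j R) I" using I low jD unfolding good_def by auto
      then show ?thesis by blast
    next
      case nbr
      then have "q j \<le> q i" "i \<in> D" using IR top[of i] by auto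
      then have "n j + e i \<le> n i + e j" using jD by (auto simp: q_def)
      then have "good (insert j R) I" using I nbr jD unfolding good_def by blast
      then show ?thesis by blast
    next
      case nbr2
      then have "q j \<le> q k" "k \<notin> D" using top[of k] by auto
      then have "n j < n k + e j" using jD by (auto simp: q_def)
      then have "good (insert j R) I" using I nbr2 jD unfolding good_def by blast
      then show ?thesis by blast
    next
      case add
      let ?I = "insert j I"
      have jI: "j \<notin> I" using IR jR by auto
      have keep: "unblocked ?I k" if "k \<in> R - D" "unblocked I k" for k
        using add(3)[OF that] that gcm_zero[OF gcm, of j k] corner_insert[OF jI, of e]
        by (simp add: unblocked_def)
      have "independent_nodes A ?I"
        using indep add(2) gcm_zero[OF gcm] by (auto simp: independent_nodes_def dynkin_edge_def)
      moreover have "\<forall>i\<in>?I. e i \<le> n i" using I add(1) by (auto simp: good_def)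
      moreover have "?I \<subseteq> insert j R \<inter> D" using IR jD by auto
      moreover have "\<forall>l\<in>insert j R \<inter> D - ?I. e l \<le> n l \<longrightarrow>
         (\<exists>i\<in>?I. A $ l $ i \<noteq> 0 \<and> n l + e i \<le> n i + e l)
       \<or> (\<exists>k\<in>insert j R - D. unblocked ?I k \<and> A $ l $ k \<noteq> 0 \<and> n l < n k + e l)"
        using I keep unfolding good_def by blast
      moreover have "\<forall>k\<in>insert j R - D. \<not> unblocked ?I k \<longrightarrow> (\<exists>i\<in>?I. A $ k $ i \<noteq> 0 \<and> n k + e i \<le> n i)"
        using I keep jD unfolding good_def by blast
      ultimately have "good (insert j R) ?I" unfolding good_def by (intro conjI)
      then show ?thesis by blast
    qed
  qed
  have "R \<subseteq> K \<longrightarrow> (\<exists>I. good R I)" if "finite R" for R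
    using that
  proof (induction R rule: finite_ranking_induct[where f = "\<lambda>j. - q j"])
    case empty
    have "good {} {}" by (simp add: good_def independent_nodes_def)
    then show ?case by blast
  next
    case (insert j R)
    show ?case
    proof (cases "j \<in> R")
      case True
      then show ?thesis using insert by (simp add: insert_absorb)
    next
      case False
      then show ?thesis using insert step[OF False, of] by blast
    qed
  qed
  then have "\<exists>I. good K I" by simp
  then show ?thesis by (simp add: good_def)
qed

context chevalley_operators
begin

text \<open>The submodule of each word still contains \<open>z\<close>, so words in these nodes never vanish if \<open>z\<close> does
  not.\<close>
lemma free_words:
  assumes z: "z \<in> submodule_of x" "\<And>k. E k z = 0" "\<And>k. T (cor k) z = s (\<zeta> k) z" and w: "set w \<subseteq> {k. \<zeta> k \<notin> \<nat>}"
  shows "z \<in> submodule_of (Fw w x)"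
  using w
proof (induction w)
  case (Cons k w)
  have "\<zeta> k \<noteq> of_nat u" for u using Cons.prems by (auto simp: Nats_def)
  then show ?case using F_submodule_of[OF _ z(2,3), of "Fw w x" k] Cons by simp
qed (use z in simp)

lemma pull_front:
  assumes "\<And>l. l \<in> set w \<Longrightarrow> A $ k $ l = 0 \<or> k = l"
  shows "Fw w x = (F k ^^ count (mset w) k) (Fw (filter (\<lambda>l. l \<noteq> k) w) x)"
  using assms
proof (induction w)
  case (Cons l w)
  show ?case
  proof (cases "l = k")
    case False
    then have "A $ k $ l = 0 \<or> k = l" using Cons.prems by auto
    then have "F l ((F k ^^ p) y) = (F k ^^ p) (F l y)" for p y
      using Fpow_commute[of k l p 1] by simp
    then show ?thesis using Cons False by simp
  qed (use Cons in simp)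
qed simp

text \<open>The operators of independent nodes commute, so the full power of any node of \<open>I\<close> can be applied
  last.\<close>
lemma E_corner_word:
  assumes hw: "hw UNIV {0} \<Lambda> v" and I: "I \<subseteq> dominant_nodes \<Lambda>" "independent_nodes A I"
    and w: "mset w = corner (exponent \<Lambda>) I"
  shows "E k (Fw w v) = 0"
proof (cases "k \<in> I")
  case False
  then have "k \<notin># mset w" using w set_corner by auto
  then show ?thesis using E_near_Fw[OF hw, of k w] by simp
next
  case True
  have sw: "set w \<subseteq> I" using w set_corner by (metis set_mset_mset)
  let ?w = "filter (\<lambda>l. l \<noteq> k) w"
  let ?y = "Fw ?w v"
  have Ak: "A $ k $ l = 0" if "l \<in> set ?w" for l
    using that sw True independent_entry[OF I(2), of k l] by auto
  have "E k ?y = 0" using E_near_Fw[OF hw, of k ?w] by simp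
  moreover have "T (cor k) ?y = s (of_nat (exponent \<Lambda> k - 1)) ?y"
  proof -
    have "coroot_value A (mset ?w) k = 0" using Ak by (intro coroot_value_zero) auto
    then show ?thesis
      using T_Fw[of "cor k" v \<Lambda> ?w] hwD(3)[OF hw, of "cor k"] dominant_nodesD(4)[of k \<Lambda>] True I(1)
      by (auto simp: wgt_cor)
  qed
  ultimately have "E k ((F k ^^ Suc (exponent \<Lambda> k - 1)) ?y) \<in> {0}"
    by (intro F_ladder_top[OF stable_zero[of UNIV]]) auto
  moreover have "Fw w v = (F k ^^ exponent \<Lambda> k) ?y"
  proof -
    have "A $ k $ l = 0 \<or> k = l" if "l \<in> set w" for l
      using that sw True independent_entry[OF I(2), of k l] by blast
    then show ?thesis using pull_front[of w k v] True w by (simp add: count_corner)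
  qed
  ultimately show ?thesis using exponent_pos[of \<Lambda> k] by simp
qed

lemma word_in_submodule: "Fw w x \<in> submodule_of x"
  by (rule stable_Fw[OF stable_submodule_of _ submodule_of_self]) simp

text \<open>Take \<open>I\<close> from the greedy choice and let \<open>z\<close> be the singular vector at its corner. The nodes of
  \<open>I\<close> and the unblocked ones have non-natural values at \<open>z\<close> and are added freely. Each remaining node is
  added by a single string, which its dominating neighbour has made long enough.\<close>
lemma free_contents:
  assumes hw: "hw UNIV {0} \<Lambda> v"
    and H: "\<And>I. I \<subseteq> K \<inter> dominant_nodes \<Lambda> \<Longrightarrow> independent_nodes A I
        \<Longrightarrow> corner (exponent \<Lambda>) I \<in> contents UNIV {0} v"
    and n: "set_mset n \<subseteq> K"
  shows "n \<in> contents UNIV {0} v"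
proof -
  let ?D = "dominant_nodes \<Lambda>" and ?e = "exponent \<Lambda>"
  define unblocked where "unblocked I k \<longleftrightarrow> \<Lambda> (cor k) - of_int (coroot_value A (corner ?e I) k) \<notin> \<nat>" for I k
  have "\<exists>I. I \<subseteq> K \<inter> ?D \<and> independent_nodes A I \<and> (\<forall>i\<in>I. ?e i \<le> count n i)
    \<and> (\<forall>j\<in>K \<inter> ?D - I. ?e j \<le> count n j \<longrightarrow>
         (\<exists>i\<in>I. A $ j $ i \<noteq> 0 \<and> count n j + ?e i \<le> count n i + ?e j)
       \<or> (\<exists>k\<in>K - ?D. unblocked I k \<and> A $ j $ k \<noteq> 0 \<and> count n j < count n k + ?e j))
    \<and> (\<forall>k\<in>K - ?D. \<not> unblocked I k \<longrightarrow> (\<exists>i\<in>I. A $ k $ i \<noteq> 0 \<and> count n k + ?e i \<le> count n i))"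
    unfolding unblocked_def by (rule greedy_independent[OF gcm]) (simp add: dominant_nodes_def)
  then obtain I where I: "I \<subseteq> K \<inter> ?D" "independent_nodes A I"
    and e: "\<And>i. i \<in> I \<Longrightarrow> ?e i \<le> count n i"
    and dom: "\<And>j. j \<in> K \<inter> ?D - I \<Longrightarrow> ?e j \<le> count n j \<Longrightarrow>
         (\<exists>i\<in>I. A $ j $ i \<noteq> 0 \<and> count n j + ?e i \<le> count n i + ?e j)
       \<or> (\<exists>k\<in>K - ?D. unblocked I k \<and> A $ j $ k \<noteq> 0 \<and> count n j < count n k + ?e j)"
    and nondom: "\<And>k. k \<in> K - ?D \<Longrightarrow> \<not> unblocked I k \<Longrightarrow> \<exists>i\<in>I. A $ k $ i \<noteq> 0 \<and> count n k + ?e i \<le> count n i"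
    by blast
  let ?cI = "corner ?e I"
  obtain w where w: "mset w = ?cI" and wv: "Fw w v \<noteq> 0"
    using H[OF I] by (auto simp: contents_def)
  define z where "z = Fw w v"
  define \<zeta> where "\<zeta> k = \<Lambda> (cor k) - of_int (coroot_value A ?cI k)" for k
  have z: "z \<in> submodule_of v" "\<And>k. E k z = 0" "\<And>k. T (cor k) z = s (\<zeta> k) z"
    using word_in_submodule E_corner_word[OF hw _ I(2) w] I(1) T_Fw[of _ v \<Lambda> w] hwD(3)[OF hw] w
    by (auto simp: z_def \<zeta>_def wgt_cor)
  define \<Phi> where "\<Phi> = I \<union> {k\<in>K - ?D. unblocked I k}"
  have free: "\<zeta> k \<notin> \<nat>" if "k \<in> \<Phi>" for k
  proof (cases "k \<in> I")
    case True
    have "coroot_value A ?cI k = 2 * int (?e k)"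
    proof -
      have c: "?cI = replicate_mset (?e k) k + corner ?e (I - {k})"
        using corner_insert[of k "I - {k}" ?e] True by (simp add: insert_absorb)
      have "coroot_value A (corner ?e (I - {k})) k = 0"
        using set_corner[of ?e "I - {k}"] independent_entry[OF I(2) True] by (intro coroot_value_zero) auto
      then show ?thesis unfolding c using gcm_diag[OF gcm, of k] by simp
    qed
    then have "\<zeta> k = of_int (coval \<Lambda> k - 2 * int (?e k))"
      using dominant_nodesD(1)[of k \<Lambda>] True I(1) by (auto simp: \<zeta>_def)
    moreover have "coval \<Lambda> k - 2 * int (?e k) < 0"
      using dominant_nodesD(2,3)[of k \<Lambda>] True I(1) by auto
    ultimately show ?thesis by (simp only: of_int_in_Nats_iff)
  next
    case False
    then show ?thesis using that by (auto simp: \<Phi>_def unblocked_def \<zeta>_def)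
  qed
  have start: "filter_mset (\<lambda>k. k \<in> \<Phi>) n \<in> contents UNIV {0} v"
  proof -
    obtain u where u: "mset u = filter_mset (\<lambda>k. k \<in> \<Phi>) n" using ex_mset by blast
    have "set u \<subseteq> \<Phi>" using u by (metis set_mset_mset set_mset_filter mem_Collect_eq subsetI)
    then have "set u \<subseteq> {k. \<zeta> k \<notin> \<nat>}" using free by blast
    then have "z \<in> submodule_of (Fw u v)" using free_words[OF z] by blast
    moreover have "submodule_of 0 \<subseteq> {0}" by (rule submodule_of_minimal[OF stable_zero]) simp
    ultimately have "Fw u v \<noteq> 0" using wv by (auto simp: z_def)
    then show ?thesis using u by (auto simp: contents_def intro!: exI[of _ u])
  qed
  \<comment> \<open>The remaining nodes, one at a time: every later one only lengthens the strings still to come.\<close>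
  have main: "filter_mset (\<lambda>k. k \<in> \<Phi> \<union> R) n \<in> contents UNIV {0} v" if "finite R" "R \<subseteq> K - \<Phi>" for R
    using that
  proof (induction R rule: finite_induct)
    case empty
    then show ?case using start by simp
  next
    case (insert j R)
    let ?c = "filter_mset (\<lambda>k. k \<in> \<Phi> \<union> R) n"
    have jc: "j \<notin># ?c" using insert by auto
    have c\<Phi>: "count ?c k = count n k" if "k \<in> \<Phi>" for k using that by simp
    have "\<exists>\<mu>. \<Lambda> (cor j) = of_int \<mu> \<and> int (count n j) \<le> \<mu> - coroot_value A ?c j"
    proof (cases "j \<in> ?D")
      case True
      have \<mu>: "\<Lambda> (cor j) = of_int (coval \<Lambda> j)" "coval \<Lambda> j = int (?e j) - 1"
        using dominant_nodesD(1,3)[OF True] by simp_all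
      have "int (count n j) \<le> coval \<Lambda> j - coroot_value A ?c j"
      proof (cases "?e j \<le> count n j")
        case False
        then show ?thesis using coroot_value_outside(1)[OF gcm jc] \<mu> by simp
      next
        case F: True
        have "\<exists>l\<in>\<Phi>. A $ j $ l \<noteq> 0 \<and> count n j < count n l + ?e j"
        proof -
          have "j \<in> K \<inter> ?D - I" using True insert.prems by (auto simp: \<Phi>_def)
          from dom[OF this F] show ?thesis
          proof
            assume "\<exists>i\<in>I. A $ j $ i \<noteq> 0 \<and> count n j + ?e i \<le> count n i + ?e j"
            then obtain i where "i \<in> I" "A $ j $ i \<noteq> 0" "count n j + ?e i \<le> count n i + ?e j" by blast
            then show ?thesis using exponent_pos[of \<Lambda> i] by (intro bexI[of _ i]) (auto simp: \<Phi>_def)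
          qed (auto simp: \<Phi>_def)
        qed
        then obtain l where l: "l \<in> \<Phi>" "A $ j $ l \<noteq> 0" "count n j < count n l + ?e j" by blast
        then show ?thesis using coroot_value_outside(2)[OF gcm jc l(2)] c\<Phi>[OF l(1)] \<mu>(2) by simp
      qed
      then show ?thesis using \<mu>(1) by blast
    next
      case False
      then have jK: "j \<in> K - ?D" and blocked: "\<not> unblocked I j" using insert.prems by (auto simp: \<Phi>_def)
      obtain i where i: "i \<in> I" "A $ j $ i \<noteq> 0" "count n j + ?e i \<le> count n i"
        using nondom[OF jK blocked] by blast
      obtain N where N: "\<Lambda> (cor j) - of_int (coroot_value A ?cI j) = of_nat N"
        using blocked by (auto simp: unblocked_def Nats_def)
      have "\<Lambda> (cor j) = of_int (int N + coroot_value A ?cI j)" using N by (simp add: algebra_simps)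
      moreover have "int (count n j) \<le> int N + coroot_value A ?cI j - coroot_value A ?c j"
      proof -
        have sub: "?cI \<subseteq># ?c"
          unfolding subseteq_mset_def using e c\<Phi> by (auto simp: count_corner \<Phi>_def)
        have "j \<notin># ?c - ?cI" using jc by (auto dest: in_diffD)
        from coroot_value_outside(2)[OF gcm this i(2)]
        have "int (count ?c i - ?e i) \<le> - (coroot_value A ?c j - coroot_value A ?cI j)"
          using i(1) by (simp only: coroot_value_diff[OF sub] count_diff count_corner if_True)
        moreover have "count ?c i = count n i" using c\<Phi>[of i] i(1) by (simp add: \<Phi>_def)
        ultimately show ?thesis using i(3) by linarith
      qed
      ultimately show ?thesis by blast
    qed
    then obtain \<mu> where "\<Lambda> (cor j) = of_int \<mu>" "int (count n j) \<le> \<mu> - coroot_value A ?c j" by blast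
    then have "?c + replicate_mset (count n j) j \<in> contents UNIV {0} v"
      using insert by (intro string_down[OF hw]) auto
    moreover have "?c + replicate_mset (count n j) j = filter_mset (\<lambda>k. k \<in> \<Phi> \<union> insert j R) n"
      using insert by (auto simp: multiset_eq_iff)
    ultimately show ?case by simp
  qed
  have "filter_mset (\<lambda>k. k \<in> \<Phi> \<union> (K - \<Phi>)) n \<in> contents UNIV {0} v" by (rule main) auto
  moreover have "filter_mset (\<lambda>k. k \<in> \<Phi> \<union> (K - \<Phi>)) n = n"
  proof (rule multiset_eqI)
    fix k show "count (filter_mset (\<lambda>k. k \<in> \<Phi> \<union> (K - \<Phi>)) n) k = count n k"
      using n by (cases "k \<in># n") (auto simp: not_in_iff)
  qed
  ultimately show ?thesis by simp
qed

end

section \<open>Reflections, regions closed under roots, and brackets\<close>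

text \<open>The contents of the roots with exactly one node outside \<open>J\<close>, counted with multiplicity: up
  to sign these are the weights of the integrable module for \<open>J\<close> generated by \<open>F\<^sub>i\<close> in the adjoint
  representation. The other positive roots not supported in \<open>J\<close> are sums of these.\<close>
definition outer_roots :: "int^'i::finite^'i \<Rightarrow> 'i set \<Rightarrow> 'i multiset set" where
  "outer_roots A J = {add_mset i y | i y. i \<notin> J \<and> y \<in> reach A {} J (\<lambda>j. - (A $ j $ i))}"

context chevalley_operators
begin

lemma hw_T_Fw: "hw K N \<Lambda> x \<Longrightarrow> T h (Fw w x) = s (\<Lambda> h - wgt (mset w) h) (Fw w x)"
  by (rule T_Fw) (rule hwD(3))

lemma near_zero: "near {0} S = S"
  by (auto simp: near_def)

lemma stable_span_words:
  assumes "hw K {0} \<Lambda> x"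
  shows "stable K (span {Fw w x | w. set w \<subseteq> K})"
  using stable_near_words[OF assms] by (simp add: near_zero)

lemma stable_span_Union:
  assumes "\<And>M. M \<in> \<M> \<Longrightarrow> stable K M"
  shows "stable K (span (\<Union>\<M>))"
proof -
  have "G y \<in> span (\<Union>\<M>)" if "Vector_Spaces.linear s s G" "\<And>M z. M \<in> \<M> \<Longrightarrow> z \<in> M \<Longrightarrow> G z \<in> M"
    and y: "y \<in> span (\<Union>\<M>)" for G y
    using near_span_closed[of G "{0}" "\<Union>\<M>" y] that module_hom.zero[OF Vector_Spaces.linear.axioms(3)[OF that(1)]]
    by (auto simp: near_zero intro: span_base)
  then show ?thesis
    using E_linear F_linear T_linear assms unfolding stable_def by auto
qed

text \<open>Split \<open>c = n + x\<close> as in \<open>reach_split\<close>. The word \<open>y\<close> of the free part \<open>n\<close> is nonzero by assumption and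
  a highest weight vector for the nodes of \<open>J\<close>. Modulo the submodule of the singular vectors \<open>F\<^sub>k\<^sup>e y\<close>, it generates an
  integrable module for \<open>J\<close>, whose contents are the \<open>x\<close> under consideration, and there the reflection
  is available.\<close>
lemma integrable_reflection_closed:
  assumes hw: "hw UNIV {0} \<Lambda> v" and J: "J \<subseteq> dominant_nodes \<Lambda>"
    and free: "\<And>n. set_mset n \<subseteq> -J \<Longrightarrow> n \<in> contents UNIV {0} v"
  shows "reflection_closed A J (coval \<Lambda>) (reach A (-J) J (coval \<Lambda>))"
  unfolding reflection_closed_def
proof (intro ballI)
  fix c j assume c: "c \<in> reach A (-J) J (coval \<Lambda>)" and j: "j \<in> J"
  obtain n x where cnx: "c = n + x" and n: "set_mset n \<subseteq> -J"
    and x: "x \<in> reach A {} J (\<lambda>j. coval \<Lambda> j - coroot_value A n j)"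
    using reach_split[OF gcm c] by blast
  let ?m = "\<lambda>j. coval \<Lambda> j - coroot_value A n j"
  obtain wn where wn: "mset wn = n" and w0: "Fw wn v \<noteq> 0" using free[OF n] by (auto simp: contents_def)
  define y where "y = Fw wn v"
  define \<Lambda>n where "\<Lambda>n h = \<Lambda> h - wgt n h" for h
  have val: "\<Lambda>n (cor k) = of_int (?m k)" if "k \<in> J" for k
    using dominant_nodesD(1)[of k \<Lambda>] that J by (auto simp: \<Lambda>n_def wgt_cor)
  have dom: "k \<in> dominant_nodes \<Lambda>n" if "k \<in> J" for k
  proof -
    have "k \<notin># n" using n that by auto
    then have "0 \<le> ?m k"
      using coroot_value_outside(1)[OF gcm, of k n] dominant_nodesD(2)[of k \<Lambda>] that J by auto
    then show ?thesis unfolding dominant_nodes_def mem_Collect_eq val[OF that] by (simp only: of_int_in_Nats_iff)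
  qed
  have hwy: "hw J {0} \<Lambda>n y"
  proof -
    have "E k y = 0" if "k \<in> J" for k
    proof -
      have "k \<notin># mset wn" using n wn that by auto
      then show ?thesis using E_near_Fw[OF hw, of k wn] by (simp add: y_def)
    qed
    moreover have "T h y = s (\<Lambda>n h) y" for h
      using T_Fw[of h v \<Lambda> wn] hwD(3)[OF hw] wn by (simp add: y_def \<Lambda>n_def)
    ultimately show ?thesis using stable_zero by (simp add: hw_def)
  qed
  let ?B = "\<lambda>k. {Fw u ((F k ^^ exponent \<Lambda>n k) y) | u. set u \<subseteq> J}"
  define N where "N = span (\<Union>k\<in>J. span (?B k))"
  have st: "stable J N" unfolding N_def
  proof (rule stable_span_Union)
    fix M assume "M \<in> (\<lambda>k. span (?B k)) ` J"
    then obtain k where k: "k \<in> J" "M = span (?B k)" by blast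
    show "stable J M" unfolding k(2) by (rule stable_span_words[OF hw_singular[OF hwy k(1) dom[OF k(1)]]])
  qed
  have N: "N \<subseteq> span (\<Union>k\<in>J. ?B k)" unfolding N_def
    by (intro span_minimal UN_least span_mono) auto
  \<comment> \<open>All generators of \<open>N\<close> have weights strictly below that of \<open>y\<close>.\<close>
  have yN: "y \<notin> N"
  proof
    assume "y \<in> N"
    then have z: "y \<in> span (\<Union>k\<in>J. ?B k)" using N by blast
    have "\<exists>b\<in>\<Union>k\<in>J. ?B k. b \<notin> {0} \<and> (\<forall>h. T h b = s (\<Lambda>n h) b)"
    proof (rule weight_component_vector[OF _ _ hwD(3)[OF hwy] _ _ z])
      fix b assume "b \<in> (\<Union>k\<in>J. ?B k)"
      then obtain k u where k: "k \<in> J" and b: "b = Fw u ((F k ^^ exponent \<Lambda>n k) y)" by blast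
      show "\<exists>\<nu>. \<forall>h. T h b = s (\<nu> h) b"
        unfolding b by (rule exI, rule allI, rule hw_T_Fw[OF hw_singular[OF hwy k dom[OF k]]])
    qed (use w0 in \<open>auto simp: y_def\<close>)
    then obtain k u where k: "k \<in> J" and b: "Fw u ((F k ^^ exponent \<Lambda>n k) y) \<noteq> 0"
      "\<And>h. T h (Fw u ((F k ^^ exponent \<Lambda>n k) y)) = s (\<Lambda>n h) (Fw u ((F k ^^ exponent \<Lambda>n k) y))" by blast
    have "\<Lambda>n h = \<Lambda>n h - of_nat (exponent \<Lambda>n k) * r k h - wgt (mset u) h" for h
      by (rule weight_unique[OF b(1) b(2) hw_T_Fw[OF hw_singular[OF hwy k dom[OF k]]]])
    then have "wgt (replicate_mset (exponent \<Lambda>n k) k + mset u) h = wgt {#} h" for h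
      by (simp add: algebra_simps)
    then have "replicate_mset (exponent \<Lambda>n k) k + mset u = {#}" by (rule wgt_eqD)
    then show False using exponent_pos[of \<Lambda>n k] by simp
  qed
  have hwN: "hw J N \<Lambda>n y"
    using hwy st subspace_0[OF stableD(1)[OF st]] by (auto simp: hw_def)
  have tor: "y \<in> torsion k N" if "k \<in> J" for k
  proof -
    have "(F k ^^ exponent \<Lambda>n k) y \<in> ?B k" by (auto intro!: exI[of _ "[]"])
    then have "(F k ^^ exponent \<Lambda>n k) y \<in> (\<Union>k\<in>J. span (?B k))"
      by (intro UN_I[OF that] span_base)
    then have "(F k ^^ exponent \<Lambda>n k) y \<in> N" unfolding N_def by (rule span_base)
    then show ?thesis by (auto simp: torsion_def)
  qed
  have "x \<in> contents J N y" by (rule reach_subset_contents[OF hwN yN subset_refl val x])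
  from reflect_content[OF hwN this j val[OF j] tor[OF j]]
  obtain k where k: "k \<le> count x j" "coroot_value A x j - ?m j \<le> int k"
    and x': "x - replicate_mset k j \<in> contents J N y" by blast
  have "x - replicate_mset k j \<in> reach A (J - J) J ?m"
    by (rule contents_subset_reach[OF hwN subset_refl tor val x'])
  then have "n + (x - replicate_mset k j) \<in> reach A (-J) J (coval \<Lambda>)"
    by (intro reach_shift[of _ _ "J - J"]) (use n in auto)
  moreover have "n + (x - replicate_mset k j) = c - replicate_mset k j"
    using k(1) by (auto simp: cnx multiset_eq_iff)
  ultimately show "\<exists>k\<le>count c j. coroot_value A c j - coval \<Lambda> j \<le> int k
      \<and> c - replicate_mset k j \<in> reach A (-J) J (coval \<Lambda>)"
    using k by (intro exI[of _ k]) (auto simp: cnx)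
qed

text \<open>The region is \<open>P(J)\<close> for the intersection \<open>J\<close> of \<open>JV\<close> with the transversal set found for \<open>c\<close>; the
  hypothesis on \<open>JV\<close> makes \<open>J\<close> transversal.\<close>
lemma contents_closed_region:
  assumes hw: "hw UNIV {0} \<Lambda> v"
    and JV: "\<And>I. I \<subseteq> dominant_nodes \<Lambda> \<Longrightarrow> independent_nodes A I \<Longrightarrow> corner (exponent \<Lambda>) I \<notin> contents UNIV {0} v
        \<Longrightarrow> \<exists>I'\<subseteq>I \<inter> JV. corner (exponent \<Lambda>) I' \<notin> contents UNIV {0} v"
    and c: "c \<in> contents UNIV {0} v"
  shows "\<exists>J R. J \<subseteq> JV \<and> c \<in> R \<and> R \<subseteq> contents UNIV {0} v \<and> (\<forall>c\<in>R. \<forall>b\<in>outer_roots A J. c + b \<in> R)"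
proof -
  let ?C = "contents UNIV {0} v" and ?D = "dominant_nodes \<Lambda>" and ?e = "exponent \<Lambda>"
  obtain J' where J': "J' \<subseteq> ?D" "transversal {0} v \<Lambda> J'" "c \<in> reach A (-J') J' (coval \<Lambda>)"
    using content_reach_transversal[OF hw c] by blast
  have corners': "corner ?e I \<in> ?C" if "I \<subseteq> ?D - J'" "independent_nodes A I" for I
  proof -
    obtain ls where ls: "set ls = I" "distinct ls" using finite_distinct_list[of I] by auto
    then have "v \<notin> torsions ls {0}" using J'(2) that by (auto simp: transversal_def)
    from word_outside_of_torsions[OF this ls(2), of ?e] show ?thesis
      using ls(1) unfolding contents_def corner_def by force
  qed
  define J where "J = J' \<inter> JV"
  have corners: "corner ?e I \<in> ?C" if I: "I \<subseteq> -J \<inter> ?D" "independent_nodes A I" for I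
  proof (rule ccontr)
    assume "corner ?e I \<notin> ?C"
    then obtain I' where I': "I' \<subseteq> I \<inter> JV" "corner ?e I' \<notin> ?C" using JV[of I] I by blast
    have "I' \<subseteq> ?D - J'" using I I'(1) by (auto simp: J_def)
    moreover have "independent_nodes A I'" using I(2) I'(1) by (auto simp: independent_nodes_def)
    ultimately show False using corners' I'(2) by blast
  qed
  have free: "n \<in> ?C" if "set_mset n \<subseteq> -J" for n
    by (rule free_contents[OF hw corners that])
  let ?R = "reach A (-J) J (coval \<Lambda>)"
  have JD: "J \<subseteq> ?D" using J'(1) by (auto simp: J_def)
  have "?R \<subseteq> ?C"
  proof
    fix d assume "d \<in> ?R"
    then obtain n x where d: "d = n + x" and n: "set_mset n \<subseteq> -J"
      and x: "x \<in> reach A {} J (\<lambda>j. coval \<Lambda> j - coroot_value A n j)"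
      using reach_split[OF gcm] by blast
    from x have "n + x \<in> ?C"
    proof induction
      case (string x j t)
      then have "n + x + replicate_mset t j \<in> ?C"
        using dominant_nodesD(1) JD by (intro string_down[OF hw]) auto
      then show ?case by (simp add: add.assoc)
    qed (use free[OF n] in auto)
    then show "d \<in> ?C" using d by simp
  qed
  moreover have "c \<in> ?R" by (rule reach_fewer_strings[OF J'(3)]) (simp add: J_def)
  moreover have "\<forall>c\<in>?R. \<forall>b\<in>outer_roots A J. c + b \<in> ?R"
    using reach_add_root[OF gcm integrable_reflection_closed[OF hw JD free]] by (auto simp: outer_roots_def)
  moreover have "J \<subseteq> JV" by (simp add: J_def)
  ultimately show ?thesis by blast
qed

text \<open>The operator of the iterated Lie bracket \<open>[F\<^sub>j, [\<dots>, [F\<^sub>k, F\<^sub>i]]]\<close>.\<close>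
definition bracket :: "'i list \<Rightarrow> 'i \<Rightarrow> 'v \<Rightarrow> 'v" where
  "bracket u i = foldr (\<lambda>j. commutator (F j)) u (F i)"

lemma bracket_simps [simp]: "bracket [] i = F i" "bracket (j # u) i = commutator (F j) (bracket u i)"
  by (simp_all add: bracket_def)

lemma bracket_linear [simp]:
  "bracket u i (x + y) = bracket u i x + bracket u i y" "bracket u i (s a x) = s a (bracket u i x)"
  "bracket u i 0 = 0"
  by (induction u arbitrary: x y) (simp_all add: commutator_def scale_right_diff_distrib)

definition brackets :: "('i list \<times> 'i) list \<Rightarrow> 'v \<Rightarrow> 'v" where
  "brackets bs x = foldr (\<lambda>(u, i). bracket u i) bs x"

lemma brackets_simps [simp]: "brackets [] x = x" "brackets ((u, i) # bs) x = bracket u i (brackets bs x)"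
  by (simp_all add: brackets_def)

definition bracket_content :: "('i list \<times> 'i) list \<Rightarrow> 'i multiset" where
  "bracket_content bs = (\<Sum>(u, i)\<leftarrow>bs. add_mset i (mset u))"

lemma bracket_content_simps [simp]: "bracket_content [] = {#}"
  "bracket_content ((u, i) # bs) = add_mset i (mset u) + bracket_content bs"
  by (simp_all add: bracket_content_def)

text \<open>Factorisation of the enveloping algebra of the negative half: first a word in \<open>J\<close>, then brackets
  with exactly one node outside \<open>J\<close>.\<close>
definition decomposed :: "'i set \<Rightarrow> 'v \<Rightarrow> 'i multiset \<Rightarrow> 'v set" where
  "decomposed J x c = span {brackets bs (Fw u x) | bs u. set u \<subseteq> J
     \<and> (\<forall>(u', i)\<in>set bs. set u' \<subseteq> J \<and> i \<notin> J) \<and> bracket_content bs + mset u = c}"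

lemma bracket_decomposed:
  assumes "y \<in> decomposed J x c" "set u \<subseteq> J" "i \<notin> J"
  shows "bracket u i y \<in> decomposed J x (add_mset i (mset u) + c)"
  using assms(1) unfolding decomposed_def
proof (induction rule: span_induct_alt)
  case base
  then show ?case by (simp add: span_zero)
next
  case (step a b y)
  then obtain bs u' where b: "b = brackets bs (Fw u' x)" "set u' \<subseteq> J"
    "\<forall>(u', i)\<in>set bs. set u' \<subseteq> J \<and> i \<notin> J" "bracket_content bs + mset u' = c" by blast
  have "bracket u i b \<in> {brackets bs (Fw w x) | bs w. set w \<subseteq> J
     \<and> (\<forall>(u', i)\<in>set bs. set u' \<subseteq> J \<and> i \<notin> J) \<and> bracket_content bs + mset w = add_mset i (mset u) + c}"
    using b assms(2,3) by (intro CollectI exI[of _ "(u, i) # bs"] exI[of _ u']) auto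
  then show ?case using step by (simp add: span_add span_scale span_base)
qed

text \<open>For \<open>k\<close> in \<open>J\<close>, moving \<open>F\<^sub>k\<close> past a bracket lengthens the bracket, without changing its node
  outside \<open>J\<close>.\<close>
lemma F_decomposed:
  assumes "y \<in> decomposed J x c"
  shows "F k y \<in> decomposed J x (add_mset k c)"
proof (cases "k \<in> J")
  case False
  then show ?thesis using bracket_decomposed[OF assms, of "[]" k] by simp
next
  case True
  have main: "F k (brackets bs (Fw u x)) \<in> decomposed J x (add_mset k (bracket_content bs + mset u))"
    if "set u \<subseteq> J" "\<forall>(u', i)\<in>set bs. set u' \<subseteq> J \<and> i \<notin> J" for bs u
    using that(2)
  proof (induction bs)
    case Nil
    have "F k (Fw u x) \<in> {brackets bs (Fw w x) | bs w. set w \<subseteq> J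
     \<and> (\<forall>(u', i)\<in>set bs. set u' \<subseteq> J \<and> i \<notin> J) \<and> bracket_content bs + mset w = add_mset k (mset u)}"
      using that(1) True by (intro CollectI exI[of _ "[]"] exI[of _ "k # u"]) auto
    then show ?case by (simp add: decomposed_def span_base)
  next
    case (Cons b bs)
    obtain u' i where b: "b = (u', i)" by (cases b)
    have u': "set u' \<subseteq> J" "i \<notin> J" and bs: "\<forall>(u', i)\<in>set bs. set u' \<subseteq> J \<and> i \<notin> J"
      using Cons.prems b by auto
    let ?z = "brackets bs (Fw u x)"
    have z: "?z \<in> decomposed J x (bracket_content bs + mset u)"
      unfolding decomposed_def using that(1) bs by (intro span_base) blast
    have 1: "bracket (k # u') i ?z \<in> decomposed J x (add_mset i (mset (k # u')) + (bracket_content bs + mset u))"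
      by (rule bracket_decomposed[OF z]) (use u' True in auto)
    have 2: "bracket u' i (F k ?z) \<in> decomposed J x (add_mset i (mset u') + add_mset k (bracket_content bs + mset u))"
      by (rule bracket_decomposed[OF Cons.IH[OF bs] u'])
    have "F k (brackets (b # bs) (Fw u x)) = bracket (k # u') i ?z + bracket u' i (F k ?z)"
      by (simp add: b commutator_def)
    moreover have "\<dots> \<in> decomposed J x (add_mset k (bracket_content (b # bs) + mset u))"
      using 1 2 unfolding decomposed_def by (intro span_add) (simp_all add: b union_ac)
    ultimately show ?case by simp
  qed
  show ?thesis using assms unfolding decomposed_def[of J x c]
  proof (induction rule: span_induct_alt)
    case base
    then show ?case by (simp add: decomposed_def span_zero)
  next
    case (step a b y)
    then have "F k b \<in> decomposed J x (add_mset k c)" using main by auto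
    then show ?case using step.IH unfolding decomposed_def by (simp add: span_add span_scale)
  qed
qed

lemma Fw_decomposed: "Fw w x \<in> decomposed J x (mset w)"
proof (induction w)
  case Nil
  have "x \<in> {brackets bs (Fw w x) | bs w. set w \<subseteq> J
     \<and> (\<forall>(u', i)\<in>set bs. set u' \<subseteq> J \<and> i \<notin> J) \<and> bracket_content bs + mset w = {#}}"
    by (intro CollectI exI[of _ "[]"]) auto
  then show ?case by (simp add: decomposed_def span_base)
qed (simp add: F_decomposed)

lemma brackets_zero [simp]: "brackets bs 0 = 0"
  by (induction bs) auto

lemma brackets_nonzero: "brackets bs x \<noteq> 0 \<Longrightarrow> x \<noteq> 0 \<and> (\<forall>(u, i)\<in>set bs. \<exists>y. bracket u i y \<noteq> 0)"
proof (induction bs)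
  case (Cons b bs)
  obtain u i where b: "b = (u, i)" by (cases b)
  then have "bracket u i (brackets bs x) \<noteq> 0" using Cons.prems by simp
  moreover from this have "brackets bs x \<noteq> 0" by auto
  ultimately show ?case using Cons.IH b by auto
qed simp

lemma Fw_decomposition:
  assumes "Fw w x \<noteq> 0"
  obtains bs u where "set u \<subseteq> J" "Fw u x \<noteq> 0" "bracket_content bs + mset u = mset w"
    "\<And>u' i. (u', i) \<in> set bs \<Longrightarrow> set u' \<subseteq> J \<and> i \<notin> J \<and> (\<exists>y. bracket u' i y \<noteq> 0)"
proof -
  let ?S = "{brackets bs (Fw u x) | bs u. set u \<subseteq> J
     \<and> (\<forall>(u', i)\<in>set bs. set u' \<subseteq> J \<and> i \<notin> J) \<and> bracket_content bs + mset u = mset w}"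
  have "\<not> ?S \<subseteq> {0}"
  proof
    assume "?S \<subseteq> {0}"
    then have "span ?S \<subseteq> {0}" by (rule span_minimal) simp
    then show False using assms Fw_decomposed[of w x J] unfolding decomposed_def by blast
  qed
  then obtain bs u where *: "brackets bs (Fw u x) \<noteq> 0" "set u \<subseteq> J"
    "\<forall>(u', i)\<in>set bs. set u' \<subseteq> J \<and> i \<notin> J" "bracket_content bs + mset u = mset w" by blast
  show thesis
    by (rule that[OF *(2) _ *(4)]) (use *(3) brackets_nonzero[OF *(1)] in auto)
qed

lemma bracket_words: "bracket u i x \<in> span {Fw w x | w. mset w = add_mset i (mset u)}"
proof (induction u arbitrary: x)
  case Nil
  show ?case by (intro span_base CollectI exI[of _ "[i]"]) simp
next
  case (Cons j u)
  let ?S = "{Fw w x | w. mset w = add_mset i (mset (j # u))}"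
  have "F j y \<in> span ?S" if "y \<in> span {Fw w x | w. mset w = add_mset i (mset u)}" for y
    using that
  proof (induction rule: span_induct_alt)
    case (step a b y)
    then obtain w where w: "b = Fw w x" "mset w = add_mset i (mset u)" by blast
    then have "F j b \<in> ?S" by (intro CollectI exI[of _ "j # w"]) simp
    then show ?case using step.IH by (simp add: span_add span_scale span_base)
  qed (simp add: span_zero)
  then have 1: "F j (bracket u i x) \<in> span ?S" using Cons.IH by blast
  have "{Fw w (F j x) | w. mset w = add_mset i (mset u)} \<subseteq> ?S"
  proof safe
    fix w assume "mset w = add_mset i (mset u)"
    then show "\<exists>w'. Fw w (F j x) = Fw w' x \<and> mset w' = add_mset i (mset (j # u))"
      by (intro exI[of _ "w @ [j]"]) simp
  qed
  then have 2: "bracket u i (F j x) \<in> span ?S" using Cons.IH[of "F j x"] span_mono by blast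
  show ?case using span_diff[OF 1 2] by (simp add: commutator_def)
qed

text \<open>Strings in the upward direction, for vectors on which \<open>F\<^sub>j\<close> is nilpotent. In the adjoint
  representation this turns the recursive description of brackets into roots.\<close>
lemma raise_weight:
  assumes x: "x \<noteq> 0" "\<And>h. T h x = s (\<mu> h) x" and tor: "x \<in> torsion j {0}"
    and z: "\<mu> (cor j) = of_int z" "int t \<le> - z"
  shows "\<exists>y. y \<noteq> 0 \<and> (\<forall>h. T h y = s (\<mu> h + of_nat t * r j h) y)"
proof -
  obtain q where "(F j ^^ q) x \<in> {0}" using tor by (auto simp: torsion_def)
  from last_power_outside[OF this] x(1)
  obtain p where p: "(F j ^^ p) x \<notin> {0}" "F j ((F j ^^ p) x) \<in> {0}" by auto
  let ?y = "(F j ^^ p) x"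
  have TF: "T h ?y = s (\<mu> h - of_nat p * r j h) ?y" for h
    using T_Fw[of h x \<mu> "replicate p j", OF x(2)] by simp
  have TE': "T h ((E j ^^ k) ?y) = s (\<mu> h - of_nat p * r j h + of_nat k * r j h) ((E j ^^ k) ?y)" for h k
  proof (induction k)
    case (Suc k)
    have "T h (E j ((E j ^^ k) ?y)) = s (\<mu> h - of_nat p * r j h + of_nat k * r j h) (E j ((E j ^^ k) ?y))
        + s (r j h) (E j ((E j ^^ k) ?y))" by (simp add: TE_eq Suc)
    then show ?case by (simp only: scale_left_distrib[symmetric] funpow.simps comp_apply)
        (simp add: distrib_right add.assoc add.commute)
  qed (simp add: TF)
  have "(E j ^^ (p + t)) ?y \<notin> {0}"
  proof (rule E_chain[where K = UNIV and k = j and n = "of_int (2 * int p - z)", OF stable_zero _ p])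
    show "T (cor j) ?y - s (- of_int (2 * int p - z)) ?y \<in> {0}"
      using TF[of "cor j"] r_cor[of j j] gcm_diag[OF gcm, of j] z(1) by (simp add: mult.commute)
    fix u assume "u < p + t"
    then have "2 * int p - z \<noteq> int u" using z(2) by simp
    then show "of_int (2 * int p - z) \<noteq> (of_nat u :: complex)" by (metis of_int_eq_iff of_int_of_nat_eq)
  qed simp
  then show ?thesis
    using TE'[of _ "p + t"] by (intro exI[of _ "(E j ^^ (p + t)) ?y"]) (simp add: algebra_simps)
qed

lemma swapped: "chevalley_operators s A r cor F E (\<lambda>h x. - T h x)"
proof (intro chevalley_operators.intro chevalley_operators_axioms.intro vector_space_axioms)
  show "Vector_Spaces.linear s s (\<lambda>x. - T h x)" for h
    by (intro Vector_Spaces.linear.intro module_hom.intro module_hom_axioms.intro)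
      (simp_all add: vector_space_axioms module_axioms)
  show "F i (E j x) - E j (F i x) = (if i = j then - T (cor i) x else 0)" for i j x
    by (auto simp: EF_eq)
  show "- T h (F i x) - F i (- T h x) = s (r i h) (F i x)" for h i x
    by (simp add: TF_eq)
  show "- T h (E i x) - E i (- T h x) = s (- r i h) (E i x)" for h i x
    by (simp add: TE_eq)
qed (use gcm wgt_inj r_cor E_linear F_linear serre_E serre_F in blast)+

end

section \<open>Root vectors of a Kac--Moody algebra\<close>

context chevalley_operators
begin

text \<open>The vector \<open>a\<close> stands for the generator of node \<open>i\<close> in the adjoint representation: it is a
  highest weight vector for \<open>J\<close>, and the Serre relations make its module integrable.\<close>
lemma word_outer_root:
  assumes E: "\<And>j. j \<in> J \<Longrightarrow> E j a = 0" and T: "\<And>h. T h a = s (- r i h) a"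
    and F: "\<And>j. j \<in> J \<Longrightarrow> (F j ^^ nat (1 - A $ j $ i)) a = 0"
    and u: "i \<notin> J" "set u \<subseteq> J" "Fw u a \<noteq> 0"
  shows "add_mset i (mset u) \<in> outer_roots A J"
proof -
  have "hw J {0} (\<lambda>h. - r i h) a"
    using E T stable_zero by (simp add: hw_def)
  moreover have "a \<in> torsion j {0}" if "j \<in> J" for j using F[OF that] by (auto simp: torsion_def)
  moreover have "- r i (cor j) = of_int (- (A $ j $ i))" for j by (simp add: r_cor)
  moreover have "mset u \<in> contents J {0} a" using u by (auto simp: contents_def)
  ultimately have "mset u \<in> reach A (J - J) J (\<lambda>j. - (A $ j $ i))"
    by (intro contents_subset_reach[where x = a and N = "{0}"]) auto
  then show ?thesis using u(1) by (auto simp: outer_roots_def)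
qed

lemma E_word_in_span:
  assumes F: "\<And>k d. d \<in> D \<Longrightarrow> F k d \<in> span (range a)" and E: "\<And>k l. E k (a l) \<in> span D"
    and T: "\<And>h l. T h (a l) = s (- r l h) (a l)"
  shows "E k (Fw w (a l)) \<in> span ({Fw w (a l) | w l. True} \<union> D)"
proof (induction w)
  let ?S = "{Fw w (a l) | w l. True} \<union> D"
  case Nil
  then show ?case using E[of k l] span_mono[of D ?S] by auto
next
  case (Cons j w)
  let ?S = "{Fw w (a l) | w l. True} \<union> D"
  have a: "range a \<subseteq> ?S" by (auto intro!: exI[of _ "[]"])
  have closed: "F j y \<in> span ?S" if "y \<in> span ?S" for y using that
  proof (induction rule: span_induct_alt)
    case (step c b y)
    have "F j b \<in> span ?S"
    proof (cases "b \<in> D")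
      case True
      then show ?thesis using F[of b j] span_mono[OF a] by blast
    next
      case False
      then obtain w l where "b = Fw w (a l)" using step.hyps by blast
      then have "F j b \<in> ?S" by (intro UnI1 CollectI exI[of _ "j # w"] exI[of _ l]) simp
      then show ?thesis by (rule span_base)
    qed
    then show ?case using step.IH by (simp add: span_add span_scale)
  qed (simp add: span_zero)
  have "T (cor k) (Fw w (a l)) \<in> span ?S"
  proof -
    have "T (cor k) (Fw w (a l)) = s (- r l (cor k) - wgt (mset w) (cor k)) (Fw w (a l))"
      by (rule T_Fw[of "cor k" "a l" "\<lambda>h. - r l h"]) (rule T)
    moreover have "Fw w (a l) \<in> ?S" by blast
    ultimately show ?thesis by (simp only: span_scale span_base)
  qed
  then show ?case using closed[OF Cons.IH] by (auto simp: EF_eq span_add)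
qed

lemma torsion_of_F: "F k y \<in> torsion k N \<Longrightarrow> y \<in> torsion k N"
proof -
  assume "F k y \<in> torsion k N"
  then obtain q where "(F k ^^ q) (F k y) \<in> N" by (auto simp: torsion_def)
  then have "(F k ^^ Suc q) y \<in> N" by (simp add: funpow_swap1)
  then show ?thesis unfolding torsion_def by blast
qed

end

lemma sum_mset_count:
  fixes f :: "'i::finite \<Rightarrow> complex"
  shows "(\<Sum>i\<in>#c. f i) = (\<Sum>i\<in>UNIV. of_nat (count c i) * f i)"
proof (induction c)
  case (add x c)
  have "(\<Sum>i\<in>UNIV. of_nat (count (add_mset x c) i) * f i)
      = (\<Sum>i\<in>UNIV. of_nat (count c i) * f i + (if i = x then f i else 0))"
    by (intro sum.cong) (auto simp: algebra_simps)
  then show ?case using add by (simp add: sum.distrib)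
qed simp

context lie_module
begin

lemma act_linear: "Vector_Spaces.linear (mscale V) (mscale V) (act V x)"
  unfolding Vector_Spaces.linear_iff using vector_space_axioms act_add_right act_scale_right by blast

lemma act_zero_left: "act V 0 v = 0"
  using act_add_left[of 0 0 v] by simp

lemma act_brk_commutator: "act V (brk L x y) = commutator (act V x) (act V y)"
  by (simp add: commutator_def fun_eq_iff act_brk)

lemma act_brk_power: "act V ((brk L x ^^ n) y) = (commutator (act V x) ^^ n) (act V y)"
  by (induction n) (simp_all add: act_brk_commutator)

end

lemma (in kac_moody_algebra) wgt_injective:
  assumes "\<And>h. (\<Sum>i\<in>#c. sroot L i h) = (\<Sum>i\<in>#d. sroot L i h)"
  shows "c = d"
proof (rule multiset_eqI)
  fix i
  have "\<forall>h. (\<Sum>i\<in>UNIV. (of_nat (count c i) - of_nat (count d i)) * sroot L i h) = 0"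
    using assms by (simp add: sum_mset_count left_diff_distrib sum_subtractf)
  then have "of_nat (count c i) - of_nat (count d i) = (0 :: complex)" by (rule sroot_indep)
  then show "count c i = count d i" by simp
qed

lemma chevalley_operators_of_module:
  assumes "kac_moody_algebra A L" and "lie_module L V"
  shows "chevalley_operators (mscale V) A (sroot L) (scoroot L)
    (\<lambda>i. act V (chev_e L i)) (\<lambda>i. act V (chev_f L i)) (\<lambda>h. act V (hemb L h))"
proof -
  interpret K: kac_moody_algebra A L by fact
  interpret M: lie_module L V by fact
  have comm: "act V x (act V y v) - act V y (act V x v) = act V (brk L x y) v" for x y v
    by (simp add: M.act_brk)
  have zero: "act V 0 = (\<lambda>x. 0)" by (simp add: fun_eq_iff M.act_zero_left)
  show ?thesis
  proof (intro chevalley_operators.intro chevalley_operators_axioms.intro M.vector_space_axioms)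
    show "act V (chev_e L i) (act V (chev_f L j) x) - act V (chev_f L j) (act V (chev_e L i) x)
        = (if i = j then act V (hemb L (scoroot L i)) x else 0)" for i j x
      by (simp add: comm K.e_f M.act_zero_left)
    show "act V (hemb L h) (act V (chev_e L i) x) - act V (chev_e L i) (act V (hemb L h) x)
        = mscale V (sroot L i h) (act V (chev_e L i) x)" for h i x
      by (simp add: comm K.h_e M.act_scale_left)
    show "act V (hemb L h) (act V (chev_f L i) x) - act V (chev_f L i) (act V (hemb L h) x)
        = mscale V (- sroot L i h) (act V (chev_f L i) x)" for h i x
      by (simp only: comm K.h_f M.act_scale_left)
    show "(commutator (act V (chev_e L i)) ^^ nat (1 - A $ i $ j)) (act V (chev_e L j)) = (\<lambda>x. 0)"
      if "i \<noteq> j" for i j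
      by (simp only: M.act_brk_power[symmetric] K.serre_e[OF that] zero)
    show "(commutator (act V (chev_f L i)) ^^ nat (1 - A $ i $ j)) (act V (chev_f L j)) = (\<lambda>x. 0)"
      if "i \<noteq> j" for i j
      by (simp only: M.act_brk_power[symmetric] K.serre_f[OF that] zero)
  qed (use K.gcm K.wgt_injective K.pairing M.act_linear in blast)+
qed

context kac_moody_algebra
begin

lemma brk_antisym: "brk L x y = - brk L y x"
proof -
  have "brk L (x + y) (x + y) = (brk L x x + brk L y y) + (brk L x y + brk L y x)"
    by (simp only: g.br_add_left g.br_add_right add_ac)
  then have "brk L x y + brk L y x = 0" by (simp add: g.br_self)
  then show ?thesis by (simp add: eq_neg_iff_add_eq_0)
qed

lemma brk_zero_left [simp]: "brk L 0 y = 0"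
  using g.br_add_left[of 0 0 y] by simp

lemma brk_zero_right [simp]: "brk L y 0 = 0"
  using g.br_add_right[of y 0 0] by simp

lemma brk_minus_right: "brk L x (- y) = - brk L x y"
  using g.br_add_right[of x y "- y"] by (simp add: eq_neg_iff_add_eq_0 add.commute)

lemma adjoint_module: "lie_module L \<lparr>mscale = gscale L, act = brk L\<rparr>"
proof (intro lie_module.intro lie_module_axioms.intro)
  show "vector_space (mscale \<lparr>mscale = gscale L, act = brk L\<rparr>)"
    by (simp add: g.vector_space_axioms)
  show "act \<lparr>mscale = gscale L, act = brk L\<rparr> (brk L x y) v
      = act \<lparr>mscale = gscale L, act = brk L\<rparr> x (act \<lparr>mscale = gscale L, act = brk L\<rparr> y v)
      - act \<lparr>mscale = gscale L, act = brk L\<rparr> y (act \<lparr>mscale = gscale L, act = brk L\<rparr> x v)" for x y v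
  proof -
    have "brk L x (brk L y v) + brk L y (brk L v x) + brk L v (brk L x y) = 0" by (rule g.jacobi)
    moreover have "brk L v x = - brk L x v" "brk L v (brk L x y) = - brk L (brk L x y) v"
      by (rule brk_antisym)+
    ultimately show ?thesis by (simp add: brk_minus_right)
  qed
qed (simp_all add: g.br_add_left g.br_add_right g.br_scale_left g.br_scale_right)

sublocale ad: chevalley_operators "gscale L" A "sroot L" "scoroot L"
    "\<lambda>i. brk L (chev_e L i)" "\<lambda>i. brk L (chev_f L i)" "\<lambda>h. brk L (hemb L h)"
  using chevalley_operators_of_module[OF kac_moody_algebra_axioms adjoint_module] by simp

sublocale ad': chevalley_operators "gscale L" A "sroot L" "scoroot L"
    "\<lambda>i. brk L (chev_f L i)" "\<lambda>i. brk L (chev_e L i)" "\<lambda>h x. - brk L (hemb L h) x"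
  by (rule ad.swapped)

text \<open>The elements that preserve \<open>S\<close> form a subalgebra.\<close>
lemma generators_act:
  assumes M: "lie_module L V" and S: "module.subspace (mscale V) S"
    and closed: "\<And>h y. y \<in> S \<Longrightarrow> act V (hemb L h) y \<in> S" "\<And>i y. y \<in> S \<Longrightarrow> act V (chev_e L i) y \<in> S"
      "\<And>i y. y \<in> S \<Longrightarrow> act V (chev_f L i) y \<in> S"
    and y: "y \<in> S"
  shows "act V x y \<in> S"
proof -
  interpret M: lie_module L V by fact
  let ?T = "{x. \<forall>y\<in>S. act V x y \<in> S}"
  have "g.subspace ?T"
    unfolding g.subspace_def using M.subspace_0[OF S] M.subspace_add[OF S] M.subspace_scale[OF S]
    by (auto simp: M.act_zero_left M.act_add_left M.act_scale_left)
  moreover have "\<forall>x\<in>?T. \<forall>y\<in>?T. brk L x y \<in> ?T"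
    using M.subspace_diff[OF S] by (auto simp: M.act_brk)
  moreover have "range (hemb L) \<union> range (chev_e L) \<union> range (chev_f L) \<subseteq> ?T"
    using closed by auto
  ultimately have "UNIV \<subseteq> ?T"
    unfolding generated[symmetric] lie_generated_def by (intro Inter_lower CollectI conjI)
  then show ?thesis using y by auto
qed

lemma generators_span:
  assumes S: "g.subspace S"
    and closed: "\<And>h y. y \<in> S \<Longrightarrow> brk L (hemb L h) y \<in> S" "\<And>i y. y \<in> S \<Longrightarrow> brk L (chev_e L i) y \<in> S"
      "\<And>i y. y \<in> S \<Longrightarrow> brk L (chev_f L i) y \<in> S"
    and gens: "\<And>h. hemb L h \<in> S" "\<And>i. chev_e L i \<in> S" "\<And>i. chev_f L i \<in> S"
  shows "x \<in> S"
proof -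
  have "brk L x y \<in> S" if "y \<in> S" for x y
    using generators_act[OF adjoint_module, of S y x] S closed that by simp
  then have "UNIV \<subseteq> S"
    unfolding generated[symmetric] lie_generated_def using S gens by (intro Inter_lower) auto
  then show ?thesis by blast
qed

lemma coroot_nonzero: "scoroot L i \<noteq> 0"
proof
  assume "scoroot L i = 0"
  moreover have "(\<Sum>j\<in>UNIV. hscale L (if j = i then 1 else 0) (scoroot L j)) = (\<Sum>j\<in>{i}. scoroot L j)"
    by (intro sum.mono_neutral_cong_right) auto
  ultimately have "(\<Sum>j\<in>UNIV. hscale L (if j = i then 1 else 0) (scoroot L j)) = 0" by simp
  from scoroot_indep[OF this, of i] show False by simp
qed

lemma hemb_zero: "hemb L 0 = 0"
  using hemb_linear by (simp add: Vector_Spaces.linear_iff) (metis add_cancel_right_left)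

lemma chev_nonzero: "chev_e L i \<noteq> 0" "chev_f L i \<noteq> 0"
proof -
  have "brk L (chev_e L i) (chev_f L i) \<noteq> 0"
    using e_f[of i i] coroot_nonzero[of i] injD[OF hemb_inj, of "scoroot L i" 0] hemb_zero by auto
  then show "chev_e L i \<noteq> 0" "chev_f L i \<noteq> 0" by auto
qed

lemma ad_f_nilpotent: "x \<in> ad.torsion j {0}"
proof (rule generators_span)
  have st: "ad.stable UNIV (ad.torsion j {0})" by (rule ad.stable_torsion[OF ad.stable_zero]) simp
  note D = ad.stableD[OF st]
  show "g.subspace (ad.torsion j {0})" by (rule D)
  show f: "chev_f L i \<in> ad.torsion j {0}" for i
  proof (cases "j = i")
    case True
    then have "brk L (chev_f L j) (chev_f L i) \<in> ad.torsion j {0}"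
      using g.subspace_0[OF D(1)] by (simp add: g.br_self)
    then show ?thesis by (rule ad.torsion_of_F)
  next
    case False
    then show ?thesis using serre_f[OF False] by (auto simp: ad.torsion_def)
  qed
  show h: "hemb L h \<in> ad.torsion j {0}" for h
  proof (rule ad.torsion_of_F)
    have "brk L (chev_f L j) (hemb L h) = - gscale L (- sroot L j h) (chev_f L j)"
      by (subst brk_antisym) (simp only: h_f)
    then show "brk L (chev_f L j) (hemb L h) \<in> ad.torsion j {0}"
      using g.subspace_scale[OF D(1) f] by simp
  qed
  show "chev_e L i \<in> ad.torsion j {0}" for i
  proof (rule ad.torsion_of_F)
    have "brk L (chev_f L j) (chev_e L i) = - (if i = j then hemb L (scoroot L i) else 0)"
      by (subst brk_antisym) (simp only: e_f)
    then show "brk L (chev_f L j) (chev_e L i) \<in> ad.torsion j {0}"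
      using g.subspace_neg[OF D(1) h] g.subspace_0[OF D(1)] by simp
  qed
  show "brk L (hemb L h) y \<in> ad.torsion j {0}" if "y \<in> ad.torsion j {0}" for h y
    by (rule D(4)[OF that])
  show "brk L (chev_e L i) y \<in> ad.torsion j {0}" "brk L (chev_f L i) y \<in> ad.torsion j {0}"
    if "y \<in> ad.torsion j {0}" for i y
    by (rule D(2)[OF that UNIV_I] D(3)[OF that UNIV_I])+
qed

text \<open>The vector is found by following the strings of \<open>b\<close> upwards from the generator of node \<open>i\<close>, in the
  positive half of the algebra.\<close>
lemma outer_root_vector:
  assumes "b \<in> outer_roots A J"
  shows "\<exists>x. x \<noteq> 0 \<and> (\<forall>h. brk L (hemb L h) x = gscale L (ad.wgt b h) x)"
proof -
  obtain i y where b: "b = add_mset i y" and y: "y \<in> reach A {} J (\<lambda>j. - (A $ j $ i))"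
    using assms by (auto simp: outer_roots_def)
  show ?thesis unfolding b using y
  proof induction
    case empty
    then show ?case using chev_nonzero(1)[of i] h_e by (intro exI[of _ "chev_e L i"]) simp
  next
    case (string y j t)
    then obtain x where x: "x \<noteq> 0" "\<And>h. brk L (hemb L h) x = gscale L (ad.wgt (add_mset i y) h) x" by blast
    have "\<exists>x'. x' \<noteq> 0 \<and> (\<forall>h. brk L (hemb L h) x' = gscale L (ad.wgt (add_mset i y) h + of_nat t * sroot L j h) x')"
    proof (rule ad.raise_weight[OF x ad_f_nilpotent])
      show "ad.wgt (add_mset i y) (scoroot L j) = of_int (A $ j $ i + coroot_value A y j)"
        by (simp only: ad.wgt_cor coroot_value_simps)
      show "int t \<le> - (A $ j $ i + coroot_value A y j)" using string.hyps by simp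
    qed
    then show ?case by (simp add: add.assoc)
  qed auto
qed

lemma f_word_outer_root:
  assumes "i \<notin> J" "set u \<subseteq> J" "ad.Fw u (chev_f L i) \<noteq> 0"
  shows "add_mset i (mset u) \<in> outer_roots A J"
proof (rule ad.word_outer_root[of J "chev_f L i" i u])
  show "(brk L (chev_f L j) ^^ nat (1 - A $ j $ i)) (chev_f L i) = 0" if "j \<in> J" for j
    using that assms(1) by (intro serre_f) auto
qed (use assms in \<open>auto simp: e_f h_f\<close>)

lemma e_word_outer_root:
  assumes "i \<notin> J" "set u \<subseteq> J" "ad'.Fw u (chev_e L i) \<noteq> 0"
  shows "add_mset i (mset u) \<in> outer_roots A J"
proof (rule ad'.word_outer_root[of J "chev_e L i" i u])
  show "brk L (chev_f L j) (chev_e L i) = 0" if "j \<in> J" for j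
    using that assms(1) brk_antisym[of "chev_f L j" "chev_e L i"] by (auto simp: e_f)
  show "(brk L (chev_e L j) ^^ nat (1 - A $ j $ i)) (chev_e L i) = 0" if "j \<in> J" for j
    using that assms(1) by (intro serre_e) auto
qed (use assms in \<open>auto simp: h_e\<close>)

lemma bracket_f: "lie_module L V \<Longrightarrow>
    chevalley_operators.bracket (\<lambda>i. act V (chev_f L i)) u i = act V (ad.Fw u (chev_f L i))"
proof -
  assume V: "lie_module L V"
  interpret M: lie_module L V by fact
  interpret O: chevalley_operators "mscale V" A "sroot L" "scoroot L" "\<lambda>i. act V (chev_e L i)"
    "\<lambda>i. act V (chev_f L i)" "\<lambda>h. act V (hemb L h)"
    by (rule chevalley_operators_of_module[OF kac_moody_algebra_axioms V])
  show ?thesis by (induction u) (simp_all add: M.act_brk_commutator)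
qed

lemma bracket_e: "ad'.bracket u i = brk L (ad'.Fw u (chev_e L i))"
proof -
  interpret M: lie_module L "\<lparr>mscale = gscale L, act = brk L\<rparr>" by (rule adjoint_module)
  have "brk L (brk L x y) = commutator (brk L x) (brk L y)" for x y
    using M.act_brk_commutator by simp
  then show ?thesis by (induction u) simp_all
qed

text \<open>The triangular decomposition, without directness of the sum.\<close>
lemma triangular_span:
  "x \<in> g.span ({ad.Fw w (chev_f L l) | w l. True} \<union> range (hemb L) \<union> {ad'.Fw w (chev_e L l) | w l. True})"
proof -
  let ?P = "{ad'.Fw w (chev_e L l) | w l. True}" and ?N = "{ad.Fw w (chev_f L l) | w l. True}"
  let ?D = "range (hemb L)"
  let ?B = "?N \<union> ?D \<union> ?P"
  have span: "G y \<in> g.span ?B" if G: "module_hom (gscale L) (gscale L) G" "\<And>b. b \<in> ?B \<Longrightarrow> G b \<in> g.span ?B"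
    and y: "y \<in> g.span ?B" for G y
    using y
  proof (induction rule: g.span_induct_alt)
    case base
    then show ?case using module_hom.zero[OF G(1)] g.span_zero by simp
  next
    case (step c x y)
    then show ?case using G(2)[of x] module_hom.add[OF G(1)] module_hom.scale[OF G(1)]
      by (simp add: g.span_add g.span_scale)
  qed
  have fh: "brk L (chev_f L k) d \<in> g.span (range (chev_f L))"
    and eh: "brk L (chev_e L k) d \<in> g.span (range (chev_e L))" if d: "d \<in> ?D" for k d
  proof -
    obtain h where d: "d = hemb L h" using d by blast
    have "brk L (chev_f L k) d = - gscale L (- sroot L k h) (chev_f L k)"
      unfolding d by (subst brk_antisym) (simp only: h_f)
    then show "brk L (chev_f L k) d \<in> g.span (range (chev_f L))"
      by (simp only:) (intro g.span_neg g.span_scale g.span_base rangeI)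
    have "brk L (chev_e L k) d = - gscale L (sroot L k h) (chev_e L k)"
      unfolding d by (subst brk_antisym) (simp only: h_e)
    then show "brk L (chev_e L k) d \<in> g.span (range (chev_e L))"
      by (simp only:) (intro g.span_neg g.span_scale g.span_base rangeI)
  qed
  have ef: "brk L (chev_e L k) (chev_f L l) \<in> g.span ?D" for k l
    by (simp add: e_f g.span_base g.span_zero)
  have fe: "brk L (chev_f L k) (chev_e L l) \<in> g.span ?D" for k l
    using g.span_neg[OF ef[of l k]] brk_antisym[of "chev_f L k" "chev_e L l"] by simp
  have N_sub: "g.span (?N \<union> ?D) \<subseteq> g.span ?B" and P_sub: "g.span (?P \<union> ?D) \<subseteq> g.span ?B"
    by (intro g.span_mono; blast)+
  have f_sub: "range (chev_f L) \<subseteq> ?N" and e_sub: "range (chev_e L) \<subseteq> ?P"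
    by (auto intro!: exI[of _ "[]"])
  have f_span: "g.span (range (chev_f L)) \<subseteq> g.span ?B" and e_span: "g.span (range (chev_e L)) \<subseteq> g.span ?B"
    using f_sub e_sub by (intro g.span_mono; blast)+
  have e_closed: "brk L (chev_e L k) y \<in> g.span ?B" if y: "y \<in> g.span ?B" for k y
  proof (rule span[OF ad.E_hom _ y])
    fix b assume "b \<in> ?B"
    then consider (n) w l where "b = ad.Fw w (chev_f L l)" | (d) "b \<in> ?D"
      | (p) w l where "b = ad'.Fw w (chev_e L l)" by blast
    then show "brk L (chev_e L k) b \<in> g.span ?B"
    proof cases
      case n
      then show ?thesis
        using ad.E_word_in_span[of ?D "chev_f L" k w l, OF fh ef h_f] N_sub by blast
    next
      case d
      then show ?thesis using eh e_span by blast
    next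
      case p
      then have "brk L (chev_e L k) b \<in> ?P" by (intro CollectI exI[of _ "k # w"] exI[of _ l]) simp
      then show ?thesis by (intro g.span_base UnI2)
    qed
  qed
  have f_closed: "brk L (chev_f L k) y \<in> g.span ?B" if y: "y \<in> g.span ?B" for k y
  proof (rule span[OF ad.F_hom _ y])
    fix b assume "b \<in> ?B"
    then consider (n) w l where "b = ad.Fw w (chev_f L l)" | (d) "b \<in> ?D"
      | (p) w l where "b = ad'.Fw w (chev_e L l)" by blast
    then show "brk L (chev_f L k) b \<in> g.span ?B"
    proof cases
      case n
      then have "brk L (chev_f L k) b \<in> ?N" by (intro CollectI exI[of _ "k # w"] exI[of _ l]) simp
      then show ?thesis by (intro g.span_base UnI1)
    next
      case d
      then show ?thesis using fh f_span by blast
    next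
      case p
      have "- brk L (hemb L h) (chev_e L l) = gscale L (- sroot L l h) (chev_e L l)" for h l
        by (simp add: h_e)
      then show ?thesis
        using p ad'.E_word_in_span[of ?D "chev_e L" k w l, OF eh fe] P_sub by blast
    qed
  qed
  have h_closed: "brk L (hemb L h) y \<in> g.span ?B" if y: "y \<in> g.span ?B" for h y
  proof (rule span[OF ad.T_hom _ y])
    fix b assume bB: "b \<in> ?B"
    then consider (n) w l where "b = ad.Fw w (chev_f L l)" | (d) "b \<in> ?D"
      | (p) w l where "b = ad'.Fw w (chev_e L l)" by blast
    then have "\<exists>a. brk L (hemb L h) b = gscale L a b"
    proof cases
      case n
      then show ?thesis using ad.T_Fw[of h "chev_f L l" "\<lambda>h. - sroot L l h" w] h_f[of h l] by auto
    next
      case d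
      then show ?thesis using h_abelian by (intro exI[of _ 0]) auto
    next
      case p
      then have "- brk L (hemb L h) b = gscale L (- sroot L l h - ad.wgt (mset w) h) b"
        using ad'.T_Fw[of h "chev_e L l" "\<lambda>h. - sroot L l h" w] h_e[of h l] by auto
      then have "brk L (hemb L h) b = gscale L (- (- sroot L l h - ad.wgt (mset w) h)) b"
        by (metis add.inverse_inverse g.scale_minus_left)
      then show ?thesis by blast
    qed
    then show "brk L (hemb L h) b \<in> g.span ?B" using g.span_scale[OF g.span_base[OF bB]] by auto
  qed
  show ?thesis
  proof (rule generators_span[OF g.subspace_span h_closed e_closed f_closed])
    show "hemb L h \<in> g.span ?B" for h by (intro g.span_base) blast
    show "chev_e L i \<in> g.span ?B" "chev_f L i \<in> g.span ?B" for i
      using f_sub e_sub by (intro g.span_base; blast)+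
  qed
qed

end

section \<open>Cones of roots\<close>

lemma nat_cone_zero: "(\<lambda>h. 0) \<in> nat_cone S"
  unfolding nat_cone_def by (intro CollectI exI[of _ "{}"]) auto

lemma nat_cone_add:
  assumes "\<beta> \<in> S" "\<gamma> \<in> nat_cone S"
  shows "(\<lambda>h. \<beta> h + \<gamma> h) \<in> nat_cone S"
proof -
  obtain F and c :: "('a \<Rightarrow> complex) \<Rightarrow> nat" where F: "finite F" "F \<subseteq> S"
    and \<gamma>: "\<gamma> = (\<lambda>h. \<Sum>\<beta>\<in>F. of_nat (c \<beta>) * \<beta> h)"
    using assms(2) unfolding nat_cone_def by blast
  define c' where "c' x = (if x \<in> F then c x else 0) + (if x = \<beta> then 1 else 0)" for x
  have "\<beta> h + \<gamma> h = (\<Sum>x\<in>insert \<beta> F. of_nat (c' x) * x h)" for h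
  proof -
    have "(\<Sum>x\<in>insert \<beta> F. of_nat (c' x) * x h)
        = (\<Sum>x\<in>insert \<beta> F. of_nat (if x \<in> F then c x else 0) * x h + (if x = \<beta> then x h else 0))"
      by (intro sum.cong) (auto simp: c'_def algebra_simps)
    also have "\<dots> = (\<Sum>x\<in>insert \<beta> F. of_nat (if x \<in> F then c x else 0) * x h) + \<beta> h"
      using F(1) by (simp add: sum.distrib sum.delta)
    also have "(\<Sum>x\<in>insert \<beta> F. of_nat (if x \<in> F then c x else 0) * x h) = (\<Sum>x\<in>F. of_nat (c x) * x h)"
      using F(1) by (intro sum.mono_neutral_cong_right) auto
    finally show ?thesis by (simp add: \<gamma>)
  qed
  then show ?thesis
    unfolding nat_cone_def using F assms(1) by (intro CollectI exI[of _ "insert \<beta> F"] exI[of _ c']) auto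
qed

lemma nat_cone_induct [consumes 1, case_names zero add]:
  assumes \<gamma>: "\<gamma> \<in> nat_cone S" and zero: "P (\<lambda>h. 0)"
    and add: "\<And>\<beta> \<gamma>. \<beta> \<in> S \<Longrightarrow> P \<gamma> \<Longrightarrow> P (\<lambda>h. \<beta> h + \<gamma> h)"
  shows "P \<gamma>"
proof -
  obtain F and c :: "('a \<Rightarrow> complex) \<Rightarrow> nat" where F: "finite F" "F \<subseteq> S"
    and \<gamma>: "\<gamma> = (\<lambda>h. \<Sum>\<beta>\<in>F. of_nat (c \<beta>) * \<beta> h)"
    using \<gamma> unfolding nat_cone_def by blast
  have mult: "P (\<lambda>h. of_nat n * \<beta> h + \<delta> h)" if "P \<delta>" "\<beta> \<in> S" for n \<beta> \<delta>
  proof (induction n)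
    case (Suc n)
    have "(\<lambda>h. of_nat (Suc n) * \<beta> h + \<delta> h) = (\<lambda>h. \<beta> h + (of_nat n * \<beta> h + \<delta> h))"
      by (simp add: algebra_simps)
    then show ?case using add[OF that(2) Suc] by simp
  qed (use that in simp)
  have "P (\<lambda>h. \<Sum>\<beta>\<in>F. of_nat (c \<beta>) * \<beta> h)" using F
  proof (induction F rule: finite_induct)
    case (insert \<beta> F)
    then show ?case using mult[of "\<lambda>h. \<Sum>\<beta>\<in>F. of_nat (c \<beta>) * \<beta> h" \<beta> "c \<beta>"] by simp
  qed (simp add: zero)
  then show ?thesis by (simp add: \<gamma>)
qed

lemma nat_cone_subset_int_lattice: "nat_cone S \<subseteq> int_lattice S"
proof
  fix \<gamma> assume "\<gamma> \<in> nat_cone S"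
  then obtain F and c :: "('a \<Rightarrow> complex) \<Rightarrow> nat" where "finite F" "F \<subseteq> S"
    "\<gamma> = (\<lambda>h. \<Sum>\<beta>\<in>F. of_nat (c \<beta>) * \<beta> h)"
    unfolding nat_cone_def by blast
  then show "\<gamma> \<in> int_lattice S"
    unfolding int_lattice_def by (intro CollectI exI[of _ F] exI[of _ "\<lambda>\<beta>. int (c \<beta>)"]) simp
qed

lemma wgt_corner: "chevalley_operators.wgt r (corner e I) h = (\<Sum>i\<in>I. of_nat (e i) * r i h)"
  if "chevalley_operators s A r cor E F T"
proof -
  interpret chevalley_operators s A r cor E F T by fact
  have "finite I" by simp
  then show ?thesis
    by (induction I rule: finite_induct) (simp_all add: corner_insert, simp add: corner_def)
qed

context kac_moody_algebra
begin

lemma wgt_add: "ad.wgt (add_mset i c) = (\<lambda>h. sroot L i h + ad.wgt c h)"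
  "ad.wgt {#} = (\<lambda>h. 0)" "ad.wgt (c + d) = (\<lambda>h. ad.wgt c h + ad.wgt d h)"
  by (simp_all add: fun_eq_iff)

lemma wgt_in_nat_cone: "set_mset c \<subseteq> J \<Longrightarrow> ad.wgt c \<in> nat_cone (sroot L ` J)"
  by (induction c) (auto simp: wgt_add intro!: nat_cone_add nat_cone_zero)

lemma nat_cone_wgt:
  assumes "\<beta> \<in> nat_cone (sroot L ` J)"
  shows "\<exists>c. set_mset c \<subseteq> J \<and> \<beta> = ad.wgt c"
  using assms
proof (induction rule: nat_cone_induct)
  case zero
  show ?case by (intro exI[of _ "{#}"]) (simp add: wgt_add)
next
  case (add \<beta> \<gamma>)
  then obtain i c where "i \<in> J" "\<beta> = sroot L i" "set_mset c \<subseteq> J" "\<gamma> = ad.wgt c" by blast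
  then show ?case by (intro exI[of _ "add_mset i c"]) (simp add: wgt_add)
qed

lemma sroot_inj: "inj (sroot L)"
proof (rule injI)
  fix i j assume "sroot L i = sroot L j"
  then have "{#i#} = {#j#}" by (intro ad.wgt_eqD) simp
  then show "i = j" by simp
qed

lemma int_lattice_wgt:
  assumes "ad.wgt c \<in> int_lattice (sroot L ` J)"
  shows "set_mset c \<subseteq> J"
proof
  fix i assume i: "i \<in># c"
  obtain F and a :: "('h \<Rightarrow> complex) \<Rightarrow> int" where F: "finite F" "F \<subseteq> sroot L ` J"
    and c: "ad.wgt c = (\<lambda>h. \<Sum>\<beta>\<in>F. of_int (a \<beta>) * \<beta> h)"
    using assms unfolding int_lattice_def by blast
  obtain G where G: "G \<subseteq> J" "F = sroot L ` G" using F(2) by (auto simp: subset_image_iff)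
  have "\<forall>h. (\<Sum>i\<in>UNIV. (of_nat (count c i) - (if i \<in> G then of_int (a (sroot L i)) else 0)) * sroot L i h) = 0"
  proof
    fix h
    have "(\<Sum>i\<in>UNIV. of_nat (count c i) * sroot L i h) = ad.wgt c h"
      by (simp add: ad.wgt_def sum_mset_count)
    also have "\<dots> = (\<Sum>i\<in>G. of_int (a (sroot L i)) * sroot L i h)"
      unfolding c G(2) by (subst sum.reindex) (auto intro: inj_on_subset[OF sroot_inj])
    also have "\<dots> = (\<Sum>i\<in>UNIV. (if i \<in> G then of_int (a (sroot L i)) else 0) * sroot L i h)"
      by (intro sum.mono_neutral_cong_left) auto
    finally show "(\<Sum>i\<in>UNIV. (of_nat (count c i) - (if i \<in> G then of_int (a (sroot L i)) else 0)) * sroot L i h) = 0"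
      by (simp add: left_diff_distrib sum_subtractf)
  qed
  then have "of_nat (count c i) - (if i \<in> G then of_int (a (sroot L i)) else 0) = (0 :: complex)"
    by (rule sroot_indep)
  then show "i \<in> J" using i G(1) by (auto simp: count_eq_zero_iff split: if_splits)
qed

lemma hdual_iff: "\<mu> \<in> hdual L \<longleftrightarrow> (\<forall>x y. \<mu> (x + y) = \<mu> x + \<mu> y) \<and> (\<forall>a x. \<mu> (hscale L a x) = a * \<mu> x)"
proof -
  have "vector_space ((*) :: complex \<Rightarrow> complex \<Rightarrow> complex)"
    by unfold_locales (auto simp: algebra_simps)
  then show ?thesis unfolding hdual_def Vector_Spaces.linear_iff using vector_space_axioms by auto
qed

lemma wgt_hdual: "ad.wgt c \<in> hdual L"
proof (induction c)
  case (add i c)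
  then show ?case using sroot_hdual[of i] by (auto simp: hdual_iff wgt_add distrib_left)
qed (simp add: hdual_iff wgt_add)

lemma outer_root_pos_root:
  assumes "b \<in> outer_roots A J"
  shows "ad.wgt b \<in> pos_roots L - pos_roots_on L J"
proof -
  obtain i y where "b = add_mset i y" "i \<notin> J" using assms by (auto simp: outer_roots_def)
  then have i: "i \<in># b" "i \<notin> J" by auto
  have "ad.wgt b \<noteq> (\<lambda>h. 0)" using ad.wgt_eqD[of b "{#}"] i(1) by (metis ad.wgt_simps(1) empty_iff set_mset_empty)
  then have "ad.wgt b \<in> roots L" using outer_root_vector[OF assms] wgt_hdual by (auto simp: roots_def)
  moreover have "ad.wgt b \<in> nat_cone (range (sroot L))" by (rule wgt_in_nat_cone) simp
  moreover have "ad.wgt b \<notin> int_lattice (sroot L ` J)" using int_lattice_wgt i by blast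
  ultimately show ?thesis by (simp add: pos_roots_def pos_roots_on_def)
qed

lemma e_word_weight:
  "brk L (hemb L h) (ad'.Fw w (chev_e L l)) = gscale L (ad.wgt (add_mset l (mset w)) h) (ad'.Fw w (chev_e L l))"
proof -
  have "- brk L (hemb L h) (ad'.Fw w (chev_e L l))
      = gscale L (- sroot L l h - ad.wgt (mset w) h) (ad'.Fw w (chev_e L l))"
    by (rule ad'.T_Fw[of h "chev_e L l" "\<lambda>h. - sroot L l h" w]) (simp add: h_e)
  then have "brk L (hemb L h) (ad'.Fw w (chev_e L l))
      = gscale L (- (- sroot L l h - ad.wgt (mset w) h)) (ad'.Fw w (chev_e L l))"
    by (metis add.inverse_inverse g.scale_minus_left)
  then show ?thesis by simp
qed

text \<open>By antisymmetry, the innermost bracket with a node \<open>i\<close> outside \<open>J\<close> can be turned around, so that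
  it becomes an operator applied to the generator of \<open>i\<close>.\<close>
lemma e_word_end_outside:
  assumes x: "ad'.Fw w (chev_e L l) \<noteq> 0" and out: "\<not> set_mset (add_mset l (mset w)) \<subseteq> J"
  shows "\<exists>i u. i \<notin> J \<and> ad'.Fw u (chev_e L i) \<noteq> 0 \<and> add_mset i (mset u) = add_mset l (mset w)"
proof (cases "l \<in> J")
  case False
  then show ?thesis using x by blast
next
  case True
  then have "\<exists>i\<in>set w. i \<notin> J" using out by auto
  then obtain w1 i w2 where w: "w = w1 @ i # w2" and i: "i \<notin> J" using split_list by metis
  have "brk L (chev_e L i) (ad'.Fw w2 (chev_e L l)) = - ad'.bracket w2 l (chev_e L i)"
    unfolding bracket_e by (rule brk_antisym)
  then have "ad'.Fw (i # w2) (chev_e L l)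
      \<in> g.span {ad'.Fw u (chev_e L i) | u. mset u = add_mset l (mset w2)}"
    using g.span_neg[OF ad'.bracket_words[of w2 l "chev_e L i"]] by simp
  then have "ad'.Fw w1 (ad'.Fw (i # w2) (chev_e L l))
      \<in> g.span {ad'.Fw u (chev_e L i) | u. mset u = mset w1 + add_mset l (mset w2)}"
  proof (induction w1)
    case (Cons k w1)
    let ?S = "{ad'.Fw u (chev_e L i) | u. mset u = mset (k # w1) + add_mset l (mset w2)}"
    have "brk L (chev_e L k) y \<in> g.span ?S"
      if "y \<in> g.span {ad'.Fw u (chev_e L i) | u. mset u = mset w1 + add_mset l (mset w2)}" for y
      using that
    proof (induction rule: g.span_induct_alt)
      case base
      then show ?case by (simp add: g.span_zero)
    next
      case (step c x y)
      then obtain u where "x = ad'.Fw u (chev_e L i)" "mset u = mset w1 + add_mset l (mset w2)" by blast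
      then have "brk L (chev_e L k) x \<in> ?S" by (intro CollectI exI[of _ "k # u"]) simp
      then show ?case using step.IH
        by (simp add: g.br_add_right g.br_scale_right g.span_add g.span_scale g.span_base)
    qed
    then show ?case using Cons by simp
  qed simp
  then have mem: "ad'.Fw w (chev_e L l)
      \<in> g.span {ad'.Fw u (chev_e L i) | u. mset u = mset w1 + add_mset l (mset w2)}" using w by simp
  have "\<not> {ad'.Fw u (chev_e L i) | u. mset u = mset w1 + add_mset l (mset w2)} \<subseteq> {0}"
    using g.span_minimal[of _ "{0}"] mem x g.subspace_single_0 by blast
  then obtain u where "ad'.Fw u (chev_e L i) \<noteq> 0" "mset u = mset w1 + add_mset l (mset w2)" by blast
  then show ?thesis using i w by (intro exI[of _ i] exI[of _ u]) simp
qed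

lemma pos_root_word:
  assumes "\<beta> \<in> pos_roots L"
  shows "\<exists>w l. ad'.Fw w (chev_e L l) \<noteq> 0 \<and> \<beta> = ad.wgt (add_mset l (mset w))"
proof -
  obtain x where x: "x \<noteq> 0" "\<And>h. brk L (hemb L h) x = gscale L (\<beta> h) x" and \<beta>0: "\<beta> \<noteq> (\<lambda>h. 0)"
    using assms by (auto simp: pos_roots_def roots_def)
  obtain b where b: "\<beta> = ad.wgt b" using assms nat_cone_wgt[of \<beta> UNIV] by (auto simp: pos_roots_def)
  let ?P = "{ad'.Fw w (chev_e L l) | w l. True}" and ?N = "{ad.Fw w (chev_f L l) | w l. True}"
  let ?B = "?N \<union> range (hemb L) \<union> ?P"
  have N: "brk L (hemb L h) (ad.Fw w (chev_f L l))
      = gscale L (- ad.wgt (add_mset l (mset w)) h) (ad.Fw w (chev_f L l))" for h w l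
    using ad.T_Fw[of h "chev_f L l" "\<lambda>h. - sroot L l h" w] h_f[of h l] by simp
  have "\<exists>y\<in>?B. y \<notin> {0} \<and> (\<forall>h. brk L (hemb L h) y = gscale L (\<beta> h) y)"
  proof (rule ad.weight_component_vector[OF _ _ x(2) _ _ triangular_span[of x]])
    fix y assume "y \<in> ?B"
    then consider (n) w l where "y = ad.Fw w (chev_f L l)" | (d) k where "y = hemb L k"
      | (p) w l where "y = ad'.Fw w (chev_e L l)" by blast
    then show "\<exists>\<nu>. \<forall>h. brk L (hemb L h) y = gscale L (\<nu> h) y"
    proof cases
      case n
      then show ?thesis using N by (intro exI[of _ "\<lambda>h. - ad.wgt (add_mset l (mset w)) h"]) simp
    next
      case d
      then show ?thesis using h_abelian by (intro exI[of _ "\<lambda>h. 0"]) simp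
    next
      case p
      then show ?thesis using e_word_weight by (intro exI[of _ "ad.wgt (add_mset l (mset w))"]) simp
    qed
  qed (use x in auto)
  then obtain y where y: "y \<in> ?B" "y \<noteq> 0" "\<And>h. brk L (hemb L h) y = gscale L (\<beta> h) y" by blast
  from y(1) consider (n) w l where "y = ad.Fw w (chev_f L l)" | (d) k where "y = hemb L k"
    | (p) w l where "y = ad'.Fw w (chev_e L l)" by blast
  then show ?thesis
  proof cases
    case n
    have "ad.wgt b h = - ad.wgt (add_mset l (mset w)) h" for h
      using ad.weight_unique[OF y(2) y(3)] N n b by metis
    then have "ad.wgt (b + add_mset l (mset w)) h = ad.wgt {#} h" for h by simp
    then have "b + add_mset l (mset w) = {#}" by (rule ad.wgt_eqD)
    then show ?thesis by simp
  next
    case d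
    have "\<beta> h = 0" for h
      using ad.weight_unique[OF y(2) y(3), of h 0] h_abelian d by simp
    then show ?thesis using \<beta>0 by auto
  next
    case p
    have "\<beta> h = ad.wgt (add_mset l (mset w)) h" for h
      using ad.weight_unique[OF y(2) y(3)] e_word_weight p by metis
    then show ?thesis using y(2) p by blast
  qed
qed

text \<open>The root vector is a word applied to the generator of some \<open>i\<close> outside \<open>J0\<close>; the factorisation of
  words into brackets and a word in \<open>J0\<close>, applied to the adjoint representation, splits the root.\<close>
lemma pos_root_sum_outer:
  assumes \<beta>: "\<beta> \<in> pos_roots L - pos_roots_on L J" and J0: "J0 \<subseteq> J"
  shows "\<exists>bs. set bs \<subseteq> outer_roots A J0 \<and> \<beta> = ad.wgt (sum_list bs)"
proof -
  obtain w l where w: "ad'.Fw w (chev_e L l) \<noteq> 0" "\<beta> = ad.wgt (add_mset l (mset w))"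
    using pos_root_word \<beta> by blast
  have "\<beta> \<notin> int_lattice (sroot L ` J)" using \<beta> by (simp add: pos_roots_on_def)
  then have "\<not> set_mset (add_mset l (mset w)) \<subseteq> J"
    using w(2) wgt_in_nat_cone nat_cone_subset_int_lattice by blast
  then have "\<not> set_mset (add_mset l (mset w)) \<subseteq> J0" using J0 by blast
  from e_word_end_outside[OF w(1) this]
  obtain i u where i: "i \<notin> J0" and u: "ad'.Fw u (chev_e L i) \<noteq> 0" "add_mset i (mset u) = add_mset l (mset w)"
    by blast
  from ad'.Fw_decomposition[OF u(1), of J0]
  obtain bs u' where u': "set u' \<subseteq> J0" "ad'.Fw u' (chev_e L i) \<noteq> 0"
    and c: "ad'.bracket_content bs + mset u' = mset u"
    and bs: "\<And>v k. (v, k) \<in> set bs \<Longrightarrow> set v \<subseteq> J0 \<and> k \<notin> J0 \<and> (\<exists>y. ad'.bracket v k y \<noteq> 0)"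
    by metis
  let ?bs = "add_mset i (mset u') # map (\<lambda>(v, k). add_mset k (mset v)) bs"
  have "add_mset k (mset v) \<in> outer_roots A J0" if "(v, k) \<in> set bs" for v k
  proof (rule e_word_outer_root)
    show "ad'.Fw v (chev_e L k) \<noteq> 0" using bs[OF that] by (auto simp: bracket_e)
  qed (use bs[OF that] in auto)
  then have "set ?bs \<subseteq> outer_roots A J0" using e_word_outer_root[OF i u'] by auto
  moreover have "sum_list ?bs = add_mset l (mset w)"
    using c u(2) by (simp add: ad'.bracket_content_def add.commute)
  ultimately show ?thesis using w(2) by metis
qed

end

lemma sum_monomials: "(\<Sum>w\<in>Poly_Mapping.keys t. Poly_Mapping.single w (Poly_Mapping.lookup t w)) = t"
proof (rule poly_mapping_eqI)
  fix k
  have "Poly_Mapping.lookup (\<Sum>w\<in>Poly_Mapping.keys t. Poly_Mapping.single w (Poly_Mapping.lookup t w)) k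
      = (\<Sum>w\<in>Poly_Mapping.keys t. if w = k then Poly_Mapping.lookup t w else 0)"
    by (simp add: lookup_sum lookup_single when_def)
  also have "\<dots> = Poly_Mapping.lookup t k" by (simp add: sum.delta in_keys_iff)
  finally show "Poly_Mapping.lookup (\<Sum>w\<in>Poly_Mapping.keys t. Poly_Mapping.single w (Poly_Mapping.lookup t w)) k = Poly_Mapping.lookup t k" .
qed

lemma word_act_word: "word_act x (word w) = word (x # w)"
  by (simp add: word_act_def word_def)

lemma word_scale_word: "word_scale c (word w) = Poly_Mapping.single w c"
  unfolding word_scale_def word_def
  by (rule poly_mapping_eqI) (simp add: Poly_Mapping.map.rep_eq lookup_single when_def)

text \<open>The image of the empty word is the highest weight vector.\<close>
lemma highest_weight_module_vector:
  fixes L :: "('h::ab_group_add, 'i, 'g::ab_group_add) km_data" and V :: "('g, 'v::ab_group_add) module_data"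
  assumes V: "highest_weight_module L \<Lambda> V"
  shows "\<exists>v. v \<noteq> 0 \<and> (\<forall>i. act V (chev_e L i) v = 0) \<and> (\<forall>h. act V (hemb L h) v = mscale V (\<Lambda> h) v)
    \<and> (\<forall>S. module.subspace (mscale V) S \<longrightarrow> (\<forall>x. \<forall>y\<in>S. act V x y \<in> S) \<longrightarrow> v \<in> S \<longrightarrow> S = UNIV)"
proof -
  have M: "lie_module L V" and nz: "\<exists>v :: 'v. v \<noteq> 0"
    and ex: "\<exists>\<pi>. Vector_Spaces.linear word_scale (mscale V) \<pi> \<and>
        (\<forall>x t. \<pi> (word_act x t) = act V x (\<pi> t)) \<and> (\<forall>t\<in>verma_kernel L \<Lambda>. \<pi> t = 0) \<and> surj \<pi>"
    using V unfolding highest_weight_module_def by simp_all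
  from ex obtain \<pi> where \<pi>: "Vector_Spaces.linear word_scale (mscale V) \<pi> \<and>
        (\<forall>x t. \<pi> (word_act x t) = act V x (\<pi> t)) \<and> (\<forall>t\<in>verma_kernel L \<Lambda>. \<pi> t = 0) \<and> surj \<pi>" ..
  then have lin: "Vector_Spaces.linear word_scale (mscale V) \<pi>"
    and hom: "\<And>x t. \<pi> (word_act x t) = act V x (\<pi> t)"
    and ker: "\<And>t. t \<in> verma_kernel L \<Lambda> \<Longrightarrow> \<pi> t = 0" and surj: "surj \<pi>"
    by simp_all
  interpret M: lie_module L V by fact
  interpret W: vector_space "word_scale :: complex \<Rightarrow> ('g list \<Rightarrow>\<^sub>0 complex) \<Rightarrow> _" using lin by (simp add: Vector_Spaces.linear_iff)
  have mh: "module_hom word_scale (mscale V) \<pi>" using lin by (simp add: module_hom_iff_linear)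
  define v where "v = \<pi> (word [])"
  have rel: "\<pi> t = 0" if "t \<in> verma_relations L \<Lambda>" for t
    using ker that unfolding verma_kernel_def by (simp add: W.span_base)
  have e: "act V (chev_e L i) v = 0" for i
  proof -
    have "chev_e L i \<in> n_plus L" by (auto simp: n_plus_def lie_generated_def)
    then have "word ([] @ [chev_e L i]) \<in> verma_relations L \<Lambda>" unfolding verma_relations_def by blast
    from rel[OF this] show ?thesis using hom[of "chev_e L i" "word []"] by (simp add: v_def word_act_word)
  qed
  have h: "act V (hemb L h) v = mscale V (\<Lambda> h) v" for h
  proof -
    have "word ([] @ [hemb L h]) - word_scale (\<Lambda> h) (word []) \<in> verma_relations L \<Lambda>"
      unfolding verma_relations_def by blast
    from rel[OF this] have "\<pi> (word [hemb L h]) = mscale V (\<Lambda> h) v"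
      by (simp add: v_def module_hom.diff[OF mh] module_hom.scale[OF mh])
    then show ?thesis using hom[of "hemb L h" "word []"] by (simp add: v_def word_act_word)
  qed
  have gen: "S = UNIV" if S: "M.subspace S" "\<forall>x. \<forall>y\<in>S. act V x y \<in> S" "v \<in> S" for S
  proof -
    have words: "\<pi> (word w) \<in> S" for w
    proof (induction w)
      case (Cons x w)
      then show ?case using S(2) hom[of x "word w"] by (simp add: word_act_word)
    qed (use S(3) in \<open>simp add: v_def\<close>)
    have "\<pi> t \<in> S" for t
    proof -
      have "\<pi> t = (\<Sum>w\<in>Poly_Mapping.keys t. \<pi> (Poly_Mapping.single w (Poly_Mapping.lookup t w)))"
        by (subst (1) sum_monomials[symmetric]) (rule module_hom.sum[OF mh])
      also have "\<dots> = (\<Sum>w\<in>Poly_Mapping.keys t. mscale V (Poly_Mapping.lookup t w) (\<pi> (word w)))"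
        by (simp add: word_scale_word[symmetric] module_hom.scale[OF mh])
      also have "\<dots> \<in> S" using S(1) words by (intro M.subspace_sum M.subspace_scale)
      finally show ?thesis .
    qed
    then show ?thesis using surj by (metis UNIV_eq_I surjD)
  qed
  have "v \<noteq> 0"
  proof
    assume "v = 0"
    then have "{0} = (UNIV :: 'v set)"
      by (intro gen) (auto simp: M.subspace_single_0 M.act_linear[unfolded Vector_Spaces.linear_iff]
          intro: module_hom.zero[OF M.act_linear[folded module_hom_iff_linear]])
    then show False using nz by (metis UNIV_I singletonD)
  qed
  then show ?thesis using e h gen by blast
qed

section \<open>Weights of highest weight modules\<close>

lemma minkowski_diffI: "c \<in> C \<Longrightarrow> d \<in> D \<Longrightarrow> (\<lambda>h. c h - d h) \<in> C \<ominus> D"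
  unfolding minkowski_diff_def by blast

lemma minkowski_diffE:
  assumes "\<mu> \<in> C \<ominus> D"
  obtains c d where "c \<in> C" "d \<in> D" "\<mu> = (\<lambda>h. c h - d h)"
  using assms unfolding minkowski_diff_def by blast

locale highest_weight_vector = kac_moody_algebra A L + V: lie_module L V
  for A :: "int^'i::finite^'i"
  and L :: "('h::ab_group_add, 'i, 'g::ab_group_add) km_data"
  and V :: "('g, 'v::ab_group_add) module_data" +
  fixes \<Lambda> :: "'h \<Rightarrow> complex" and v :: 'v
  assumes \<Lambda>: "\<Lambda> \<in> hdual L"
    and v: "v \<noteq> 0" "\<And>i. act V (chev_e L i) v = 0" "\<And>h. act V (hemb L h) v = mscale V (\<Lambda> h) v"
    and cyclic: "V.subspace S \<Longrightarrow> (\<And>x y. y \<in> S \<Longrightarrow> act V x y \<in> S) \<Longrightarrow> v \<in> S \<Longrightarrow> S = UNIV"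
begin

sublocale O: chevalley_operators "mscale V" A "sroot L" "scoroot L"
    "\<lambda>i. act V (chev_e L i)" "\<lambda>i. act V (chev_f L i)" "\<lambda>h. act V (hemb L h)"
  by (rule chevalley_operators_of_module[OF kac_moody_algebra_axioms V.lie_module_axioms])

abbreviation C :: "'i multiset set" where "C \<equiv> O.contents UNIV {0} v"

lemma hw: "O.hw UNIV {0} \<Lambda> v"
  using v O.stable_zero by (simp add: O.hw_def)

lemma words_span: "y \<in> V.span {O.Fw w v | w. set w \<subseteq> UNIV}"
proof -
  let ?S = "V.span {O.Fw w v | w. set w \<subseteq> UNIV}"
  have st: "O.stable UNIV ?S" by (rule O.stable_span_words[OF hw])
  have "?S = UNIV"
  proof (rule cyclic)
    show "act V x y \<in> ?S" if "y \<in> ?S" for x y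
      by (rule generators_act[OF V.lie_module_axioms _ _ _ _ that]) (use O.stableD[OF st] in auto)
    show "v \<in> ?S" by (intro V.span_base CollectI exI[of _ "[]"]) simp
  qed simp
  then show ?thesis by simp
qed

definition weight_of :: "'i multiset \<Rightarrow> 'h \<Rightarrow> complex" where
  "weight_of c = (\<lambda>h. \<Lambda> h - ad.wgt c h)"

lemma weight_of_inj: "weight_of c = weight_of d \<longleftrightarrow> c = d"
proof
  assume eq: "weight_of c = weight_of d"
  have "ad.wgt c h = ad.wgt d h" for h using fun_cong[OF eq, of h] by (simp add: weight_of_def)
  then show "c = d" by (rule ad.wgt_eqD)
qed simp

lemma weights_contents: "weights L V = weight_of ` C"
proof (intro equalityI subsetI)
  fix \<mu> assume "\<mu> \<in> weights L V"
  then obtain y where y: "y \<noteq> 0" "\<And>h. act V (hemb L h) y = mscale V (\<mu> h) y"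
    by (auto simp: weights_def)
  have "\<exists>b\<in>{O.Fw w v | w. set w \<subseteq> UNIV}. b \<notin> {0} \<and> (\<forall>h. act V (hemb L h) b = mscale V (\<mu> h) b)"
  proof (rule O.weight_component_vector[OF _ _ y(2) _ _ words_span[of y]])
    fix b assume "b \<in> {O.Fw w v | w. set w \<subseteq> UNIV}"
    then obtain w where b: "b = O.Fw w v" by blast
    show "\<exists>\<nu>. \<forall>h. act V (hemb L h) b = mscale V (\<nu> h) b"
      unfolding b by (rule exI, rule allI, rule O.hw_T_Fw[OF hw])
  qed (use y in auto)
  then obtain w where w: "O.Fw w v \<noteq> 0" "\<And>h. act V (hemb L h) (O.Fw w v) = mscale V (\<mu> h) (O.Fw w v)"
    by blast
  have "\<mu> h = weight_of (mset w) h" for h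
    unfolding weight_of_def by (rule O.weight_unique[OF w(1) w(2) O.hw_T_Fw[OF hw]])
  moreover have "mset w \<in> C" using w(1) by (auto simp: O.contents_def)
  ultimately show "\<mu> \<in> weight_of ` C" by blast
next
  fix \<mu> assume "\<mu> \<in> weight_of ` C"
  then obtain w where w: "O.Fw w v \<noteq> 0" and \<mu>: "\<mu> = weight_of (mset w)" by (auto simp: O.contents_def)
  have "\<mu> \<in> hdual L"
    using \<Lambda> wgt_hdual[of "mset w"] by (simp add: \<mu> weight_of_def hdual_iff right_diff_distrib)
  then show "\<mu> \<in> weights L V"
    using w O.hw_T_Fw[OF hw, of _ w] by (auto simp: weights_def \<mu> weight_of_def)
qed

lemma weight_of_in_weights: "weight_of c \<in> weights L V \<longleftrightarrow> c \<in> C"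
  unfolding weights_contents using weight_of_inj by auto

lemma minkowski_cone: "{\<Lambda>} \<ominus> nat_cone (sroot L ` J) = weight_of ` {c. set_mset c \<subseteq> J}"
proof (intro equalityI subsetI)
  fix \<mu> assume "\<mu> \<in> {\<Lambda>} \<ominus> nat_cone (sroot L ` J)"
  then obtain \<beta> where "\<beta> \<in> nat_cone (sroot L ` J)" "\<mu> = (\<lambda>h. \<Lambda> h - \<beta> h)"
    by (auto simp: minkowski_diff_def)
  moreover from this(1) obtain c where "set_mset c \<subseteq> J" "\<beta> = ad.wgt c" using nat_cone_wgt by blast
  ultimately show "\<mu> \<in> weight_of ` {c. set_mset c \<subseteq> J}"
    by (intro image_eqI[of _ _ c]) (simp_all add: weight_of_def)
next
  fix \<mu> assume "\<mu> \<in> weight_of ` {c. set_mset c \<subseteq> J}"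
  then obtain c where c: "set_mset c \<subseteq> J" "\<mu> = weight_of c" by blast
  show "\<mu> \<in> {\<Lambda>} \<ominus> nat_cone (sroot L ` J)"
    unfolding minkowski_diff_def c(2) weight_of_def
    by (intro CollectI exI[of _ \<Lambda>] exI[of _ "ad.wgt c"] conjI refl singletonI wgt_in_nat_cone[OF c(1)])
qed

lemma J_wt_dominant: "J_wt L \<Lambda> = O.dominant_nodes \<Lambda>"
  by (simp add: J_wt_def O.dominant_nodes_def)

lemma shifted_wt_corner:
  assumes "I \<subseteq> O.dominant_nodes \<Lambda>"
  shows "shifted_wt L \<Lambda> I = weight_of (corner (O.exponent \<Lambda>) I)"
proof -
  have "(\<Sum>i\<in>I. (\<Lambda> (scoroot L i) + 1) * sroot L i h) = ad.wgt (corner (O.exponent \<Lambda>) I) h" for h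
    unfolding wgt_corner[OF ad.chevalley_operators_axioms]
    using assms O.dominant_nodesD(5)[of _ \<Lambda>] by (intro sum.cong) auto
  then show ?thesis by (simp add: shifted_wt_def weight_of_def)
qed

abbreviation JV :: "'i set" where "JV \<equiv> J_mod A L \<Lambda> V"

lemma J_mod_iff:
  "i \<in> JV \<longleftrightarrow> (\<exists>I. i \<in> I \<and> I \<subseteq> O.dominant_nodes \<Lambda> \<and> independent_nodes A I
     \<and> corner (O.exponent \<Lambda>) I \<notin> C \<and> (\<forall>K. K \<subset> I \<longrightarrow> corner (O.exponent \<Lambda>) K \<in> C))"
proof -
  have *: "shifted_wt L \<Lambda> I \<in> weights L V \<longleftrightarrow> corner (O.exponent \<Lambda>) I \<in> C"
    if "I \<subseteq> O.dominant_nodes \<Lambda>" for I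
    using shifted_wt_corner[OF that] weight_of_in_weights by simp
  have "(shifted_wt L \<Lambda> I \<notin> weights L V \<and> (\<forall>K. K \<subset> I \<longrightarrow> shifted_wt L \<Lambda> K \<in> weights L V))
      \<longleftrightarrow> (corner (O.exponent \<Lambda>) I \<notin> C \<and> (\<forall>K. K \<subset> I \<longrightarrow> corner (O.exponent \<Lambda>) K \<in> C))"
    if I: "I \<subseteq> O.dominant_nodes \<Lambda>" for I
  proof -
    have "shifted_wt L \<Lambda> K \<in> weights L V \<longleftrightarrow> corner (O.exponent \<Lambda>) K \<in> C" if "K \<subset> I" for K
      using that I by (intro *) auto
    then show ?thesis using *[OF I] by simp
  qed
  then have "J_mod A L \<Lambda> V = \<Union>{I. I \<subseteq> O.dominant_nodes \<Lambda> \<and> independent_nodes A I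
     \<and> corner (O.exponent \<Lambda>) I \<notin> C \<and> (\<forall>K. K \<subset> I \<longrightarrow> corner (O.exponent \<Lambda>) K \<in> C)}"
    unfolding J_mod_def J_wt_dominant
    by (simp cong: conj_cong)
  then show ?thesis by (simp only: Union_iff mem_Collect_eq Bex_def) (simp only: conj_commute conj_left_commute)
qed

lemma minimal_nonweight:
  assumes I: "I \<subseteq> O.dominant_nodes \<Lambda>" "independent_nodes A I" "corner (O.exponent \<Lambda>) I \<notin> C"
  shows "\<exists>I'\<subseteq>I \<inter> JV. corner (O.exponent \<Lambda>) I' \<notin> C"
proof -
  have "finite I" by simp
  then obtain I' where I': "I' \<subseteq> I" "corner (O.exponent \<Lambda>) I' \<notin> C"
    and min: "\<And>K. K \<subset> I' \<Longrightarrow> corner (O.exponent \<Lambda>) K \<in> C"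
    using I(3)
  proof (induction I arbitrary: thesis rule: finite_psubset_induct)
    case (psubset I)
    show ?case
    proof (cases "\<exists>K. K \<subset> I \<and> corner (O.exponent \<Lambda>) K \<notin> C")
      case True
      then obtain K where K: "K \<subset> I" "corner (O.exponent \<Lambda>) K \<notin> C" by blast
      show ?thesis by (rule psubset.IH[OF K(1) _ K(2)]) (use psubset.prems(1) K(1) in blast)
    next
      case False
      then show ?thesis using psubset.prems by blast
    qed
  qed
  have "independent_nodes A I'" using I(2) I'(1) by (auto simp: independent_nodes_def)
  then have "I' \<subseteq> JV" using I' I(1) min
    by (intro subsetI J_mod_iff[THEN iffD2] exI[of _ I']) auto
  then show ?thesis using I' by blast
qed

lemma closed_region:
  assumes "c \<in> C"
  obtains J R where "J \<subseteq> JV" "c \<in> R" "R \<subseteq> C" "\<forall>d\<in>R. \<forall>b\<in>outer_roots A J. d + b \<in> R"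
proof -
  have "\<exists>J R. J \<subseteq> JV \<and> c \<in> R \<and> R \<subseteq> C \<and> (\<forall>c\<in>R. \<forall>b\<in>outer_roots A J. c + b \<in> R)"
  proof (rule O.contents_closed_region[OF hw _ assms])
    show "\<exists>I'\<subseteq>I \<inter> JV. corner (O.exponent \<Lambda>) I' \<notin> C"
      if "I \<subseteq> O.dominant_nodes \<Lambda>" "independent_nodes A I" "corner (O.exponent \<Lambda>) I \<notin> C" for I
      using that by (rule minimal_nonweight)
  qed
  then show thesis using that by (elim exE conjE) simp
qed

text \<open>A region \<open>P(J0)\<close> with \<open>J0\<close> inside \<open>J_V\<close> contains the weight, and the root is a sum of outer roots
  of \<open>J0\<close>.\<close>
lemma weights_minus_pos_root:
  assumes J: "JV \<subseteq> J" and \<beta>: "\<beta> \<in> pos_roots L - pos_roots_on L J" and \<mu>: "\<mu> \<in> weights L V"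
  shows "(\<lambda>h. \<mu> h - \<beta> h) \<in> weights L V"
proof -
  obtain c where c: "c \<in> C" "\<mu> = weight_of c" using \<mu> weights_contents by auto
  obtain J0 R where J0: "J0 \<subseteq> JV" and R: "c \<in> R" "R \<subseteq> C"
    and closed: "\<forall>d\<in>R. \<forall>b\<in>outer_roots A J0. d + b \<in> R"
    by (rule closed_region[OF c(1)])
  obtain bs where bs: "set bs \<subseteq> outer_roots A J0" "\<beta> = ad.wgt (sum_list bs)"
    using pos_root_sum_outer[OF \<beta>, of J0] J0 J by blast
  have "c + sum_list bs \<in> R" using bs(1) R(1)
  proof (induction bs arbitrary: c)
    case (Cons b bs)
    then have "c + b \<in> R" using closed by auto
    then show ?case using Cons.IH[of "c + b"] Cons.prems by (simp add: add.assoc)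
  qed simp
  then have "weight_of (c + sum_list bs) \<in> weights L V" using R(2) weight_of_in_weights by blast
  moreover have "weight_of (c + sum_list bs) = (\<lambda>h. \<mu> h - \<beta> h)"
    by (simp add: weight_of_def c(2) bs(2) diff_diff_eq fun_eq_iff)
  ultimately show ?thesis by simp
qed

lemma contents_decomposition:
  assumes "c \<in> C"
  shows "\<exists>d bs. set_mset d \<subseteq> J \<and> d \<in> C \<and> set bs \<subseteq> outer_roots A J \<and> c = d + sum_list bs"
proof -
  obtain w where w: "O.Fw w v \<noteq> 0" "mset w = c" using assms by (auto simp: O.contents_def)
  from O.Fw_decomposition[OF w(1), of J]
  obtain bs u where u: "set u \<subseteq> J" "O.Fw u v \<noteq> 0" and c: "O.bracket_content bs + mset u = mset w"
    and bs: "\<And>x k. (x, k) \<in> set bs \<Longrightarrow> set x \<subseteq> J \<and> k \<notin> J \<and> (\<exists>y. O.bracket x k y \<noteq> 0)"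
    by metis
  have "add_mset k (mset x) \<in> outer_roots A J" if "(x, k) \<in> set bs" for x k
  proof (rule f_word_outer_root)
    show "ad.Fw x (chev_f L k) \<noteq> 0"
      using bs[OF that] by (auto simp: bracket_f[OF V.lie_module_axioms] V.act_zero_left)
  qed (use bs[OF that] in auto)
  then have "set (map (\<lambda>(x, k). add_mset k (mset x)) bs) \<subseteq> outer_roots A J" by auto
  moreover have "c = mset u + sum_list (map (\<lambda>(x, k). add_mset k (mset x)) bs)"
    using c w(2) by (simp add: O.bracket_content_def add.commute)
  moreover have "mset u \<in> C" using u(2) by (auto simp: O.contents_def)
  ultimately show ?thesis using u(1) by (metis set_mset_mset)
qed

lemma weights_subset:
  "weights L V \<subseteq> (weights L V \<inter> ({\<Lambda>} \<ominus> nat_cone (sroot L ` J))) \<ominus> nat_cone (pos_roots L - pos_roots_on L J)"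
proof
  fix \<mu> assume "\<mu> \<in> weights L V"
  then obtain c where c: "c \<in> C" "\<mu> = weight_of c" using weights_contents by auto
  obtain d bs where d: "set_mset d \<subseteq> J" "d \<in> C" and bs: "set bs \<subseteq> outer_roots A J" and c': "c = d + sum_list bs"
    using contents_decomposition[OF c(1)] by blast
  have start: "weight_of d \<in> weights L V \<inter> ({\<Lambda>} \<ominus> nat_cone (sroot L ` J))"
    using d by (auto simp: weight_of_in_weights minkowski_cone)
  have cone: "ad.wgt (sum_list bs) \<in> nat_cone (pos_roots L - pos_roots_on L J)"
    using bs
  proof (induction bs)
    case Nil
    then show ?case by (simp add: wgt_add nat_cone_zero)
  next
    case (Cons b bs)
    then have "(\<lambda>h. ad.wgt b h + ad.wgt (sum_list bs) h) \<in> nat_cone (pos_roots L - pos_roots_on L J)"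
      by (intro nat_cone_add outer_root_pos_root) auto
    then show ?case by (simp add: wgt_add)
  qed
  have \<mu>: "\<mu> = (\<lambda>h. weight_of d h - ad.wgt (sum_list bs) h)"
    by (simp add: c(2) c' weight_of_def fun_eq_iff)
  show "\<mu> \<in> (weights L V \<inter> ({\<Lambda>} \<ominus> nat_cone (sroot L ` J))) \<ominus> nat_cone (pos_roots L - pos_roots_on L J)"
    unfolding \<mu> by (rule minkowski_diffI[OF start cone])
qed

text \<open>For the converse direction, the right-hand side is closed under subtracting simple roots of
  nodes outside \<open>J\<close>. So a minimal \<open>I\<close> with missing corner cannot contain such a node \<open>i\<close>: its
  corner would be reached from that of \<open>I - {i}\<close>.\<close>
lemma decomposition_iff:
  "weights L V = (weights L V \<inter> ({\<Lambda>} \<ominus> nat_cone (sroot L ` J))) \<ominus> nat_cone (pos_roots L - pos_roots_on L J)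
    \<longleftrightarrow> JV \<subseteq> J"
proof
  let ?W = "weights L V" and ?S = "pos_roots L - pos_roots_on L J"
  let ?R = "(?W \<inter> ({\<Lambda>} \<ominus> nat_cone (sroot L ` J))) \<ominus> nat_cone ?S"
  assume J: "JV \<subseteq> J"
  have "?R \<subseteq> ?W"
  proof
    fix \<mu> assume "\<mu> \<in> ?R"
    then obtain \<nu> \<gamma> where \<nu>: "\<nu> \<in> ?W \<inter> ({\<Lambda>} \<ominus> nat_cone (sroot L ` J))" and \<gamma>: "\<gamma> \<in> nat_cone ?S" and \<mu>: "\<mu> = (\<lambda>h. \<nu> h - \<gamma> h)"
      by (rule minkowski_diffE)
    have "(\<lambda>h. \<nu> h - \<gamma> h) \<in> ?W" using \<gamma>
    proof (induction rule: nat_cone_induct)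
      case (add \<beta> \<gamma>)
      then show ?case using weights_minus_pos_root[OF J add(1,2)] by (simp add: diff_diff_eq add.commute)
    qed (use \<nu> in simp)
    then show "\<mu> \<in> ?W" by (simp add: \<mu>)
  qed
  then show "?W = ?R" using weights_subset by blast
next
  let ?W = "weights L V" and ?S = "pos_roots L - pos_roots_on L J"
  assume eq: "?W = (?W \<inter> ({\<Lambda>} \<ominus> nat_cone (sroot L ` J))) \<ominus> nat_cone ?S"
  have step: "add_mset i c \<in> C" if c: "c \<in> C" and i: "i \<notin> J" for c i
  proof -
    have "weight_of c \<in> ?W" using c weight_of_in_weights by simp
    from subsetD[OF equalityD1[OF eq] this]
    obtain \<nu> \<gamma> where \<nu>: "\<nu> \<in> ?W \<inter> ({\<Lambda>} \<ominus> nat_cone (sroot L ` J))" and \<gamma>: "\<gamma> \<in> nat_cone ?S"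
      and \<mu>: "weight_of c = (\<lambda>h. \<nu> h - \<gamma> h)"
      by (rule minkowski_diffE)
    have "{#i#} \<in> outer_roots A J" using i reach.empty unfolding outer_roots_def by blast
    then have "sroot L i \<in> ?S" using outer_root_pos_root[of "{#i#}" J] by (simp add: wgt_add)
    then have "(\<lambda>h. sroot L i h + \<gamma> h) \<in> nat_cone ?S" using \<gamma> by (rule nat_cone_add)
    then have "(\<lambda>h. \<nu> h - (sroot L i h + \<gamma> h)) \<in> ?W"
      by (rule subsetD[OF equalityD2[OF eq] minkowski_diffI[OF \<nu>]])
    moreover have "weight_of (add_mset i c) = (\<lambda>h. \<nu> h - (sroot L i h + \<gamma> h))"
    proof (rule ext)
      fix h
      have "weight_of c h = \<nu> h - \<gamma> h" by (rule fun_cong[OF \<mu>])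
      then show "weight_of (add_mset i c) h = \<nu> h - (sroot L i h + \<gamma> h)"
        unfolding weight_of_def by simp
    qed
    ultimately have "weight_of (add_mset i c) \<in> ?W" by (simp only:)
    then show ?thesis by (simp only: weight_of_in_weights)
  qed
  show "JV \<subseteq> J"
  proof
    fix i assume "i \<in> JV"
    then obtain I where I: "i \<in> I" "corner (O.exponent \<Lambda>) I \<notin> C"
      and min: "\<And>K. K \<subset> I \<Longrightarrow> corner (O.exponent \<Lambda>) K \<in> C"
      unfolding J_mod_iff by blast
    show "i \<in> J"
    proof (rule ccontr)
      assume i: "i \<notin> J"
      have "replicate_mset n i + corner (O.exponent \<Lambda>) (I - {i}) \<in> C" for n
      proof (induction n)
        case 0
        then show ?case using min[of "I - {i}"] I(1) by auto
      qed (use step i in simp)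
      moreover have "corner (O.exponent \<Lambda>) I = replicate_mset (O.exponent \<Lambda> i) i + corner (O.exponent \<Lambda>) (I - {i})"
        using corner_insert[of i "I - {i}" "O.exponent \<Lambda>"] I(1) by (simp add: insert_absorb)
      ultimately show False using I(2) by metis
    qed
  qed
qed

lemma full_cone:
  assumes "J \<subseteq> - JV"
  shows "{\<Lambda>} \<ominus> nat_cone (sroot L ` J) \<subseteq> weights L V"
proof -
  have "{#} \<in> C" using v(1) by (auto simp: O.contents_def intro!: exI[of _ "[]"])
  then obtain J0 R where J0: "J0 \<subseteq> JV" and R: "{#} \<in> R" "R \<subseteq> C"
    and closed: "\<forall>d\<in>R. \<forall>b\<in>outer_roots A J0. d + b \<in> R"
    by (rule closed_region)
  have "c \<in> R" if "set_mset c \<subseteq> J" for c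
    using that
  proof (induction c)
    case (add i c)
    then have "i \<notin> J0" using assms J0 by auto
    then have "{#i#} \<in> outer_roots A J0" using reach.empty unfolding outer_roots_def by blast
    then show ?case using bspec[OF bspec[OF closed, of c], of "{#i#}"] add by simp
  qed (rule R(1))
  then have "set_mset c \<subseteq> J \<Longrightarrow> c \<in> C" for c using R(2) by blast
  then show ?thesis by (auto simp: minkowski_cone weight_of_in_weights)
qed

end

theorem theoremC:
  fixes A :: "int^'i::finite^'i"
    and L :: "('h::ab_group_add, 'i, 'g::ab_group_add) km_data"
    and V :: "('g, 'v::ab_group_add) module_data"
    and \<Lambda> :: "'h \<Rightarrow> complex"
  assumes "kac_moody_algebra A L"
    and "\<Lambda> \<in> hdual L"
    and "highest_weight_module L \<Lambda> V"
  shows "weights L V =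
           (weights L V \<inter> ({\<Lambda>} \<ominus> nat_cone (sroot L ` J_mod A L \<Lambda> V)))
             \<ominus> nat_cone (pos_roots L - pos_roots_on L (J_mod A L \<Lambda> V))
    \<and> (\<forall>J. weights L V =
           (weights L V \<inter> ({\<Lambda>} \<ominus> nat_cone (sroot L ` J)))
             \<ominus> nat_cone (pos_roots L - pos_roots_on L J)
         \<longleftrightarrow> J \<supseteq> J_mod A L \<Lambda> V)
    \<and> {J. weights L V =
           (weights L V \<inter> ({\<Lambda>} \<ominus> nat_cone (sroot L ` J)))
             \<ominus> nat_cone (pos_roots L - pos_roots_on L J)} = {J_mod A L \<Lambda> V..UNIV}
    \<and> (\<forall>J. J \<subseteq> - J_mod A L \<Lambda> V \<longrightarrow> {\<Lambda>} \<ominus> nat_cone (sroot L ` J) \<subseteq> weights L V)"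
proof -
  obtain v where v: "v \<noteq> 0" "\<forall>i. act V (chev_e L i) v = 0" "\<forall>h. act V (hemb L h) v = mscale V (\<Lambda> h) v"
    and cyclic: "\<forall>S. module.subspace (mscale V) S \<longrightarrow> (\<forall>x. \<forall>y\<in>S. act V x y \<in> S) \<longrightarrow> v \<in> S \<longrightarrow> S = UNIV"
    using highest_weight_module_vector[OF assms(3)] by blast
  interpret highest_weight_vector A L V \<Lambda> v
  proof (intro highest_weight_vector.intro highest_weight_vector_axioms.intro)
    show "lie_module L V" using assms(3) by (simp add: highest_weight_module_def)
  qed (use assms v cyclic in auto)
  have interval: "{J. JV \<subseteq> J} = {JV..UNIV}" by auto
  show ?thesis
    unfolding decomposition_iff using full_cone interval by simp
qed


end
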